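(* Let $d\geq 3$ be a fixed integer, and let $Y_{\mathcal{G}}$ denote the number of spanning trees of a uniformly random $d$-regular simple graph on the vertex set $\{1,\ldots,n\}$. Then, as $n\to\infty$ (restricted to even $n$ when $d$ is odd), \[ \mathbb{E} Y_{\mathcal{G}} \sim \exp\left(\frac{6d^{2}-14d+7}{4\left(d-1\right)^{2}}\right)\, \frac{\left(d-1\right)^{1/2}}{n\left(d-2\right)^{3/2}}\, \left(\frac{\left(d-1\right)^{d-1}}{\left(d^{2}-2d\right)^{d/2-1}} \right)^{n}. \]
   Context: The random graph is drawn uniformly from the set of all $d$-regular simple graphs (no loops, no multiple edges) on vertex set $\{1,\ldots,n\}$. *)

theory Defs
  imports "HOL-Probability.Probability" "HOL-Library.Landau_Symbols"
begin

text \<open>A simple graph on the vertex set \<open>V\<close> is given by its edge set, a set of two-element subsets of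
  \<open>V\<close>; this excludes loops and multiple edges.\<close>

definition simple_graphs :: "'a set \<Rightarrow> 'a set set set" where
  "simple_graphs V = {E. E \<subseteq> {e. e \<subseteq> V \<and> card e = 2}}"

definition graph_degree :: "'a set set \<Rightarrow> 'a \<Rightarrow> nat" where
  "graph_degree E v = card {e \<in> E. v \<in> e}"

definition regular_graphs :: "nat \<Rightarrow> 'a set \<Rightarrow> 'a set set set" where
  "regular_graphs d V = {E \<in> simple_graphs V. \<forall>v\<in>V. graph_degree E v = d}"

definition graph_connected :: "'a set \<Rightarrow> 'a set set \<Rightarrow> bool" where
  "graph_connected V E \<longleftrightarrow> V \<noteq> {} \<and> (\<forall>u\<in>V. \<forall>v\<in>V. (u, v) \<in> {(x, y). {x, y} \<in> E}\<^sup>*)"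

text \<open>A cycle is listed by its successive distinct vertices; the \<open>mod\<close> closes it up.\<close>

definition graph_cycle :: "'a set set \<Rightarrow> 'a list \<Rightarrow> bool" where
  "graph_cycle E vs \<longleftrightarrow> length vs \<ge> 3 \<and> distinct vs \<and>
     (\<forall>i<length vs. {vs ! i, vs ! (Suc i mod length vs)} \<in> E)"

definition graph_tree :: "'a set \<Rightarrow> 'a set set \<Rightarrow> bool" where
  "graph_tree V E \<longleftrightarrow> E \<in> simple_graphs V \<and> graph_connected V E \<and> (\<nexists>vs. graph_cycle E vs)"

text \<open>A spanning subgraph has all of \<open>V\<close> as its vertices, so it is determined by its edge set.\<close>

definition spanning_trees :: "'a set \<Rightarrow> 'a set set \<Rightarrow> 'a set set set" where
  "spanning_trees V E = {T. T \<subseteq> E \<and> graph_tree V T}"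

text \<open>The value is meaningful only if \<open>d\<close>-regular graphs on \<open>{1..n}\<close> exist, since \<open>pmf_of_set {}\<close> is
  unspecified.\<close>

definition random_regular_graph :: "nat \<Rightarrow> nat \<Rightarrow> nat set set pmf" where
  "random_regular_graph d n = pmf_of_set (regular_graphs d {1..n})"

definition expected_spanning_trees :: "nat \<Rightarrow> nat \<Rightarrow> real" where
  "expected_spanning_trees d n =
     measure_pmf.expectation (random_regular_graph d n) (\<lambda>E. real (card (spanning_trees {1..n} E)))"

end

theory Submission
  imports Defs "HOL-Real_Asymp.Real_Asymp"
begin

text \<open>
  The expectation is the sum over all trees \<open>T\<close> of the number of \<open>d\<close>-regular graphs containing \<open>T\<close>,
  divided by the number of all \<open>d\<close>-regular graphs. Removing \<open>T\<close> turns the former into the number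
  of simple graphs with degrees \<open>r v = d - deg T v\<close> and no edge in \<open>T\<close>.

  Such graphs are counted in the configuration model. With \<open>N\<close> half-edges, the numbers of loops, of
  double edges and of edges in a forbidden graph \<open>X\<close> of bounded degree behave like independent
  Poisson variables, whose means are \<open>\<lambda>\<close>, \<open>\<lambda>\<^sup>2\<close> and \<open>\<kappa>\<close>, where \<open>2 N \<lambda>\<close> is the sum of \<open>r v (r v - 1)\<close> and
  \<open>N \<kappa>\<close> is the sum of \<open>r u r v\<close> over the edges \<open>{u, v}\<close> of \<open>X\<close>. So the probability of a simple graph
  avoiding \<open>X\<close> is close to \<open>exp (- \<lambda> - \<lambda>\<^sup>2 - \<kappa>)\<close>, uniformly in \<open>r\<close> and \<open>X\<close>.

  The number of trees with given degrees \<open>\<delta> v\<close> is \<open>(n - 2)!\<close> divided by the product of the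
  \<open>(\<delta> v - 1)!\<close>, so that the degrees of a tree, weighted by its number of occurrences in the
  configuration model, are distributed like the occupation numbers of a random subset of
  \<open>n (d - 1)\<close> points. Second moments show that \<open>\<lambda>\<close> and \<open>\<kappa>\<close> are concentrated under this
  distribution; for \<open>\<kappa>\<close> this needs the number of trees with given degrees that contain two
  given disjoint edges. The exponential factor of the theorem is the quotient of the two Poisson
  probabilities, and the rest is Stirling's formula.
\<close>

section \<open>Weighted multigraphs\<close>

text \<open>The forbidden graph is the tree itself and varies over all trees, so the Poisson
  approximation needs an error that depends only on \<open>d\<close> and the number of half-edges.
  This decides its proof: removing a bad configuration leaves a configuration model with other
  degrees, the class \<open>admissible\<close> is closed under this, and one differential inequality
  is iterated over the whole class at once. An error tending to 0 without a rate is enough, because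
  the pairs (tree, complement) carry nonnegative weights of exactly known total and the limiting
  probability is a positive constant. The weights c^k / k! of a multigraph and the binomial weights
  of a degree sequence serve one purpose: a factor equal to a multiplicity or a degree shifts the
  index by one, so expectations are found by a change of index. \<kappa> is concentrated given the
  degrees: its conditional mean is about (d - 2) ((d - 2) - 2 \<lambda>). In turn \<lambda> is
  concentrated near (d - 2)^2 / (2 (d - 1)), because the random subset has density (d - 2) / (d -
  1).\<close>

definition vertex_pairs :: "'a set \<Rightarrow> 'a set set" where
  "vertex_pairs V = {e. e \<subseteq> V \<and> card e = 2}"

text \<open>A loop at \<open>v\<close> is represented by the singleton \<open>{v}\<close>.\<close>

definition pair_or_loop :: "'a set \<Rightarrow> 'a set set" where
  "pair_or_loop V = (\<lambda>v. {v}) ` V \<union> vertex_pairs V"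

definition incidence :: "'a set \<Rightarrow> 'a \<Rightarrow> nat" where
  "incidence e v = (if v \<in> e then if card e = 1 then 2 else 1 else 0)"

definition multigraphs :: "'a set \<Rightarrow> ('a \<Rightarrow> nat) \<Rightarrow> ('a set \<Rightarrow> nat) set" where
  "multigraphs V r = {m. (\<forall>e. e \<notin> pair_or_loop V \<longrightarrow> m e = 0) \<and>
     (\<forall>v\<in>V. (\<Sum>e\<in>pair_or_loop V. incidence e v * m e) = r v)}"

text \<open>With these weights the multigraphs with degrees \<open>r\<close> have the same distribution as in the
  configuration model: the total weight is the number of perfect matchings of the half-edges,
  divided by the product of the \<open>fact (r v)\<close>.\<close>

definition edge_coeff :: "'a set \<Rightarrow> real" where
  "edge_coeff e = (if card e = 1 then 1/2 else 1)"

text \<open>Permuting the half-edges at each vertex acts transitively on the matchings that realise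
  \<open>m\<close>. The stabiliser has order 2 for each copy of a loop times
  \<open>fact (m e)\<close> for each \<open>e\<close>, so \<open>m\<close> arises from this weight
  times the product of the \<open>fact (r v)\<close> matchings.\<close>

definition mg_weight :: "'a set \<Rightarrow> ('a set \<Rightarrow> nat) \<Rightarrow> real" where
  "mg_weight V m = (\<Prod>e\<in>pair_or_loop V. edge_coeff e ^ m e / fact (m e))"

definition mg_sum :: "'a set \<Rightarrow> ('a \<Rightarrow> nat) \<Rightarrow> (('a set \<Rightarrow> nat) \<Rightarrow> real) \<Rightarrow> real" where
  "mg_sum V r f = (\<Sum>m\<in>multigraphs V r. mg_weight V m * f m)"

text \<open>Subtraction is truncated: these are the degrees after deleting \<open>e\<close> only if
  \<open>e\<close> fits, that is \<open>incidence e v \<le> r v\<close> at every vertex. Where it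
  does not fit, \<open>edge_ways r e\<close> is 0 and hides the wrong value.\<close>

definition drop_edge :: "('a \<Rightarrow> nat) \<Rightarrow> 'a set \<Rightarrow> 'a \<Rightarrow> nat" where
  "drop_edge r e v = r v - incidence e v"

definition add_edge :: "('a set \<Rightarrow> nat) \<Rightarrow> 'a set \<Rightarrow> 'a set \<Rightarrow> nat" where
  "add_edge m e = m(e := Suc (m e))"

lemma finite_vertex_pairs [simp]: "finite V \<Longrightarrow> finite (vertex_pairs V)"
  unfolding vertex_pairs_def by (rule finite_subset[of _ "Pow V"]) auto

lemma finite_pair_or_loop [simp]: "finite V \<Longrightarrow> finite (pair_or_loop V)"
  unfolding pair_or_loop_def by simp

lemma pair_or_loop_cases:
  assumes "e \<in> pair_or_loop V"
  obtains v where "v \<in> V" "e = {v}" | u v where "u \<in> V" "v \<in> V" "u \<noteq> v" "e = {u, v}"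
  using assms unfolding pair_or_loop_def vertex_pairs_def by (auto simp: card_2_iff)

lemma multigraph_le_degree:
  assumes "finite V" "m \<in> multigraphs V r" "e \<in> pair_or_loop V" "v \<in> e"
  shows "m e \<le> r v"
proof -
  have v: "v \<in> V" using assms by (auto simp: pair_or_loop_def vertex_pairs_def)
  have "m e \<le> incidence e v * m e" using assms(4) by (simp add: incidence_def)
  also have "\<dots> \<le> (\<Sum>e\<in>pair_or_loop V. incidence e v * m e)"
    using assms by (intro member_le_sum) auto
  also have "\<dots> = r v" using assms v by (simp add: multigraphs_def)
  finally show ?thesis .
qed

lemma finite_multigraphs [simp]:
  assumes "finite V"
  shows "finite (multigraphs V r)"
proof (rule finite_subset)
  show "multigraphs V r \<subseteq> {m. \<forall>e. (e \<in> pair_or_loop V \<longrightarrow> m e \<in> {..\<Sum>v\<in>V. r v}) \<and>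
      (e \<notin> pair_or_loop V \<longrightarrow> m e = 0)}"
  proof (clarsimp, intro conjI allI impI)
    fix m e assume m: "m \<in> multigraphs V r"
    show "m e = 0" if "e \<notin> pair_or_loop V" using m that by (simp add: multigraphs_def)
    assume e: "e \<in> pair_or_loop V"
    then obtain v where v: "v \<in> e" "v \<in> V" by (cases rule: pair_or_loop_cases) auto
    have "m e \<le> r v" by (rule multigraph_le_degree[OF assms m e v(1)])
    also have "\<dots> \<le> (\<Sum>v\<in>V. r v)" using assms v by (intro member_le_sum) auto
    finally show "m e \<le> (\<Sum>v\<in>V. r v)" .
  qed
  show "finite {m. \<forall>e. (e \<in> pair_or_loop V \<longrightarrow> m e \<in> {..\<Sum>v\<in>V. r v}) \<and>
      (e \<notin> pair_or_loop V \<longrightarrow> m e = 0)}"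
    by (rule finite_set_of_finite_funs) (use assms in auto)
qed

lemma mg_weight_nonneg: "mg_weight V m \<ge> 0"
  unfolding mg_weight_def edge_coeff_def by (intro prod_nonneg) auto

lemma mg_weight_add_edge:
  assumes "finite V" "e \<in> pair_or_loop V"
  shows "mg_weight V (add_edge m e) * real (Suc (m e)) = edge_coeff e * mg_weight V m"
proof -
  have *: "mg_weight V m' = (edge_coeff e ^ m' e / fact (m' e)) *
      (\<Prod>e\<in>pair_or_loop V - {e}. edge_coeff e ^ m' e / fact (m' e))" for m'
    unfolding mg_weight_def using assms by (subst prod.remove[of _ e]) auto
  have "(\<Prod>e\<in>pair_or_loop V - {e}. edge_coeff e ^ add_edge m e' e / fact (add_edge m e' e)) =
     (\<Prod>e\<in>pair_or_loop V - {e}. edge_coeff e ^ m e / fact (m e))" if "e' = e" for e'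
    using that by (intro prod.cong) (auto simp: add_edge_def)
  then show ?thesis
    unfolding *[of m] *[of "add_edge m e"] by (simp add: add_edge_def divide_simps del: of_nat_Suc)
qed

lemma sum_incidence_add_edge:
  assumes "finite V" "e \<in> pair_or_loop V"
  shows "(\<Sum>e'\<in>pair_or_loop V. incidence e' v * add_edge m e e') =
    (\<Sum>e'\<in>pair_or_loop V. incidence e' v * m e') + incidence e v"
proof -
  have *: "(\<Sum>e'\<in>pair_or_loop V. incidence e' v * m' e') =
     incidence e v * m' e + (\<Sum>e'\<in>pair_or_loop V - {e}. incidence e' v * m' e')" for m'
    using assms by (subst sum.remove[of _ e]) auto
  have "(\<Sum>e'\<in>pair_or_loop V - {e}. incidence e' v * add_edge m e e') =
     (\<Sum>e'\<in>pair_or_loop V - {e}. incidence e' v * m e')"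
    by (intro sum.cong) (auto simp: add_edge_def)
  then show ?thesis unfolding *[of m] *[of "add_edge m e"] by (simp add: add_edge_def)
qed

text \<open>The factor \<open>m e\<close> cancels one factor of \<open>fact (m e)\<close>.
  Multigraphs with \<open>m e > 0\<close> correspond to those with one copy of \<open>e\<close>
  deleted, whose degrees are \<open>drop_edge r e\<close>; if \<open>e\<close> does not fit the
  degrees, \<open>m e\<close> is always 0.\<close>

lemma mg_sum_shift:
  assumes "finite V" and e: "e \<in> pair_or_loop V"
  shows "mg_sum V r (\<lambda>m. real (m e) * f m) =
    (if \<forall>v\<in>V. incidence e v \<le> r v
     then edge_coeff e * mg_sum V (drop_edge r e) (\<lambda>m. f (add_edge m e)) else 0)"
proof (cases "\<forall>v\<in>V. incidence e v \<le> r v")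
  case False
  then obtain v where v: "v \<in> V" "incidence e v > r v" by auto
  have "m e = 0" if m: "m \<in> multigraphs V r" for m
  proof (rule ccontr)
    assume "m e \<noteq> 0"
    then have "incidence e v \<le> incidence e v * m e" by simp
    also have "\<dots> \<le> (\<Sum>e\<in>pair_or_loop V. incidence e v * m e)"
      using assms by (intro member_le_sum) auto
    also have "\<dots> = r v" using m v by (simp add: multigraphs_def)
    finally show False using v by simp
  qed
  with False show ?thesis unfolding mg_sum_def by (auto intro!: sum.neutral)
next
  case True
  have "mg_sum V r (\<lambda>m. real (m e) * f m) =
      (\<Sum>m\<in>{m \<in> multigraphs V r. m e > 0}. mg_weight V m * (real (m e) * f m))"
    unfolding mg_sum_def using assms by (intro sum.mono_neutral_right) auto
  also have "\<dots> = (\<Sum>m\<in>multigraphs V (drop_edge r e). edge_coeff e * (mg_weight V m * f (add_edge m e)))"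
  proof (rule sum.reindex_bij_witness[of _ "\<lambda>m. add_edge m e" "\<lambda>m. m(e := m e - 1)"])
    fix m assume "m \<in> {m \<in> multigraphs V r. m e > 0}"
    then have m: "m \<in> multigraphs V r" "m e > 0" by auto
    define m' where "m' = m(e := m e - 1)"
    have mm: "m = add_edge m' e" using m by (auto simp: m'_def add_edge_def)
    show "add_edge (m(e := m e - 1)) e = m" using mm m'_def by simp
    have "(\<Sum>e'\<in>pair_or_loop V. incidence e' v * m' e') = r v - incidence e v" if "v \<in> V" for v
      using m(1) that sum_incidence_add_edge[OF assms, of v m'] mm by (simp add: multigraphs_def)
    then show "m(e := m e - 1) \<in> multigraphs V (drop_edge r e)"
      using m e unfolding m'_def[symmetric]
      by (auto simp: multigraphs_def drop_edge_def) (auto simp: m'_def)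
    show "edge_coeff e * (mg_weight V (m(e := m e - 1)) * f (add_edge (m(e := m e - 1)) e)) =
         mg_weight V m * (real (m e) * f m)"
      unfolding m'_def[symmetric] using mg_weight_add_edge[OF assms, of m'] mm
      by (simp add: add_edge_def mult_ac)
  next
    fix m assume m: "m \<in> multigraphs V (drop_edge r e)"
    show "(add_edge m e)(e := add_edge m e e - 1) = m" by (auto simp: add_edge_def)
    show "add_edge m e \<in> {m \<in> multigraphs V r. m e > 0}"
      using m e True sum_incidence_add_edge[OF assms, of _ m]
      by (auto simp: multigraphs_def drop_edge_def) (auto simp: add_edge_def)
  qed
  finally show ?thesis using True by (simp add: mg_sum_def sum_distrib_left)
qed

text \<open>For even \<open>N\<close> this is the product of the odd numbers below \<open>N\<close>,
  the number of perfect matchings of \<open>N\<close> points.\<close>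

definition matching_count :: "nat \<Rightarrow> real" where
  "matching_count N = fact N / (2 ^ (N div 2) * fact (N div 2))"

lemma matching_count_rec:
  assumes "even N" "N \<ge> 2"
  shows "matching_count N = (real N - 1) * matching_count (N - 2)"
proof -
  obtain j where j: "N = 2 * j" using assms by (elim evenE)
  then obtain k where k: "N = 2 * Suc k" using assms by (cases j) auto
  show ?thesis unfolding k matching_count_def
    by (simp add: divide_simps)
qed

lemma matching_count_pos: "matching_count N > 0"
  by (simp add: matching_count_def)

lemma sum_drop_edge:
  assumes "finite V" "e \<in> pair_or_loop V" "\<forall>v\<in>V. incidence e v \<le> r v"
  shows "(\<Sum>v\<in>V. drop_edge r e v) + 2 = (\<Sum>v\<in>V. r v)"
proof -
  have "(\<Sum>v\<in>V. incidence e v) = 2"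
    using assms(2)
  proof (cases rule: pair_or_loop_cases)
    case (1 v)
    then have "(\<Sum>v\<in>V. incidence e v) = (\<Sum>v\<in>{v}. incidence e v)"
      using assms(1) by (intro sum.mono_neutral_right) (auto simp: incidence_def)
    then show ?thesis using 1 by (simp add: incidence_def)
  next
    case (2 u v)
    then have "(\<Sum>v\<in>V. incidence e v) = (\<Sum>v\<in>{u,v}. incidence e v)"
      using assms(1) by (intro sum.mono_neutral_right) (auto simp: incidence_def)
    then show ?thesis using 2 by (simp add: incidence_def)
  qed
  moreover have "(\<Sum>v\<in>V. drop_edge r e v) + (\<Sum>v\<in>V. incidence e v) = (\<Sum>v\<in>V. r v)"
    unfolding sum.distrib[symmetric] using assms(3) by (intro sum.cong) (auto simp: drop_edge_def)
  ultimately show ?thesis by simp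
qed

text \<open>The number of ways to choose the two half-edges of \<open>e\<close> if each \<open>v\<close> carries \<open>r v\<close> half-edges.\<close>

definition edge_ways :: "('a \<Rightarrow> nat) \<Rightarrow> 'a set \<Rightarrow> real" where
  "edge_ways r e = (if card e = 1 then (\<Prod>v\<in>e. real (r v) * (real (r v) - 1) / 2)
     else (\<Prod>v\<in>e. real (r v)))"

text \<open>The case of an edge that does not fit is absorbed by a vanishing prefactor, so the
  averaged shift identities hold without case distinction.\<close>

lemma edge_ways_zero:
  assumes "e \<in> pair_or_loop V" "v \<in> V" "\<not> incidence e v \<le> r v"
  shows "edge_ways r e = 0"
  using assms(1)
proof (cases rule: pair_or_loop_cases)
  case (1 u)
  then have "v = u" "r v < 2" using assms by (auto simp: incidence_def split: if_splits)
  then have "r v = 0 \<or> r v = 1" by auto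
  then show ?thesis using 1 \<open>v = u\<close> by (auto simp: edge_ways_def)
next
  case (2 u w)
  then show ?thesis using assms by (auto simp: edge_ways_def incidence_def split: if_splits)
qed

lemma edge_ways_nonneg: "e \<in> pair_or_loop V \<Longrightarrow> edge_ways r e \<ge> 0"
proof (unfold edge_ways_def, auto intro!: prod_nonneg)
  fix v show "0 \<le> real (r v) * (real (r v) - 1)" by (cases "r v = 0") auto
qed

text \<open>The factorials before and after the deletion differ by falling factorials, which are the
  choices of half-edges; \<open>edge_coeff\<close> is the factor 1/2 for the two orders at a
  loop.\<close>

lemma prod_fact_drop_edge:
  assumes "finite V" "e \<in> pair_or_loop V" "\<forall>v\<in>V. incidence e v \<le> r v"
  shows "edge_coeff e * (\<Prod>v\<in>V. fact (r v)) = edge_ways r e * (\<Prod>v\<in>V. fact (drop_edge r e v))"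
proof -
  have R: "(\<Prod>v\<in>V. fact (r v) :: real) = (\<Prod>v\<in>V - e. fact (r v)) * (\<Prod>v\<in>e. fact (r v))" for r :: "'a \<Rightarrow> nat"
    using assms by (intro prod.subset_diff) (auto simp: pair_or_loop_def vertex_pairs_def)
  have "(\<Prod>v\<in>V - e. fact (drop_edge r e v)) = (\<Prod>v\<in>V - e. fact (r v) :: real)"
    by (intro prod.cong) (auto simp: drop_edge_def incidence_def)
  moreover have "edge_coeff e * (\<Prod>v\<in>e. fact (r v)) = edge_ways r e * (\<Prod>v\<in>e. fact (drop_edge r e v))"
    using assms(2)
  proof (cases rule: pair_or_loop_cases)
    case (1 v)
    then have "r v \<ge> 2" using assms by (auto simp: incidence_def split: if_splits)
    then obtain k where "r v = Suc (Suc k)" by (metis add_2_eq_Suc le_Suc_ex)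
    then show ?thesis using 1 by (simp add: edge_coeff_def edge_ways_def drop_edge_def incidence_def field_simps)
  next
    case (2 u v)
    then have "r u \<ge> 1" "r v \<ge> 1" using assms by (auto simp: incidence_def split: if_splits)
    then obtain k l where "r u = Suc k" "r v = Suc l" by (auto dest!: Suc_le_D)
    then show ?thesis using 2 by (simp add: edge_coeff_def edge_ways_def drop_edge_def incidence_def field_simps)
  qed
  ultimately show ?thesis unfolding R[of r] R[of "drop_edge r e"] by simp
qed

text \<open>Induction on the number \<open>N\<close> of half-edges. At a vertex \<open>v\<close> of
  positive degree the multiplicities add up to \<open>r v\<close>; deleting one edge at
  \<open>v\<close> leaves \<open>N - 2\<close> half-edges, and the choices for it add up to
  \<open>r v * (N - 1)\<close>. This is the recursion of \<open>matching_count\<close>.\<close>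

lemma mg_sum_one:
  assumes "finite V" "even (\<Sum>v\<in>V. r v)"
  shows "mg_sum V r (\<lambda>_. 1) = matching_count (\<Sum>v\<in>V. r v) / (\<Prod>v\<in>V. fact (r v))"
  using assms(2)
proof (induction "\<Sum>v\<in>V. r v" arbitrary: r rule: less_induct)
  case less
  let ?N = "\<Sum>v\<in>V. r v"
  show ?case
  proof (cases "?N = 0")
    case True
    then have r0: "r v = 0" if "v \<in> V" for v using that assms(1) by simp
    have "multigraphs V r = {\<lambda>_. 0}"
    proof
      show "multigraphs V r \<subseteq> {\<lambda>_. 0}"
      proof
        fix m assume m: "m \<in> multigraphs V r"
        have "m e = 0" for e
        proof (cases "e \<in> pair_or_loop V")
          case True
          then obtain v where v: "v \<in> e" "v \<in> V" by (cases rule: pair_or_loop_cases) auto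
          show ?thesis using multigraph_le_degree[OF assms(1) m True v(1)] r0[OF v(2)] by simp
        qed (use m in \<open>simp add: multigraphs_def\<close>)
        then show "m \<in> {\<lambda>_. 0}" by auto
      qed
      show "{\<lambda>_. 0} \<subseteq> multigraphs V r" using r0 by (auto simp: multigraphs_def)
    qed
    then show ?thesis using True r0 by (simp add: mg_sum_def mg_weight_def matching_count_def)
  next
    case False
    then obtain v where v: "v \<in> V" "r v > 0" using assms(1) by auto
    have N2: "?N \<ge> 2" using False less.prems by (cases "?N = 1") auto
    have M: "matching_count ?N = (real ?N - 1) * matching_count (?N - 2)"
      by (rule matching_count_rec) (use less.prems N2 in auto)
    let ?B = "{e \<in> pair_or_loop V. v \<in> e}"
    have edge: "real (incidence e v) * mg_sum V r (\<lambda>m. real (m e)) =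
        real (incidence e v) * edge_ways r e * (matching_count (?N - 2) / (\<Prod>v\<in>V. fact (r v)))"
      if e: "e \<in> pair_or_loop V" for e
    proof (cases "\<forall>v\<in>V. incidence e v \<le> r v")
      case True
      have s: "(\<Sum>v\<in>V. drop_edge r e v) + 2 = ?N" by (rule sum_drop_edge[OF assms(1) e True])
      have s': "(\<Sum>v\<in>V. drop_edge r e v) = ?N - 2" using s by simp
      have "mg_sum V r (\<lambda>m. real (m e)) = edge_coeff e * mg_sum V (drop_edge r e) (\<lambda>_. 1)"
        using mg_sum_shift[OF assms(1) e, of r "\<lambda>_. 1"] True by simp
      also have "mg_sum V (drop_edge r e) (\<lambda>_. 1) =
          matching_count (?N - 2) / (\<Prod>v\<in>V. fact (drop_edge r e v))"
        unfolding s'[symmetric] using s less.prems by (intro less.hyps) (simp_all flip: s)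
      also have "edge_coeff e * \<dots> = edge_ways r e * (matching_count (?N - 2) / (\<Prod>v\<in>V. fact (r v)))"
        using prod_fact_drop_edge[OF assms(1) e True]
        by (simp add: field_simps prod_zero_iff[OF assms(1)])
      finally show ?thesis by simp
    next
      case False
      then have "edge_ways r e = 0" using edge_ways_zero[OF e] by auto
      then show ?thesis using mg_sum_shift[OF assms(1) e, of r "\<lambda>_. 1"] False by simp
    qed
    have "real (r v) * mg_sum V r (\<lambda>_. 1) = 
       mg_sum V r (\<lambda>m. \<Sum>e\<in>pair_or_loop V. real (incidence e v) * real (m e))"
      unfolding mg_sum_def sum_distrib_left[of "real (r v)"]
    proof (intro sum.cong refl)
      fix m assume "m \<in> multigraphs V r"
      then have "(\<Sum>e\<in>pair_or_loop V. incidence e v * m e) = r v" using v by (simp add: multigraphs_def)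
      then have "real (r v) = (\<Sum>e\<in>pair_or_loop V. real (incidence e v) * real (m e))"
        by (metis (mono_tags, lifting) of_nat_mult of_nat_sum sum.cong)
      then show "real (r v) * (mg_weight V m * 1) = mg_weight V m * (\<Sum>e\<in>pair_or_loop V. real (incidence e v) * real (m e))"
        by simp
    qed
    also have "\<dots> = (\<Sum>e\<in>pair_or_loop V. real (incidence e v) * mg_sum V r (\<lambda>m. real (m e)))"
      unfolding mg_sum_def sum_distrib_left by (subst sum.swap) (simp add: mult_ac)
    also have "\<dots> = (\<Sum>e\<in>pair_or_loop V. real (incidence e v) * edge_ways r e) * (matching_count (?N - 2) / (\<Prod>v\<in>V. fact (r v)))"
      unfolding sum_distrib_right using edge by (intro sum.cong) auto
    also have "(\<Sum>e\<in>pair_or_loop V. real (incidence e v) * edge_ways r e) = (\<Sum>e\<in>(\<lambda>u. {v,u}) ` V. real (incidence e v) * edge_ways r e)"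
    proof (rule sum.mono_neutral_right)
      show "(\<lambda>u. {v, u}) ` V \<subseteq> pair_or_loop V"
      proof
        fix e assume "e \<in> (\<lambda>u. {v, u}) ` V"
        then obtain u where "u \<in> V" "e = {v,u}" by auto
        then show "e \<in> pair_or_loop V" using v by (cases "u = v") (auto simp: pair_or_loop_def vertex_pairs_def)
      qed
      show "\<forall>e\<in>pair_or_loop V - (\<lambda>u. {v, u}) ` V. real (incidence e v) * edge_ways r e = 0"
      proof
        fix e assume e: "e \<in> pair_or_loop V - (\<lambda>u. {v, u}) ` V"
        then have "v \<notin> e" by (auto elim!: pair_or_loop_cases)
        then show "real (incidence e v) * edge_ways r e = 0" by (simp add: incidence_def)
      qed
    qed (use assms in auto)
    also have "\<dots> = (\<Sum>u\<in>V. real (incidence {v,u} v) * edge_ways r {v,u})"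
      by (subst sum.reindex) (auto simp: inj_on_def doubleton_eq_iff)
    \<comment> \<open>For the loop, incidence 2 times \<open>r v * (r v - 1) / 2\<close> gives
      \<open>r v * (r v - 1)\<close>: a half-edge at \<open>v\<close> may be matched with any
      half-edge but itself.\<close>
    also have "\<dots> = (\<Sum>u\<in>V. real (r v) * (real (r u) - (if u = v then 1 else 0)))"
      by (intro sum.cong) (auto simp: incidence_def edge_ways_def)
    also have "\<dots> = real (r v) * (real ?N - 1)"
      using assms(1) v by (simp add: sum_distrib_left[symmetric] sum_subtractf)
    finally have "real (r v) * mg_sum V r (\<lambda>_. 1) = real (r v) * ((real ?N - 1) * matching_count (?N - 2) / (\<Prod>v\<in>V. fact (r v)))"
      by simp
    then have "mg_sum V r (\<lambda>_. 1) = (real ?N - 1) * matching_count (?N - 2) / (\<Prod>v\<in>V. fact (r v))"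
      using v(2) by (auto simp only: mult_cancel_left of_nat_eq_0_iff)
    then show ?thesis unfolding M .
  qed
qed

section \<open>Poisson approximation\<close>

definition mg_avg :: "'a set \<Rightarrow> ('a \<Rightarrow> nat) \<Rightarrow> (('a set \<Rightarrow> nat) \<Rightarrow> real) \<Rightarrow> real" where
  "mg_avg V r f = mg_sum V r f / mg_sum V r (\<lambda>_. 1)"

lemma mg_sum_one_pos:
  assumes "finite V" "even (\<Sum>v\<in>V. r v)"
  shows "mg_sum V r (\<lambda>_. 1) > 0"
  unfolding mg_sum_one[OF assms] by (intro divide_pos_pos matching_count_pos prod_pos) simp

lemma mg_avg_const:
  assumes "finite V" "even (\<Sum>v\<in>V. r v)"
  shows "mg_avg V r (\<lambda>_. c) = c"
proof -
  have "mg_sum V r (\<lambda>_. c) = c * mg_sum V r (\<lambda>_. 1)"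
    by (simp add: mg_sum_def sum_distrib_left mult_ac)
  then show ?thesis using mg_sum_one_pos[OF assms] by (simp add: mg_avg_def)
qed

lemma mg_avg_sum: "mg_avg V r (\<lambda>m. \<Sum>i\<in>I. f i m) = (\<Sum>i\<in>I. mg_avg V r (f i))"
  unfolding mg_avg_def mg_sum_def sum_distrib_left sum_divide_distrib[symmetric]
  by (subst sum.swap) simp

lemma mg_avg_diff: "mg_avg V r (\<lambda>m. f m - g m) = mg_avg V r f - mg_avg V r g"
  unfolding mg_avg_def mg_sum_def by (simp add: algebra_simps sum_subtractf diff_divide_distrib)

lemma mg_avg_mono:
  assumes "\<And>m. m \<in> multigraphs V r \<Longrightarrow> f m \<le> g m"
  shows "mg_avg V r f \<le> mg_avg V r g"
  unfolding mg_avg_def mg_sum_def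
  by (intro divide_right_mono sum_mono mult_left_mono assms mg_weight_nonneg)
     (auto intro!: sum_nonneg mg_weight_nonneg)

lemma mg_avg_abs_le: "\<bar>mg_avg V r f\<bar> \<le> mg_avg V r (\<lambda>m. \<bar>f m\<bar>)"
proof -
  have n: "(\<Sum>m\<in>multigraphs V r. mg_weight V m) \<ge> 0"
    by (intro sum_nonneg mg_weight_nonneg)
  have "\<bar>\<Sum>m\<in>multigraphs V r. mg_weight V m * f m\<bar> \<le> (\<Sum>m\<in>multigraphs V r. \<bar>mg_weight V m * f m\<bar>)"
    by (rule sum_abs)
  also have "\<dots> = (\<Sum>m\<in>multigraphs V r. mg_weight V m * \<bar>f m\<bar>)"
    by (simp add: abs_mult mg_weight_nonneg)
  finally show ?thesis using n by (simp add: mg_avg_def mg_sum_def divide_right_mono)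
qed

text \<open>Each of the \<open>edge_ways r e\<close> pairs of half-edges is matched with probability
  1 / (N - 1), and given such a match the rest is again a configuration model.\<close>

lemma mg_avg_shift:
  assumes V: "finite V" and e: "e \<in> pair_or_loop V" and ev: "even (\<Sum>v\<in>V. r v)" and "(\<Sum>v\<in>V. r v) \<ge> 2"
  shows "mg_avg V r (\<lambda>m. real (m e) * f m) =
    edge_ways r e / (real (\<Sum>v\<in>V. r v) - 1) * mg_avg V (drop_edge r e) (\<lambda>m. f (add_edge m e))"
proof (cases "\<forall>v\<in>V. incidence e v \<le> r v")
  case False
  then have "edge_ways r e = 0" using edge_ways_zero[OF e] by auto
  then show ?thesis using mg_sum_shift[OF V e, of r f] False by (simp add: mg_avg_def)
next
  case True
  let ?N = "\<Sum>v\<in>V. r v"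
  have s: "(\<Sum>v\<in>V. drop_edge r e v) + 2 = ?N" by (rule sum_drop_edge[OF V e True])
  then have s': "(\<Sum>v\<in>V. drop_edge r e v) = ?N - 2" by simp
  have ev': "even (\<Sum>v\<in>V. drop_edge r e v)" using ev by (simp flip: s)
  define P where "P = (\<Prod>v\<in>V. fact (r v) :: real)"
  define P' where "P' = (\<Prod>v\<in>V. fact (drop_edge r e v) :: real)"
  have pos: "P > 0" "P' > 0" unfolding P_def P'_def by (auto intro!: prod_pos)
  have W: "mg_sum V r (\<lambda>_. 1) = (real ?N - 1) * matching_count (?N - 2) / P"
    unfolding mg_sum_one[OF V ev] P_def using matching_count_rec[OF ev assms(4)] by simp
  have W': "mg_sum V (drop_edge r e) (\<lambda>_. 1) = matching_count (?N - 2) / P'"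
    unfolding mg_sum_one[OF V ev'] P'_def s' ..
  have PP: "edge_coeff e * P = edge_ways r e * P'"
    unfolding P_def P'_def by (rule prod_fact_drop_edge[OF V e True])
  have M: "matching_count (?N - 2) > 0" by (rule matching_count_pos)
  have "mg_avg V r (\<lambda>m. real (m e) * f m) = 
     edge_coeff e * mg_sum V (drop_edge r e) (\<lambda>m. f (add_edge m e)) / ((real ?N - 1) * matching_count (?N - 2) / P)"
    unfolding mg_avg_def W using mg_sum_shift[OF V e, of r f] True by simp
  also have "\<dots> = (edge_coeff e * P) * mg_sum V (drop_edge r e) (\<lambda>m. f (add_edge m e)) / ((real ?N - 1) * matching_count (?N - 2))"
    by simp
  also have "\<dots> = edge_ways r e / (real ?N - 1) * (mg_sum V (drop_edge r e) (\<lambda>m. f (add_edge m e)) / (matching_count (?N - 2) / P'))"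
    unfolding PP by simp
  finally show ?thesis unfolding mg_avg_def W' .
qed

lemma vertex_pairs_subset: "vertex_pairs V \<subseteq> pair_or_loop V"
  by (auto simp: pair_or_loop_def)

lemma sum_drop_edge_cases:
  assumes V: "finite V" and e: "e \<in> pair_or_loop V" and "edge_ways r e \<noteq> 0"
  shows "(\<Sum>v\<in>V. drop_edge r e v) + 2 = (\<Sum>v\<in>V. r v)"
  using sum_drop_edge[OF V e] edge_ways_zero[OF e] assms(3) by blast

text \<open>Each of the two copies costs one shift, hence the denominators \<open>N - 1\<close> and
  \<open>N - 3\<close>; the factor 1/2 is that of the binomial coefficient.\<close>

lemma mg_avg_shift_twice:
  assumes V: "finite V" and e: "e \<in> vertex_pairs V" and ev: "even (\<Sum>v\<in>V. r v)" and N: "(\<Sum>v\<in>V. r v) \<ge> 4"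
  shows "mg_avg V r (\<lambda>m. real (m e choose 2) * f m) =
    (\<Prod>v\<in>e. real (r v) * (real (r v) - 1)) / (2 * (real (\<Sum>v\<in>V. r v) - 1) * (real (\<Sum>v\<in>V. r v) - 3)) *
    mg_avg V (drop_edge (drop_edge r e) e) (\<lambda>m. f (add_edge (add_edge m e) e))"
proof -
  let ?N = "\<Sum>v\<in>V. r v"
  have e': "e \<in> pair_or_loop V" using e vertex_pairs_subset by blast
  have ch: "real (k choose 2) = real k * ((real k - 1) / 2)" for k
    by (induction k) (auto simp: numeral_2_eq_2 field_simps)
  have "mg_avg V r (\<lambda>m. real (m e choose 2) * f m) = mg_avg V r (\<lambda>m. real (m e) * (((real (m e) - 1) / 2) * f m))"
    unfolding ch by (simp add: mult_ac)
  \<comment> \<open>Adding back the first copy turns \<open>m e - 1\<close> into \<open>m e\<close>,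
    the form required by the second shift.\<close>
  also have "\<dots> = edge_ways r e / (real ?N - 1) *
      mg_avg V (drop_edge r e) (\<lambda>m. real (m e) * (f (add_edge m e) / 2))"
    using N by (subst mg_avg_shift[OF V e' ev]) (auto simp: add_edge_def)
  also have "\<dots> = (\<Prod>v\<in>e. real (r v) * (real (r v) - 1)) / (2 * (real ?N - 1) * (real ?N - 3)) *
    mg_avg V (drop_edge (drop_edge r e) e) (\<lambda>m. f (add_edge (add_edge m e) e))"
  proof (cases "edge_ways r e = 0")
    case True
    then have "\<exists>v\<in>e. r v = 0" using e by (auto simp: edge_ways_def vertex_pairs_def card_2_iff)
    then have "(\<Prod>v\<in>e. real (r v) * (real (r v) - 1)) = 0"
      using e by (intro prod_zero) (auto simp: vertex_pairs_def intro: card_ge_0_finite)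
    then show ?thesis using True by simp
  next
    case False
    have s: "(\<Sum>v\<in>V. drop_edge r e v) + 2 = ?N" by (rule sum_drop_edge_cases[OF V e' False])
    have ev': "even (\<Sum>v\<in>V. drop_edge r e v)" using ev by (simp flip: s)
    have half: "mg_avg V r' (\<lambda>m. g m / 2) = mg_avg V r' g / 2" for r' g
      by (simp add: mg_avg_def mg_sum_def sum_divide_distrib[symmetric])
    have q: "edge_ways r e * edge_ways (drop_edge r e) e = (\<Prod>v\<in>e. real (r v) * (real (r v) - 1))"
    proof -
      obtain u v where uv: "e = {u,v}" "u \<noteq> v" using e by (auto simp: vertex_pairs_def card_2_iff)
      have "r u > 0" "r v > 0" using False uv by (auto simp: edge_ways_def)
      then show ?thesis using uv
        by (simp add: edge_ways_def drop_edge_def incidence_def of_nat_diff)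
    qed
    have "mg_avg V (drop_edge r e) (\<lambda>m. real (m e) * (f (add_edge m e) / 2)) =
       edge_ways (drop_edge r e) e / (real (\<Sum>v\<in>V. drop_edge r e v) - 1) *
       mg_avg V (drop_edge (drop_edge r e) e) (\<lambda>m. f (add_edge (add_edge m e) e) / 2)"
      using s N by (intro mg_avg_shift[OF V e' ev']) auto
    moreover have "real (\<Sum>v\<in>V. drop_edge r e v) - 1 = real ?N - 3"
      unfolding s[symmetric] by simp
    moreover have "x / b * (y / c * (A / 2)) = (x * y) / (2 * b * c) * A" for x y b c A :: real
      by simp
    ultimately show ?thesis unfolding half q[symmetric] by (simp only:)
  qed
  finally show ?thesis .
qed

text \<open>\<open>bad_count V X m\<close> vanishes exactly if \<open>m\<close> is a simple graph without edges in \<open>X\<close>. A single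
  copy of a loop or of a member of \<open>X\<close> is bad, any other pair has to occur twice.\<close>

definition bad_single :: "'a set set \<Rightarrow> 'a set \<Rightarrow> bool" where
  "bad_single X e \<longleftrightarrow> card e = 1 \<or> e \<in> X"

definition bad_copies :: "'a set set \<Rightarrow> ('a set \<Rightarrow> nat) \<Rightarrow> 'a set \<Rightarrow> nat" where
  "bad_copies X m e = (if bad_single X e then m e else m e choose 2)"

definition bad_count :: "'a set \<Rightarrow> 'a set set \<Rightarrow> ('a set \<Rightarrow> nat) \<Rightarrow> nat" where
  "bad_count V X m = (\<Sum>e\<in>pair_or_loop V. bad_copies X m e)"

text \<open>The expected value of \<open>bad_copies X m e\<close> in the configuration model with
  degrees \<open>r\<close>, as \<open>mg_avg_bad_shift\<close> shows for
  \<open>f = 1\<close>.\<close>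

definition bad_rate :: "'a set \<Rightarrow> 'a set set \<Rightarrow> ('a \<Rightarrow> nat) \<Rightarrow> 'a set \<Rightarrow> real" where
  "bad_rate V X r e = (if bad_single X e then edge_ways r e / (real (\<Sum>v\<in>V. r v) - 1)
     else (\<Prod>v\<in>e. real (r v) * (real (r v) - 1)) / (2 * (real (\<Sum>v\<in>V. r v) - 1) * (real (\<Sum>v\<in>V. r v) - 3)))"

definition bad_drop :: "'a set set \<Rightarrow> ('a \<Rightarrow> nat) \<Rightarrow> 'a set \<Rightarrow> 'a \<Rightarrow> nat" where
  "bad_drop X r e = (if bad_single X e then drop_edge r e else drop_edge (drop_edge r e) e)"

definition bad_add :: "'a set set \<Rightarrow> ('a set \<Rightarrow> nat) \<Rightarrow> 'a set \<Rightarrow> 'a set \<Rightarrow> nat" where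
  "bad_add X m e = (if bad_single X e then add_edge m e else add_edge (add_edge m e) e)"

lemma mg_avg_bad_shift:
  assumes V: "finite V" and e: "e \<in> pair_or_loop V" and ev: "even (\<Sum>v\<in>V. r v)" and N: "(\<Sum>v\<in>V. r v) \<ge> 4"
  shows "mg_avg V r (\<lambda>m. real (bad_copies X m e) * f m) =
    bad_rate V X r e * mg_avg V (bad_drop X r e) (\<lambda>m. f (bad_add X m e))"
proof (cases "bad_single X e")
  case True
  then show ?thesis using mg_avg_shift[OF V e ev, of f] N
    by (simp add: bad_copies_def bad_rate_def bad_drop_def bad_add_def)
next
  case False
  then have "e \<in> vertex_pairs V" using e by (auto simp: pair_or_loop_def bad_single_def)
  then show ?thesis using mg_avg_shift_twice[OF V _ ev N, of e f] False
    by (simp add: bad_copies_def bad_rate_def bad_drop_def bad_add_def)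
qed

text \<open>By \<open>(k + 2 choose 2) = (k choose 2) + 2 * k + 1\<close>, a planted bad
  configuration counts as one, except that a planted double edge also forms pairs with the
  \<open>m e\<close> copies already present.\<close>

lemma bad_count_add:
  assumes V: "finite V" and e: "e \<in> pair_or_loop V"
  shows "bad_count V X (bad_add X m e) = Suc (bad_count V X m + (if bad_single X e then 0 else 2 * m e))"
proof -
  have *: "bad_count V X m' = bad_copies X m' e + (\<Sum>e\<in>pair_or_loop V - {e}. bad_copies X m' e)" for m'
    unfolding bad_count_def using assms by (subst sum.remove[of _ e]) auto
  have "(\<Sum>e'\<in>pair_or_loop V - {e}. bad_copies X (bad_add X m e) e') = (\<Sum>e\<in>pair_or_loop V - {e}. bad_copies X m e)"
    by (intro sum.cong) (auto simp: bad_copies_def bad_add_def add_edge_def)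
  moreover have "bad_copies X (bad_add X m e) e = Suc (bad_copies X m e + (if bad_single X e then 0 else 2 * m e))"
    by (simp add: bad_copies_def bad_add_def add_edge_def numeral_2_eq_2)
  ultimately show ?thesis unfolding *[of m] *[of "bad_add X m e"] by simp
qed

text \<open>A Poisson variable of mean \<mu> would give \<open>exp (- (\<mu> * t))\<close>. At
  \<open>t = 1\<close> only \<open>bad_count = 0\<close> survives, since \<open>0 ^ 0 = 1\<close>,
  so the value there is the probability of a simple graph avoiding \<open>X\<close>.\<close>

definition bad_gf :: "'a set \<Rightarrow> 'a set set \<Rightarrow> ('a \<Rightarrow> nat) \<Rightarrow> real \<Rightarrow> real" where
  "bad_gf V X r t = mg_avg V r (\<lambda>m. (1 - t) ^ bad_count V X m)"

text \<open>Differentiation brings down the factor \<open>bad_count\<close>, a sum over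
  \<open>e\<close>. Shifting the term of \<open>e\<close> plants a bad configuration there, whose
  unit in \<open>bad_count\<close> makes up for the lowered exponent.\<close>

lemma bad_gf_deriv:
  assumes V: "finite V" and ev: "even (\<Sum>v\<in>V. r v)" and N: "(\<Sum>v\<in>V. r v) \<ge> 4"
  shows "(bad_gf V X r has_real_derivative
    - (\<Sum>e\<in>pair_or_loop V. bad_rate V X r e * mg_avg V (bad_drop X r e)
         (\<lambda>m. (1 - t) ^ (bad_count V X m + (if bad_single X e then 0 else 2 * m e))))) (at t)"
proof -
  have "(\<Sum>e\<in>pair_or_loop V. bad_rate V X r e * mg_avg V (bad_drop X r e)
         (\<lambda>m. (1 - t) ^ (bad_count V X m + (if bad_single X e then 0 else 2 * m e)))) =
      (\<Sum>e\<in>pair_or_loop V. mg_avg V r (\<lambda>m. real (bad_copies X m e) * (1 - t) ^ (bad_count V X m - 1)))"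
    using mg_avg_bad_shift[OF V _ ev N, of _ X "\<lambda>m. (1 - t) ^ (bad_count V X m - 1)"] bad_count_add[OF V]
    by (intro sum.cong) auto
  also have "\<dots> = mg_avg V r (\<lambda>m. \<Sum>e\<in>pair_or_loop V. real (bad_copies X m e) * (1 - t) ^ (bad_count V X m - 1))"
    by (rule mg_avg_sum[symmetric])
  also have "\<dots> = mg_avg V r (\<lambda>m. real (bad_count V X m) * (1 - t) ^ (bad_count V X m - 1))"
    unfolding bad_count_def by (simp add: sum_distrib_right)
  finally have *: "(\<Sum>e\<in>pair_or_loop V. bad_rate V X r e * mg_avg V (bad_drop X r e)
         (\<lambda>m. (1 - t) ^ (bad_count V X m + (if bad_single X e then 0 else 2 * m e)))) =
      mg_avg V r (\<lambda>m. real (bad_count V X m) * (1 - t) ^ (bad_count V X m - 1))" .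
  have "(bad_gf V X r has_real_derivative
      - mg_avg V r (\<lambda>m. real (bad_count V X m) * (1 - t) ^ (bad_count V X m - 1))) (at t)"
  proof -
    obtain W where W: "mg_sum V r (\<lambda>_. 1) = W" "W \<noteq> 0"
      using mg_sum_one_pos[OF V ev] by auto
    show ?thesis unfolding bad_gf_def[abs_def] mg_avg_def W(1) unfolding mg_sum_def using W(2)
      by (auto intro!: derivative_eq_intros sum.cong simp: sum_negf mult_ac)
  qed
  then show ?thesis unfolding * .
qed

section \<open>Moments of a degree sequence and the total rate of bad configurations\<close>

lemma vertex_pairsE:
  assumes "e \<in> vertex_pairs V"
  obtains u v where "e = {u, v}" "u \<noteq> v" "u \<in> V" "v \<in> V"
  using assms by (auto simp: vertex_pairs_def card_2_iff)

lemma sum_vertex_pairs: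
  fixes h :: "'a set \<Rightarrow> real"
  assumes "finite V"
  shows "2 * (\<Sum>e\<in>vertex_pairs V. h e) = (\<Sum>u\<in>V. \<Sum>v\<in>V - {u}. h {u, v})"
proof -
  let ?S = "Sigma V (\<lambda>u. V - {u})"
  have "(\<Sum>u\<in>V. \<Sum>v\<in>V - {u}. h {u, v}) = (\<Sum>x\<in>?S. h {fst x, snd x})"
    using assms by (simp add: sum.Sigma split_def)
  also have "\<dots> = (\<Sum>e\<in>vertex_pairs V. \<Sum>x\<in>{x \<in> ?S. {fst x, snd x} = e}. h {fst x, snd x})"
    using assms by (intro sum.group[symmetric]) (auto simp: vertex_pairs_def)
  also have "\<dots> = (\<Sum>e\<in>vertex_pairs V. 2 * h e)"
  proof (intro sum.cong refl)
    fix e assume "e \<in> vertex_pairs V"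
    then obtain a b where ab: "e = {a,b}" "a \<noteq> b" "a \<in> V" "b \<in> V"
      by (auto simp: vertex_pairs_def card_2_iff)
    have "{x \<in> ?S. {fst x, snd x} = e} = {(a,b),(b,a)}"
      using ab by (auto simp: doubleton_eq_iff)
    then show "(\<Sum>x\<in>{x \<in> ?S. {fst x, snd x} = e}. h {fst x, snd x}) = 2 * h e"
      using ab by (simp add: insert_commute)
  qed
  finally show ?thesis by (simp add: sum_distrib_left)
qed

text \<open>The second elementary symmetric function in terms of power sums.\<close>

lemma sum_vertex_pairs_prod:
  fixes f :: "'a \<Rightarrow> real"
  assumes "finite V"
  shows "2 * (\<Sum>e\<in>vertex_pairs V. \<Prod>v\<in>e. f v) = (\<Sum>v\<in>V. f v)\<^sup>2 - (\<Sum>v\<in>V. (f v)\<^sup>2)"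
proof -
  have "2 * (\<Sum>e\<in>vertex_pairs V. \<Prod>v\<in>e. f v) = (\<Sum>u\<in>V. \<Sum>v\<in>V - {u}. f u * f v)"
    unfolding sum_vertex_pairs[OF assms] by (intro sum.cong) auto
  also have "\<dots> = (\<Sum>u\<in>V. f u * (\<Sum>v\<in>V. f v) - (f u)\<^sup>2)"
    using assms by (intro sum.cong refl)
      (simp add: sum_distrib_left[symmetric] sum_diff1 algebra_simps power2_eq_square)
  also have "\<dots> = (\<Sum>v\<in>V. f v)\<^sup>2 - (\<Sum>v\<in>V. (f v)\<^sup>2)"
    by (simp add: sum_subtractf sum_distrib_right[symmetric] power2_eq_square)
  finally show ?thesis .
qed

lemma sum_edges_vertices:
  fixes h :: "'a \<Rightarrow> real"
  assumes "finite V" "X \<subseteq> vertex_pairs V"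
  shows "(\<Sum>e\<in>X. \<Sum>v\<in>e. h v) = (\<Sum>v\<in>V. h v * real (graph_degree X v))"
proof -
  have X: "finite X" using assms finite_subset finite_vertex_pairs by blast
  have "(\<Sum>e\<in>X. \<Sum>v\<in>e. h v) = (\<Sum>e\<in>X. \<Sum>v\<in>V. if v \<in> e then h v else 0)"
  proof (rule sum.cong[OF refl])
    fix e assume "e \<in> X"
    then have "V \<inter> e = e" using assms by (auto simp: vertex_pairs_def)
    then show "(\<Sum>v\<in>e. h v) = (\<Sum>v\<in>V. if v \<in> e then h v else 0)"
      using assms by (subst sum.inter_restrict[symmetric]) auto
  qed
  also have "\<dots> = (\<Sum>v\<in>V. \<Sum>e\<in>X. if v \<in> e then h v else 0)" by (rule sum.swap)
  also have "\<dots> = (\<Sum>v\<in>V. h v * real (graph_degree X v))"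
    using X by (simp add: sum.inter_filter[symmetric] graph_degree_def mult.commute)
  finally show ?thesis .
qed

definition pair_moment :: "'a set \<Rightarrow> ('a \<Rightarrow> nat) \<Rightarrow> real" where
  "pair_moment V r = (\<Sum>v\<in>V. real (r v) * (real (r v) - 1))"

definition edge_moment :: "'a set set \<Rightarrow> ('a \<Rightarrow> nat) \<Rightarrow> real" where
  "edge_moment X r = (\<Sum>e\<in>X. \<Prod>v\<in>e. real (r v))"

definition bad_mean :: "'a set \<Rightarrow> 'a set set \<Rightarrow> ('a \<Rightarrow> nat) \<Rightarrow> real" where
  "bad_mean V X r = pair_moment V r / (2 * real (\<Sum>v\<in>V. r v)) +
     (pair_moment V r / (2 * real (\<Sum>v\<in>V. r v)))\<^sup>2 + edge_moment X r / real (\<Sum>v\<in>V. r v)"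

text \<open>One bound \<open>d\<close> serves the degrees and the forbidden graph. The class is
  closed under \<open>bad_drop\<close>, and the estimates for it involve only \<open>d\<close> and
  the number of half-edges; the iteration rests on both facts.\<close>

definition admissible :: "nat \<Rightarrow> 'a set \<Rightarrow> 'a set set \<Rightarrow> ('a \<Rightarrow> nat) \<Rightarrow> bool" where
  "admissible d V X r \<longleftrightarrow> finite V \<and> X \<subseteq> vertex_pairs V \<and> even (\<Sum>v\<in>V. r v) \<and>
     (\<forall>v\<in>V. r v \<le> d \<and> graph_degree X v \<le> d)"

lemma nat_mult_pred_nonneg: "real k * (real k - 1) \<ge> 0"
  by (cases "k = 0") auto

lemma pair_moment_bounds:
  assumes "\<forall>v\<in>V. r v \<le> d"
  shows "0 \<le> pair_moment V r" "pair_moment V r \<le> real d * real (\<Sum>v\<in>V. r v)"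
proof -
  show "0 \<le> pair_moment V r" unfolding pair_moment_def by (intro sum_nonneg nat_mult_pred_nonneg)
  have "pair_moment V r \<le> (\<Sum>v\<in>V. real d * real (r v))" unfolding pair_moment_def
  proof (rule sum_mono)
    fix v assume "v \<in> V"
    then have "real (r v) - 1 \<le> real d" using assms by (force intro: order_trans[of _ "real (r v)"])
    then show "real (r v) * (real (r v) - 1) \<le> real d * real (r v)"
      using mult_left_mono[of "real (r v) - 1" "real d" "real (r v)"] by (simp add: mult.commute)
  qed
  then show "pair_moment V r \<le> real d * real (\<Sum>v\<in>V. r v)" by (simp add: sum_distrib_left)
qed

text \<open>Losing a half-edge at one end changes a product by at most \<open>d\<close>, and a
  vertex lies in at most \<open>d\<close> edges of \<open>X\<close>. This makes
  \<open>d\<^sup>2\<close> per lost half-edge.\<close>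

lemma edge_moment_diff_bound:
  assumes "finite V" "X \<subseteq> vertex_pairs V" "\<forall>v\<in>V. graph_degree X v \<le> d" "\<forall>v\<in>V. r v \<le> d" "\<forall>v\<in>V. r' v \<le> r v"
  shows "0 \<le> edge_moment X r - edge_moment X r'"
    "edge_moment X r - edge_moment X r' \<le> real d ^ 2 * (real (\<Sum>v\<in>V. r v) - real (\<Sum>v\<in>V. r' v))"
proof -
  have *: "0 \<le> (\<Prod>v\<in>e. real (r v)) - (\<Prod>v\<in>e. real (r' v)) \<and>
      (\<Prod>v\<in>e. real (r v)) - (\<Prod>v\<in>e. real (r' v)) \<le> real d * (\<Sum>v\<in>e. real (r v) - real (r' v))"
    if e: "e \<in> X" for e
  proof -
    obtain u v where uv: "e = {u,v}" "u \<noteq> v" "u \<in> V" "v \<in> V"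
      using e assms(2) by (meson subsetD vertex_pairsE)
    have le: "r' u \<le> r u" "r' v \<le> r v" "r u \<le> d" "r v \<le> d" using uv assms by auto
    have "real (r' u) * real (r' v) \<le> real (r u) * real (r v)"
      using le by (intro mult_mono) auto
    moreover have "real (r v) * (real (r u) - real (r' u)) \<le> real d * (real (r u) - real (r' u))"
      using le by (intro mult_right_mono) auto
    moreover have "real (r' u) * (real (r v) - real (r' v)) \<le> real d * (real (r v) - real (r' v))"
      using le by (intro mult_right_mono) auto
    ultimately show ?thesis using uv by (simp add: algebra_simps)
  qed
  show "0 \<le> edge_moment X r - edge_moment X r'"
    unfolding edge_moment_def sum_subtractf[symmetric] using * by (intro sum_nonneg) auto
  have "edge_moment X r - edge_moment X r' \<le> (\<Sum>e\<in>X. real d * (\<Sum>v\<in>e. real (r v) - real (r' v)))"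
    unfolding edge_moment_def sum_subtractf[symmetric] using * by (intro sum_mono) (auto simp: sum_subtractf)
  also have "\<dots> = real d * (\<Sum>v\<in>V. (real (r v) - real (r' v)) * real (graph_degree X v))"
    unfolding sum_distrib_left[symmetric] sum_edges_vertices[OF assms(1,2)] ..
  also have "\<dots> \<le> real d * (\<Sum>v\<in>V. (real (r v) - real (r' v)) * real d)"
    using assms by (intro mult_left_mono sum_mono) auto
  also have "\<dots> = real d ^ 2 * (real (\<Sum>v\<in>V. r v) - real (\<Sum>v\<in>V. r' v))"
    by (simp add: sum_distrib_right[symmetric] sum_subtractf power2_eq_square)
  finally show "edge_moment X r - edge_moment X r' \<le> \<dots>" .
qed

lemma edge_moment_bounds:
  assumes "finite V" "X \<subseteq> vertex_pairs V" "\<forall>v\<in>V. graph_degree X v \<le> d" "\<forall>v\<in>V. r v \<le> d"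
  shows "0 \<le> edge_moment X r" "edge_moment X r \<le> real d ^ 2 * real (\<Sum>v\<in>V. r v)"
proof -
  \<comment> \<open>The bounds are the Lipschitz estimate against the zero sequence, whose moment
    vanishes because the members of \<open>X\<close> are nonempty.\<close>
  have "edge_moment X (\<lambda>_. 0) = 0"
  proof -
    have "(\<Prod>v\<in>e. real 0) = 0" if "e \<in> X" for e
      using that assms(2) by (auto simp: vertex_pairs_def card_2_iff dest!: subsetD)
    then show ?thesis unfolding edge_moment_def by (intro sum.neutral) auto
  qed
  then show "0 \<le> edge_moment X r" "edge_moment X r \<le> real d ^ 2 * real (\<Sum>v\<in>V. r v)"
    using edge_moment_diff_bound[OF assms, of "\<lambda>_. 0"] by auto
qed

lemma pair_moment_diff_bound:
  assumes "\<forall>v\<in>V. r v \<le> d" "\<forall>v\<in>V. r' v \<le> r v"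
  shows "0 \<le> pair_moment V r - pair_moment V r'"
    "pair_moment V r - pair_moment V r' \<le> 2 * real d * (real (\<Sum>v\<in>V. r v) - real (\<Sum>v\<in>V. r' v))"
proof -
  have *: "0 \<le> real (r v) * (real (r v) - 1) - real (r' v) * (real (r' v) - 1) \<and>
     real (r v) * (real (r v) - 1) - real (r' v) * (real (r' v) - 1) \<le> 2 * real d * (real (r v) - real (r' v))"
    if v: "v \<in> V" for v
  \<comment> \<open>Equal degrees are treated apart because both may be 0, and then the factor
    \<open>r v + r' v - 1\<close> is negative.\<close>
  proof (cases "r v = r' v")
    case False
    have le: "r' v \<le> r v" "r v \<le> d" using assms v by auto
    have eq: "real (r v) * (real (r v) - 1) - real (r' v) * (real (r' v) - 1) =
      (real (r v) - real (r' v)) * (real (r v) + real (r' v) - 1)" by (simp add: algebra_simps)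
    have "0 \<le> real (r v) + real (r' v) - 1" "real (r v) + real (r' v) - 1 \<le> 2 * real d" "0 \<le> real (r v) - real (r' v)"
      using le False by auto
    then show ?thesis unfolding eq
      using mult_left_mono[of "real (r v) + real (r' v) - 1" "2 * real d" "real (r v) - real (r' v)"]
      by (simp add: mult.commute)
  qed auto
  show "0 \<le> pair_moment V r - pair_moment V r'"
    unfolding pair_moment_def sum_subtractf[symmetric] using * by (intro sum_nonneg) auto
  have "pair_moment V r - pair_moment V r' \<le> (\<Sum>v\<in>V. 2 * real d * (real (r v) - real (r' v)))"
    unfolding pair_moment_def sum_subtractf[symmetric] using * by (intro sum_mono) auto
  then show "pair_moment V r - pair_moment V r' \<le> 2 * real d * (real (\<Sum>v\<in>V. r v) - real (\<Sum>v\<in>V. r' v))"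
    by (simp add: sum_distrib_left[symmetric] sum_subtractf)
qed

text \<open>A bad configuration uses at most 4 half-edges, whence \<open>N \<le> N' + 4\<close>. The
  change of the denominator costs at most 4 times the bound \<open>b\<close> of the
  quotient.\<close>

lemma quotient_diff_bound:
  fixes S S' N N' a b :: real
  assumes "0 \<le> S - S'" "S - S' \<le> a" "0 \<le> S'" "S' \<le> b * N'" "N' \<le> N" "N \<le> N' + 4" "N' > 0"
  shows "\<bar>S / N - S' / N'\<bar> \<le> (a + 4 * b) / N"
proof -
  have N: "N > 0" using assms by linarith
  have eq: "S / N - S' / N' = ((S - S') - (S' / N') * (N - N')) / N"
    using N assms(7) by (simp add: field_simps)
  have q: "0 \<le> S' / N'" "S' / N' \<le> b" using assms by (auto simp: field_simps)
  have "b \<ge> 0" using q by linarith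
  then have "(S' / N') * (N - N') \<le> b * 4" using q assms
    by (intro mult_mono) (simp_all only: diff_ge_0_iff_ge le_diff_eq diff_le_eq add.commute)
  moreover have "0 \<le> (S' / N') * (N - N')" using q assms by (intro mult_nonneg_nonneg) auto
  ultimately have "\<bar>(S - S') - (S' / N') * (N - N')\<bar> \<le> a + 4 * b" using assms(1,2) by (simp add: abs_le_iff)
  then show ?thesis unfolding eq using N by (simp add: abs_divide divide_right_mono)
qed

lemma bad_mean_nonneg:
  assumes "admissible d V X r"
  shows "bad_mean V X r \<ge> 0"
  using assms pair_moment_bounds(1)[of V r d] edge_moment_bounds(1)[of V X d r]
  by (auto simp: bad_mean_def admissible_def intro!: add_nonneg_nonneg divide_nonneg_nonneg sum_nonneg)

lemma bad_mean_upper: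
  assumes "admissible d V X r" "d \<ge> 1"
  shows "bad_mean V X r \<le> 2 * real d ^ 4"
proof (cases "(\<Sum>v\<in>V. r v) = 0")
  case True
  \<comment> \<open>Without half-edges all quotients are divisions by zero, so the mean is
    0.\<close>
  then show ?thesis by (simp add: bad_mean_def del: of_nat_sum)
next
  case False
  define N where "N = real (\<Sum>v\<in>V. r v)"
  have N: "N > 0" using False unfolding N_def by (simp del: of_nat_sum)
  have S: "0 \<le> pair_moment V r" "pair_moment V r \<le> real d * N"
    using pair_moment_bounds[of V r d] assms by (auto simp: N_def admissible_def)
  have K: "0 \<le> edge_moment X r" "edge_moment X r \<le> real d ^ 2 * N"
    using edge_moment_bounds[of V X d r] assms by (auto simp: N_def admissible_def)
  define l where "l = pair_moment V r / (2 * N)"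
  have l: "0 \<le> l" "l \<le> real d / 2" using S N by (auto simp: l_def field_simps)
  have k: "edge_moment X r / N \<le> real d ^ 2" using K N by (auto simp: field_simps)
  have "l\<^sup>2 \<le> (real d / 2)\<^sup>2" using l by (intro power_mono) auto
  then have "l\<^sup>2 \<le> real d ^ 2 / 4" by (simp add: power_divide)
  moreover have "real d \<le> real d ^ 4" using assms(2) by (intro self_le_power) auto
  moreover have "real d ^ 2 \<le> real d ^ 4" using assms(2) by (intro power_increasing) auto
  ultimately have "l + l\<^sup>2 + edge_moment X r / N \<le> 2 * real d ^ 4"
    using l k zero_le_power[of "real d" 4] by linarith
  then show ?thesis unfolding bad_mean_def l_def N_def .
qed

text \<open>The quotient bound gives \<open>6 * d\<close> for the loops,
  \<open>6 * d\<^sup>2\<close> for the square of that term and \<open>8 * d\<^sup>2\<close> for the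
  edges of \<open>X\<close>, each over \<open>N\<close>; the powers of \<open>d\<close> are then all
  raised to the fourth.\<close>

lemma bad_mean_diff:
  assumes "admissible d V X r" "\<forall>v\<in>V. r' v \<le> r v" "d \<ge> 1"
    "(\<Sum>v\<in>V. r v) \<le> (\<Sum>v\<in>V. r' v) + 4" "(\<Sum>v\<in>V. r v) > 4"
  shows "\<bar>bad_mean V X r - bad_mean V X r'\<bar> \<le> 20 * real d ^ 4 / real (\<Sum>v\<in>V. r v)"
proof -
  define N where "N = real (\<Sum>v\<in>V. r v)"
  define N' where "N' = real (\<Sum>v\<in>V. r' v)"
  have NN: "N' \<le> N" "N \<le> N' + 4" "N' > 0"
  proof -
    show "N' \<le> N" unfolding N_def N'_def using assms(2) by (intro of_nat_mono sum_mono) auto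
    show "N \<le> N' + 4" using assms(4) unfolding N_def N'_def by linarith
    then show "N' > 0" using assms(5) unfolding N_def N'_def by linarith
  qed
  then have N: "N > 0" by linarith
  have r': "\<forall>v\<in>V. r' v \<le> d" using assms(1,2) by (force simp: admissible_def intro: order_trans)
  note a = assms(1)[unfolded admissible_def]
  have r: "\<forall>v\<in>V. r v \<le> d" "\<forall>v\<in>V. graph_degree X v \<le> d" "finite V" "X \<subseteq> vertex_pairs V" using a by auto
  define S where "S = pair_moment V r / 2"
  define S' where "S' = pair_moment V r' / 2"
  have S: "0 \<le> S - S'" "S - S' \<le> real d * 4" "0 \<le> S'" "S' \<le> (real d / 2) * N'" "0 \<le> S" "S \<le> (real d / 2) * N"
  proof -
    show "0 \<le> S - S'" using pair_moment_diff_bound(1)[OF r(1) assms(2)] by (simp add: S_def S'_def)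
    have "S - S' \<le> real d * (N - N')" using pair_moment_diff_bound(2)[OF r(1) assms(2)] by (simp add: S_def S'_def N_def N'_def)
    also have "\<dots> \<le> real d * 4" using NN by (intro mult_left_mono) auto
    finally show "S - S' \<le> real d * 4" .
    show "0 \<le> S'" "S' \<le> (real d / 2) * N'" using pair_moment_bounds[OF r'] by (simp_all add: S'_def N'_def)
    show "0 \<le> S" "S \<le> (real d / 2) * N" using pair_moment_bounds[OF r(1)] by (simp_all add: S_def N_def)
  qed
  have l: "\<bar>S / N - S' / N'\<bar> \<le> 6 * real d / N"
    using quotient_diff_bound[OF S(1-4) NN] by (simp add: algebra_simps)
  have lb: "0 \<le> S / N" "S / N \<le> real d / 2" "0 \<le> S' / N'" "S' / N' \<le> real d / 2"
    using S N NN by (auto simp: field_simps)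
  have "\<bar>(S / N)\<^sup>2 - (S' / N')\<^sup>2\<bar> = \<bar>S / N - S' / N'\<bar> * \<bar>S / N + S' / N'\<bar>"
    by (simp add: abs_mult[symmetric] power2_eq_square algebra_simps)
  also have "\<dots> \<le> (6 * real d / N) * real d"
  proof (intro mult_mono l)
    show "\<bar>S / N + S' / N'\<bar> \<le> real d" using lb by linarith
  qed (use N in auto)
  finally have l2: "\<bar>(S / N)\<^sup>2 - (S' / N')\<^sup>2\<bar> \<le> 6 * real d ^ 2 / N" by (simp add: power2_eq_square)
  have k: "\<bar>edge_moment X r / N - edge_moment X r' / N'\<bar> \<le> (real d ^ 2 * 4 + 4 * real d ^ 2) / N"
  proof (rule quotient_diff_bound[OF _ _ _ _ NN])
    show "0 \<le> edge_moment X r - edge_moment X r'"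
      by (rule edge_moment_diff_bound(1)[OF r(3,4,2,1) assms(2)])
    have "edge_moment X r - edge_moment X r' \<le> real d ^ 2 * (N - N')"
      unfolding N_def N'_def by (rule edge_moment_diff_bound(2)[OF r(3,4,2,1) assms(2)])
    also have "\<dots> \<le> real d ^ 2 * 4" using NN by (intro mult_left_mono) auto
    finally show "edge_moment X r - edge_moment X r' \<le> real d ^ 2 * 4" .
    show "0 \<le> edge_moment X r'" "edge_moment X r' \<le> real d ^ 2 * N'"
      unfolding N'_def using edge_moment_bounds[OF r(3,4,2) r'] by auto
  qed
  have eq: "bad_mean V X r = S / N + (S / N)\<^sup>2 + edge_moment X r / N"
    "bad_mean V X r' = S' / N' + (S' / N')\<^sup>2 + edge_moment X r' / N'"
    by (simp_all add: bad_mean_def S_def S'_def N_def N'_def)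
  have "\<bar>bad_mean V X r - bad_mean V X r'\<bar> \<le> 6 * real d / N + 6 * real d ^ 2 / N + (real d ^ 2 * 4 + 4 * real d ^ 2) / N"
    unfolding eq using l l2 k by linarith
  also have "\<dots> = (6 * real d + 14 * real d ^ 2) / N" by (simp add: add_divide_distrib)
  also have "\<dots> \<le> 20 * real d ^ 4 / N"
  proof -
    have "real d \<le> real d ^ 4" using assms(3) by (intro self_le_power) auto
    moreover have "real d ^ 2 \<le> real d ^ 4" using assms(3) by (intro power_increasing) auto
    ultimately have "6 * real d + 14 * real d ^ 2 \<le> 20 * real d ^ 4" by linarith
    then show ?thesis using N by (intro divide_right_mono) auto
  qed
  finally show ?thesis unfolding N_def .
qed

lemma bad_rate_nonneg:
  assumes "e \<in> pair_or_loop V" "(\<Sum>v\<in>V. r v) \<ge> 4"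
  shows "bad_rate V X r e \<ge> 0"
proof -
  have "real (\<Sum>v\<in>V. r v) \<ge> 4" using assms(2) by linarith
  then show ?thesis unfolding bad_rate_def using edge_ways_nonneg[OF assms(1), of r]
    by (auto intro!: divide_nonneg_nonneg mult_nonneg_nonneg prod_nonneg nat_mult_pred_nonneg simp del: of_nat_sum)
qed

text \<open>\<open>S\<close> and \<open>K\<close> are the pair and edge moments; \<open>Q\<close>
  and \<open>R\<close> correct for a vertex paired with itself and for pairs inside
  \<open>X\<close>. Replacing \<open>N - 1\<close> and \<open>N - 3\<close> by \<open>N\<close>
  costs \<open>d\<close>, \<open>2 * d\<^sup>2\<close> and \<open>4 * d\<^sup>2\<close>, the
  corrections cost \<open>3 * d ^ 4\<close>, all over \<open>N\<close>; the factor 11 covers the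
  sum.\<close>

lemma rate_sum_estimate:
  fixes N d S K Q R :: real
  assumes N: "N \<ge> 8" and d: "d \<ge> 1" and S: "0 \<le> S" "S \<le> d * N" and K: "0 \<le> K" "K \<le> d ^ 2 * N"
    and Q: "0 \<le> Q" "Q \<le> d ^ 4 * N" and R: "0 \<le> R" "R \<le> d ^ 4 * N"
  shows "\<bar>S / 2 / (N - 1) + K / (N - 1) + ((S\<^sup>2 - Q) / 2 - R) / (2 * (N - 1) * (N - 3)) -
    (S / (2 * N) + (S / (2 * N))\<^sup>2 + K / N)\<bar> \<le> 11 * d ^ 4 / N"
proof -
  have d4: "d \<le> d ^ 4" "d ^ 2 \<le> d ^ 4" using d by (auto intro: self_le_power power_increasing)
  have pos: "N > 0" "N - 1 > 0" "N - 3 > 0" using N by auto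
  have n1: "1 / (N - 1) \<le> 2 / N" "1 / (N - 3) \<le> 2 / N" using N by (auto simp: field_simps)
  have s: "S / 2 / (N - 1) - S / (2 * N) = (S / N) * (1 / (N - 1)) / 2"
    using pos by (simp add: field_simps)
  have sn: "0 \<le> S / N" "S / N \<le> d" using S pos by (auto simp: field_simps)
  have kn: "0 \<le> K / N" "K / N \<le> d ^ 2" using K pos by (auto simp: field_simps)
  have qn: "0 \<le> Q / N" "Q / N \<le> d ^ 4" "0 \<le> R / N" "R / N \<le> d ^ 4" using Q R pos by (auto simp: field_simps)
  have "(S / N) * (1 / (N - 1)) \<le> d * (2 / N)" using sn n1 pos d by (intro mult_mono) auto
  moreover have "0 \<le> (S / N) * (1 / (N - 1))" using sn pos by (intro mult_nonneg_nonneg) auto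
  moreover have "d * (2 / N) = 2 * (d / N)" by simp
  moreover have "0 \<le> w / 2 \<and> w / 2 \<le> z" if "w \<le> y" "0 \<le> w" "y = 2 * z" for w y z :: real
    using that by auto
  ultimately have 1: "0 \<le> S / 2 / (N - 1) - S / (2 * N)" "S / 2 / (N - 1) - S / (2 * N) \<le> d / N"
    unfolding s by blast+
  have k: "K / (N - 1) - K / N = (K / N) * (1 / (N - 1))" using pos by (simp add: field_simps)
  have "(K / N) * (1 / (N - 1)) \<le> d ^ 2 * (2 / N)" using kn n1 pos by (intro mult_mono) auto
  then have 2: "K / (N - 1) - K / N \<le> 2 * d ^ 2 / N" unfolding k by (simp add: mult.commute)
  have k2: "0 \<le> K / (N - 1) - K / N" unfolding k using kn pos by (intro mult_nonneg_nonneg) auto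
  have ss: "S\<^sup>2 / 2 / (2 * (N - 1) * (N - 3)) - (S / (2 * N))\<^sup>2 =
      (S / N)\<^sup>2 * ((4 * N - 3) / (4 * ((N - 1) * (N - 3))))"
  proof -
    have "S\<^sup>2 / 2 / (2 * a * b) - (S / (2 * N))\<^sup>2 = (S / N)\<^sup>2 * ((N\<^sup>2 - a * b) / (4 * (a * b)))"
      if "a > 0" "b > 0" for a b using that pos(1) by (simp add: field_simps power2_eq_square)
    from this[OF pos(2,3)] show ?thesis by (simp add: algebra_simps power2_eq_square)
  qed
  have "(4 * N - 3) / (4 * ((N - 1) * (N - 3))) \<le> N * ((1 / (N - 1)) * (1 / (N - 3)))"
  proof -
    have "(4 * N - 3) / (4 * (a * b)) \<le> N * ((1 / a) * (1 / b))" if "a > 0" "b > 0" for a b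
      using that by (simp add: field_simps)
    from this[OF pos(2,3)] show ?thesis .
  qed
  also have "\<dots> \<le> N * ((2 / N) * (2 / N))" using n1 pos by (intro mult_left_mono mult_mono) auto
  finally have q: "(4 * N - 3) / (4 * ((N - 1) * (N - 3))) \<le> 4 / N" using pos by simp
  have "(S / N)\<^sup>2 * ((4 * N - 3) / (4 * ((N - 1) * (N - 3)))) \<le> d\<^sup>2 * (4 / N)"
    using sn q pos N by (intro mult_mono power_mono) auto
  then have 3: "S\<^sup>2 / 2 / (2 * (N - 1) * (N - 3)) - (S / (2 * N))\<^sup>2 \<le> 4 * d\<^sup>2 / N"
    unfolding ss by (simp only: times_divide_eq_right mult.commute)
  have k3: "0 \<le> S\<^sup>2 / 2 / (2 * (N - 1) * (N - 3)) - (S / (2 * N))\<^sup>2"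
    unfolding ss using pos N by (intro mult_nonneg_nonneg divide_nonneg_nonneg) auto
  have rr: "(Q / 2 + R) / (2 * (N - 1) * (N - 3)) = (Q / N / 2 + R / N) / 2 * N * ((1 / (N - 1)) * (1 / (N - 3)))"
  proof -
    have "(Q / 2 + R) / (2 * a * b) = (Q / N / 2 + R / N) / 2 * N * ((1 / a) * (1 / b))" if "a > 0" "b > 0" for a b
      using that pos(1) by (simp add: field_simps)
    from this[OF pos(2,3)] show ?thesis .
  qed
  have "(Q / N / 2 + R / N) / 2 * N * ((1 / (N - 1)) * (1 / (N - 3))) \<le>
      (d ^ 4 / 2 + d ^ 4) / 2 * N * ((2 / N) * (2 / N))"
    using n1 qn pos by (intro mult_mono divide_right_mono add_mono) auto
  also have "\<dots> = 3 * d ^ 4 / N" using pos by (simp add: field_simps)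
  finally have 4: "(Q / 2 + R) / (2 * (N - 1) * (N - 3)) \<le> 3 * d ^ 4 / N"
    unfolding rr .
  have k4: "0 \<le> (Q / 2 + R) / (2 * (N - 1) * (N - 3))"
    using pos Q R by (intro divide_nonneg_nonneg mult_nonneg_nonneg) auto
  have sp: "((S\<^sup>2 - Q) / 2 - R) / (2 * (N - 1) * (N - 3)) =
     S\<^sup>2 / 2 / (2 * (N - 1) * (N - 3)) - (Q / 2 + R) / (2 * (N - 1) * (N - 3))"
    by (simp add: diff_divide_distrib add_divide_distrib)
  have "d / N \<le> d ^ 4 / N" "2 * d ^ 2 / N \<le> 2 * d ^ 4 / N" "4 * d\<^sup>2 / N \<le> 4 * d ^ 4 / N"
    using d4 pos by (auto intro!: divide_right_mono)
  moreover have "11 * d ^ 4 / N = 11 * (d ^ 4 / N)" "3 * d ^ 4 / N = 3 * (d ^ 4 / N)"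
    "2 * d ^ 4 / N = 2 * (d ^ 4 / N)" "4 * d ^ 4 / N = 4 * (d ^ 4 / N)" by simp_all
  moreover have "d ^ 4 / N \<ge> 0" using pos d by simp
  ultimately show ?thesis using 1 2 k2 3 k3 4 k4 unfolding sp abs_le_iff by linarith
qed

lemma bad_rate_sum:
  assumes adm: "admissible d V X r" and d: "d \<ge> 1" and N8: "(\<Sum>v\<in>V. r v) \<ge> 8"
  shows "\<bar>(\<Sum>e\<in>pair_or_loop V. bad_rate V X r e) - bad_mean V X r\<bar> \<le> 11 * real d ^ 4 / real (\<Sum>v\<in>V. r v)"
proof -
  define N where "N = real (\<Sum>v\<in>V. r v)"
  have N: "N \<ge> 8" using N8 unfolding N_def by linarith
  have r: "\<forall>v\<in>V. r v \<le> d" "\<forall>v\<in>V. graph_degree X v \<le> d" "finite V" "X \<subseteq> vertex_pairs V"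
    using adm by (auto simp: admissible_def)
  have X: "finite X" using r finite_subset finite_vertex_pairs by blast
  define S where "S = pair_moment V r"
  define K where "K = edge_moment X r"
  define f where "f v = real (r v) * (real (r v) - 1)" for v
  have f: "0 \<le> f v" "f v \<le> real d * real (r v)" "f v \<le> real d ^ 2" if "v \<in> V" for v
  proof -
    show f0: "0 \<le> f v" by (simp add: f_def nat_mult_pred_nonneg)
    have "r v \<le> d" using r that by auto
    then show "f v \<le> real d * real (r v)"
      using mult_left_mono[of "real (r v) - 1" "real d" "real (r v)"] by (simp add: f_def mult.commute)
    also have "\<dots> \<le> real d * real d" using \<open>r v \<le> d\<close> by (intro mult_left_mono) auto
    finally show "f v \<le> real d ^ 2" by (simp add: power2_eq_square)
  qed
  define Q where "Q = (\<Sum>v\<in>V. (f v)\<^sup>2)"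
  define R where "R = (\<Sum>e\<in>X. \<Prod>v\<in>e. f v)"
  have loops: "(\<Sum>e\<in>(\<lambda>v. {v}) ` V. bad_rate V X r e) = S / 2 / (N - 1)"
    unfolding S_def pair_moment_def N_def
    by (subst sum.reindex) (auto simp: bad_rate_def bad_single_def edge_ways_def sum_divide_distrib inj_on_def simp del: of_nat_sum)
  have c2: "card e = 2" if "e \<in> vertex_pairs V" for e using that by (simp add: vertex_pairs_def)
  have xs: "(\<Sum>e\<in>X. bad_rate V X r e) = K / (N - 1)"
    unfolding K_def edge_moment_def N_def sum_divide_distrib
    using c2 r(4) by (intro sum.cong) (auto simp: bad_rate_def bad_single_def edge_ways_def dest!: subsetD simp del: of_nat_sum)
  have ps: "(\<Sum>e\<in>vertex_pairs V - X. bad_rate V X r e) = (\<Sum>e\<in>vertex_pairs V - X. \<Prod>v\<in>e. f v) / (2 * (N - 1) * (N - 3))"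
    unfolding N_def sum_divide_distrib f_def
    using c2 by (intro sum.cong) (auto simp: bad_rate_def bad_single_def simp del: of_nat_sum)
  \<comment> \<open>All pairs by the elementary symmetric function, less those in
    \<open>X\<close>.\<close>
  have pp: "(\<Sum>e\<in>vertex_pairs V - X. \<Prod>v\<in>e. f v) = (S\<^sup>2 - Q) / 2 - R"
    using sum_vertex_pairs_prod[OF r(3), of f] r(3,4) X
    by (simp add: sum_diff R_def S_def Q_def pair_moment_def f_def)
  have "pair_or_loop V = ((\<lambda>v. {v}) ` V \<union> X) \<union> (vertex_pairs V - X)"
    using r(4) by (auto simp: pair_or_loop_def)
  moreover have "((\<lambda>v. {v}) ` V \<union> X) \<inter> (vertex_pairs V - X) = {}" "(\<lambda>v. {v}) ` V \<inter> X = {}"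
    using r(4) by (auto simp: vertex_pairs_def)
  ultimately have tot: "(\<Sum>e\<in>pair_or_loop V. bad_rate V X r e) =
      S / 2 / (N - 1) + K / (N - 1) + ((S\<^sup>2 - Q) / 2 - R) / (2 * (N - 1) * (N - 3))"
    using r(3) X loops xs ps pp by (simp add: sum.union_disjoint)
  have mean: "bad_mean V X r = S / (2 * N) + (S / (2 * N))\<^sup>2 + K / N"
    by (simp add: bad_mean_def S_def K_def N_def)
  show ?thesis unfolding tot mean N_def[symmetric]
  proof (rule rate_sum_estimate[OF N])
    show "real d \<ge> 1" using d by simp
    show "0 \<le> S" "S \<le> real d * N" using pair_moment_bounds[OF r(1)] by (auto simp: S_def N_def)
    show K': "0 \<le> K" "K \<le> real d ^ 2 * N" using edge_moment_bounds[OF r(3,4,2,1)] by (auto simp: K_def N_def)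
    show "0 \<le> Q" unfolding Q_def by (intro sum_nonneg) auto
    have "Q \<le> (\<Sum>v\<in>V. real d ^ 3 * real (r v))" unfolding Q_def
    proof (rule sum_mono)
      fix v assume "v \<in> V"
      then have "f v * f v \<le> (real d ^ 2) * (real d * real (r v))" using f by (intro mult_mono) auto
      then show "(f v)\<^sup>2 \<le> real d ^ 3 * real (r v)" by (simp add: power2_eq_square power3_eq_cube)
    qed
    also have "\<dots> = real d ^ 3 * N" by (simp add: N_def sum_distrib_left)
    also have "\<dots> \<le> real d ^ 4 * N" using d N by (intro mult_right_mono power_increasing) auto
    finally show "Q \<le> real d ^ 4 * N" .
    show "0 \<le> R" unfolding R_def by (intro sum_nonneg prod_nonneg) (auto simp: f_def nat_mult_pred_nonneg)
    have "R \<le> (\<Sum>e\<in>X. real d ^ 2 * (\<Prod>v\<in>e. real (r v)))" unfolding R_def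
    proof (rule sum_mono)
      fix e assume "e \<in> X"
      then obtain u v where uv: "e = {u,v}" "u \<noteq> v" "u \<in> V" "v \<in> V"
        using r(4) by (meson subsetD vertex_pairsE)
      have "f u * f v \<le> (real d * real (r u)) * (real d * real (r v))"
        using f uv by (intro mult_mono) auto
      then show "(\<Prod>v\<in>e. f v) \<le> real d ^ 2 * (\<Prod>v\<in>e. real (r v))"
        using uv by (simp add: power2_eq_square mult_ac)
    qed
    also have "\<dots> = real d ^ 2 * K" by (simp add: K_def edge_moment_def sum_distrib_left)
    also have "\<dots> \<le> real d ^ 2 * (real d ^ 2 * N)" using K' by (intro mult_left_mono) auto
    finally show "R \<le> real d ^ 4 * N" by (simp add: power2_eq_square power4_eq_xxxx mult_ac)
  qed
qed

lemma bad_drop_le: "bad_drop X r e v \<le> r v"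
  by (auto simp: bad_drop_def drop_edge_def)

lemma sum_bad_drop:
  assumes V: "finite V" and e: "e \<in> pair_or_loop V" and "bad_rate V X r e \<noteq> 0"
  shows "(\<Sum>v\<in>V. bad_drop X r e v) + (if bad_single X e then 2 else 4) = (\<Sum>v\<in>V. r v)"
proof (cases "bad_single X e")
  case True
  then show ?thesis using sum_drop_edge_cases[OF V e, of r] assms(3) by (auto simp: bad_drop_def bad_rate_def)
next
  case False
  then obtain u v where uv: "e = {u,v}" "u \<noteq> v"
    using e by (auto simp: bad_single_def elim!: pair_or_loop_cases)
  have "r u \<ge> 2" "r v \<ge> 2"
    using assms(3) False uv by (auto simp: bad_rate_def not_le numeral_2_eq_2 less_Suc_eq)
  then have "edge_ways r e \<noteq> 0" "edge_ways (drop_edge r e) e \<noteq> 0"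
    using uv by (auto simp: edge_ways_def drop_edge_def incidence_def)
  from sum_drop_edge_cases[OF V e this(1)] sum_drop_edge_cases[OF V e this(2)]
  show ?thesis using False by (simp add: bad_drop_def)
qed

text \<open>A nonzero rate means that the removed edges fit, so exactly 2 or 4 half-edges disappear
  and the parity is kept.\<close>

lemma admissible_bad_drop:
  assumes "admissible d V X r" "e \<in> pair_or_loop V" "bad_rate V X r e \<noteq> 0"
  shows "admissible d V X (bad_drop X r e)"
proof -
  have a: "finite V" "X \<subseteq> vertex_pairs V" "even (\<Sum>v\<in>V. r v)" "\<forall>v\<in>V. r v \<le> d \<and> graph_degree X v \<le> d"
    using assms(1) by (auto simp: admissible_def)
  note s = sum_bad_drop[OF a(1) assms(2,3)]
  have "even ((\<Sum>v\<in>V. bad_drop X r e v) + (if bad_single X e then 2 else 4))" unfolding s by (rule a(3))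
  then have "even (\<Sum>v\<in>V. bad_drop X r e v)" by (auto split: if_splits)
  then show ?thesis using a bad_drop_le[of X r e] unfolding admissible_def by (meson order_trans)
qed

lemma bad_gf_bounds:
  assumes "finite V" "even (\<Sum>v\<in>V. r v)" "0 \<le> t" "t \<le> 1"
  shows "0 \<le> bad_gf V X r t" "bad_gf V X r t \<le> 1"
  using mg_avg_mono[of V r "\<lambda>_. 0" "\<lambda>m. (1 - t) ^ bad_count V X m"]
    mg_avg_mono[of V r "\<lambda>m. (1 - t) ^ bad_count V X m" "\<lambda>_. 1"] assms
  by (auto simp: bad_gf_def mg_avg_const power_le_one)

lemma bad_gf_zero:
  assumes "finite V" "even (\<Sum>v\<in>V. r v)"
  shows "bad_gf V X r 0 = 1"
  using assms by (simp add: bad_gf_def mg_avg_const)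

text \<open>The two powers differ only if the planted pair occurs once more, which costs at most the
  expectation of \<open>m e\<close>. That is at most \<open>d\<^sup>2 / (N - 5)\<close>, and
  \<open>N \<ge> 10\<close> makes \<open>N - 5\<close> at least \<open>N / 2\<close>.\<close>

lemma mg_avg_bad_error:
  assumes adm: "admissible d V X r" and e: "e \<in> pair_or_loop V" and rate: "bad_rate V X r e \<noteq> 0"
    and N: "(\<Sum>v\<in>V. r v) \<ge> 10" and t: "0 \<le> t" "t \<le> 1"
  shows "\<bar>mg_avg V (bad_drop X r e) (\<lambda>m. (1 - t) ^ (bad_count V X m + (if bad_single X e then 0 else 2 * m e)))
     - bad_gf V X (bad_drop X r e) t\<bar> \<le> 2 * real d ^ 2 / real (\<Sum>v\<in>V. r v)"
proof (cases "bad_single X e")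
  case True
  then show ?thesis by (simp add: bad_gf_def sum_nonneg)
next
  case False
  define r' where "r' = bad_drop X r e"
  define N' where "N' = (\<Sum>v\<in>V. r' v)"
  have V: "finite V" using adm by (simp add: admissible_def)
  have adm': "admissible d V X r'" unfolding r'_def by (rule admissible_bad_drop[OF adm e rate])
  have NN: "N' + 4 = (\<Sum>v\<in>V. r v)" using sum_bad_drop[OF V e rate] False by (simp add: N'_def r'_def)
  have N'2: "N' \<ge> 2" using NN N by linarith
  have ev: "even (\<Sum>v\<in>V. r' v)" using adm' by (simp add: admissible_def)
  have "\<bar>mg_avg V r' (\<lambda>m. (1 - t) ^ (bad_count V X m + 2 * m e)) - bad_gf V X r' t\<bar> \<le>
     mg_avg V r' (\<lambda>m. \<bar>(1 - t) ^ (bad_count V X m + 2 * m e) - (1 - t) ^ bad_count V X m\<bar>)"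
    unfolding bad_gf_def mg_avg_diff[symmetric] by (rule mg_avg_abs_le)
  also have "\<dots> \<le> mg_avg V r' (\<lambda>m. real (m e) * 1)"
  proof (rule mg_avg_mono)
    fix m
    show "\<bar>(1 - t) ^ (bad_count V X m + 2 * m e) - (1 - t) ^ bad_count V X m\<bar> \<le> real (m e) * 1"
    proof (cases "m e = 0")
      case False
      have "(1 - t) ^ k \<in> {0..1}" for k using t by (auto intro: power_le_one)
      then have "\<bar>(1 - t) ^ (bad_count V X m + 2 * m e) - (1 - t) ^ bad_count V X m\<bar> \<le> 1"
        by (simp add: abs_le_iff) (smt (verit) t zero_le_power power_le_one)
      also have "1 \<le> real (m e)" using False by simp
      finally show ?thesis by simp
    qed simp
  qed
  also have "\<dots> = edge_ways r' e / (real N' - 1) * mg_avg V (drop_edge r' e) (\<lambda>_. 1)"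
    unfolding N'_def using N'2 by (intro mg_avg_shift[OF V e ev]) (simp add: N'_def)
  also have "\<dots> \<le> real d ^ 2 / (real N' - 1)"
  proof (cases "edge_ways r' e = 0")
    case True
    then show ?thesis using N'2 by simp
  next
    case F: False
    have "(\<Sum>v\<in>V. drop_edge r' e v) + 2 = (\<Sum>v\<in>V. r' v)" by (rule sum_drop_edge_cases[OF V e F])
    then have "even (\<Sum>v\<in>V. drop_edge r' e v)" using ev by (metis even_add even_numeral)
    then have "mg_avg V (drop_edge r' e) (\<lambda>_. 1) = 1" by (rule mg_avg_const[OF V])
    moreover have "edge_ways r' e \<le> real d ^ 2"
    proof -
      obtain u v where uv: "e = {u,v}" "u \<noteq> v" "u \<in> V" "v \<in> V"
        using e False by (auto simp: bad_single_def elim!: pair_or_loop_cases)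
      have "r' u \<le> d" "r' v \<le> d" using adm' uv by (auto simp: admissible_def)
      then have "real (r' u) * real (r' v) \<le> real d * real d" by (intro mult_mono) auto
      then show ?thesis using uv by (simp add: edge_ways_def power2_eq_square)
    qed
    ultimately show ?thesis using N'2 by (simp add: divide_right_mono)
  qed
  also have "\<dots> \<le> 2 * real d ^ 2 / real (\<Sum>v\<in>V. r v)"
  proof -
    have "real (\<Sum>v\<in>V. r v) = real N' + 4" using NN by linarith
    moreover have "real N' \<ge> 6" using NN N by linarith
    ultimately show ?thesis by (simp add: field_simps del: of_nat_sum) (simp add: mult_right_mono)
  qed
  finally show ?thesis using False by (simp add: r'_def)
qed

section \<open>Comparison of the generating function with an exponential\<close>

lemma exp_minus_lipschitz:
  fixes x y :: real
  assumes "x \<ge> 0" "y \<ge> 0"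
  shows "\<bar>exp (- x) - exp (- y)\<bar> \<le> \<bar>x - y\<bar>"
proof -
  have *: "\<bar>exp (- x) - exp (- y)\<bar> \<le> \<bar>x - y\<bar>" if "0 \<le> x" "x \<le> y" for x y :: real
  proof -
    have "exp (- x) - exp (- y) = exp (- x) * (1 - exp (- (y - x)))"
      by (simp add: algebra_simps flip: exp_add)
    also have "\<dots> \<le> 1 * (y - x)"
    proof (rule mult_mono)
      show "1 - exp (- (y - x)) \<le> y - x" using exp_ge_add_one_self[of "- (y - x)"] by linarith
    qed (use that in auto)
    finally show ?thesis using that by simp
  qed
  show ?thesis using *[of x y] *[of y x] assms by (cases "x \<le> y") (auto simp: abs_minus_commute)
qed

text \<open>If \<open>g\<close> is the antiderivative of the bound with \<open>g 0 = 0\<close>, then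
  \<open>g - f\<close> and \<open>g + f\<close> are both nondecreasing and start at 0.\<close>

lemma growth_from_derivative_bound:
  fixes f f' :: "real \<Rightarrow> real"
  assumes f: "\<And>s. 0 \<le> s \<Longrightarrow> s \<le> t \<Longrightarrow> (f has_real_derivative f' s) (at s)"
    and b: "\<And>s. 0 \<le> s \<Longrightarrow> s \<le> t \<Longrightarrow> \<bar>f' s\<bar> \<le> a + A * ((A * s) ^ J / fact J)"
    and "f 0 = 0" "0 \<le> t"
  shows "\<bar>f t\<bar> \<le> a * t + (A * t) ^ Suc J / fact (Suc J)"
proof -
  define g where "g s = a * s + (A * s) ^ Suc J / fact (Suc J)" for s
  have g: "(g has_real_derivative a + A * ((A * s) ^ J / fact J)) (at s)" for s
  proof -
    have "(fact (Suc J) :: real) = real (Suc J) * fact J" by simp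
    then have eq: "a + real (Suc J) * (A * (A * s) ^ J) / fact (Suc J) = a + A * ((A * s) ^ J / fact J)"
      by (simp del: of_nat_Suc fact_Suc)
    have "(g has_real_derivative a + real (Suc J) * (A * (A * s) ^ J) / fact (Suc J)) (at s)"
      unfolding g_def by (auto intro!: derivative_eq_intros simp del: fact_Suc power_Suc)
    then show ?thesis unfolding eq .
  qed
  have "g 0 - f 0 \<le> g t - f t"
    using assms(4)
  proof (rule DERIV_nonneg_imp_nondecreasing)
    fix s assume s: "0 \<le> s" "s \<le> t"
    show "\<exists>y. ((\<lambda>s. g s - f s) has_real_derivative y) (at s) \<and> 0 \<le> y"
      using DERIV_diff[OF g f[OF s]] b[OF s] by (intro exI conjI) auto
  qed
  moreover have "g 0 + f 0 \<le> g t + f t"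
    using assms(4)
  proof (rule DERIV_nonneg_imp_nondecreasing)
    fix s assume s: "0 \<le> s" "s \<le> t"
    show "\<exists>y. ((\<lambda>s. g s + f s) has_real_derivative y) (at s) \<and> 0 \<le> y"
      using DERIV_add[OF g f[OF s]] b[OF s] by (intro exI conjI) auto
  qed
  ultimately show ?thesis using assms(3) by (simp add: g_def abs_le_iff)
qed

text \<open>The derivative of \<open>bad_gf V X r\<close> is, up to a small error, minus the sum of
  \<open>bad_rate V X r e * bad_gf V X (bad_drop X r e)\<close>. Comparing with the differential equation of
  \<open>\<lambda>t. exp (- (\<mu> * t))\<close> is therefore a Picard iteration over all degree sequences at once; every
  round replaces the error term \<open>(c * t) ^ J / fact J\<close> by the next one.\<close>

lemma bad_gf_iterate_step:
  assumes adm: "admissible d V X r" and d: "d \<ge> 1" and N10: "(\<Sum>v\<in>V. r v) \<ge> 10" and t: "0 \<le> t" "t \<le> 1"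
    and C: "C \<ge> 0"
    and IH: "\<And>r' s. admissible d V X r' \<Longrightarrow> (\<Sum>v\<in>V. r v) \<le> (\<Sum>v\<in>V. r' v) + 4 \<Longrightarrow> 0 \<le> s \<Longrightarrow> s \<le> 1 \<Longrightarrow>
       \<bar>bad_gf V X r' s - exp (- (bad_mean V X r' * s))\<bar> \<le>
         C / real (\<Sum>v\<in>V. r' v) + (13 * real d ^ 4 * s) ^ J / fact J"
  shows "\<bar>bad_gf V X r t - exp (- (bad_mean V X r * t))\<bar> \<le>
     (13 * real d ^ 4 * (2 * real d ^ 2 + 2 * C + 20 * real d ^ 4) + 11 * real d ^ 4) / real (\<Sum>v\<in>V. r v) +
       (13 * real d ^ 4 * t) ^ Suc J / fact (Suc J)"
proof -
  define N where "N = real (\<Sum>v\<in>V. r v)"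
  have N: "N \<ge> 10" using N10 unfolding N_def by linarith
  define \<mu> where "\<mu> = bad_mean V X r"
  \<comment> \<open>A bound for the total rate: the mean is at most \<open>2 * d ^ 4\<close>, and
    the rates miss it by at most \<open>11 * d ^ 4\<close>.\<close>
  define A where "A = 13 * real d ^ 4"
  have V: "finite V" and ev: "even (\<Sum>v\<in>V. r v)" using adm by (auto simp: admissible_def)
  define p where "p e = bad_rate V X r e" for e
  define g where "g e s = mg_avg V (bad_drop X r e)
         (\<lambda>m. (1 - s) ^ (bad_count V X m + (if bad_single X e then 0 else 2 * m e)))" for e s
  define f' where "f' s = - (\<Sum>e\<in>pair_or_loop V. p e * g e s) + \<mu> * exp (- (\<mu> * s))" for s
  \<comment> \<open>Three errors for each \<open>e\<close>: further copies of the planted pair, the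
    hypothesis at the reduced degrees, where \<open>C / N' \<le> 2 * C / N\<close>, and the drift of
    the mean.\<close>
  define B where "B = (2 * real d ^ 2 + 2 * C + 20 * real d ^ 4) / N"
  have p0: "p e \<ge> 0" if "e \<in> pair_or_loop V" for e
    unfolding p_def using that N10 by (intro bad_rate_nonneg) auto
  have psum: "\<bar>(\<Sum>e\<in>pair_or_loop V. p e) - \<mu>\<bar> \<le> 11 * real d ^ 4 / N"
    unfolding p_def \<mu>_def N_def using N10 by (intro bad_rate_sum[OF adm d]) auto
  have \<mu>0: "0 \<le> \<mu>" "\<mu> \<le> 2 * real d ^ 4"
    unfolding \<mu>_def using bad_mean_nonneg[OF adm] bad_mean_upper[OF adm d] by auto
  have pA: "(\<Sum>e\<in>pair_or_loop V. p e) \<le> A"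
  proof -
    have "11 * real d ^ 4 / N \<le> 11 * real d ^ 4" using N by (simp add: divide_le_eq mult_le_cancel_left1)
    then show ?thesis using psum \<mu>0 unfolding A_def by (simp add: abs_le_iff)
  qed
  have key: "p e * \<bar>g e s - exp (- (\<mu> * s))\<bar> \<le> p e * (B + (A * s) ^ J / fact J)"
    if e: "e \<in> pair_or_loop V" and s: "0 \<le> s" "s \<le> 1" for e s
  proof (cases "p e = 0")
    case False
    then have rate: "bad_rate V X r e \<noteq> 0" by (simp add: p_def)
    define r' where "r' = bad_drop X r e"
    define N' where "N' = real (\<Sum>v\<in>V. r' v)"
    have adm': "admissible d V X r'" unfolding r'_def by (rule admissible_bad_drop[OF adm e rate])
    have le: "(\<Sum>v\<in>V. r v) \<le> (\<Sum>v\<in>V. r' v) + 4"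
      using sum_bad_drop[OF V e rate] by (simp add: r'_def split: if_splits)
    then have NN: "N \<le> N' + 4" unfolding N_def N'_def by linarith
    have 1: "\<bar>g e s - bad_gf V X r' s\<bar> \<le> 2 * real d ^ 2 / N"
      unfolding g_def r'_def N_def by (rule mg_avg_bad_error[OF adm e rate N10 s])
    have 2: "\<bar>bad_gf V X r' s - exp (- (bad_mean V X r' * s))\<bar> \<le> C / N' + (A * s) ^ J / fact J"
      unfolding N'_def A_def by (rule IH[OF adm' le s])
    have "C / N' \<le> C / (N / 2)" using NN N C by (intro divide_left_mono) auto
    then have 2: "\<bar>bad_gf V X r' s - exp (- (bad_mean V X r' * s))\<bar> \<le> 2 * C / N + (A * s) ^ J / fact J"
      using 2 by (simp add: mult.commute)
    have "\<bar>exp (- (bad_mean V X r' * s)) - exp (- (\<mu> * s))\<bar> \<le> \<bar>bad_mean V X r' * s - \<mu> * s\<bar>"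
      using bad_mean_nonneg[OF adm'] \<mu>0 s by (intro exp_minus_lipschitz) auto
    also have "\<dots> = \<bar>\<mu> - bad_mean V X r'\<bar> * s"
      using s by (simp add: left_diff_distrib[symmetric] abs_mult abs_minus_commute)
    also have "\<dots> \<le> (20 * real d ^ 4 / N) * 1"
    proof (rule mult_mono)
      show "\<bar>\<mu> - bad_mean V X r'\<bar> \<le> 20 * real d ^ 4 / N" unfolding \<mu>_def N_def
        using le N10 bad_drop_le[of X r e] by (intro bad_mean_diff[OF adm _ d]) (auto simp: r'_def)
    qed (use s N in auto)
    finally have 3: "\<bar>exp (- (bad_mean V X r' * s)) - exp (- (\<mu> * s))\<bar> \<le> 20 * real d ^ 4 / N" by simp
    have "\<bar>g e s - exp (- (\<mu> * s))\<bar> \<le> 2 * real d ^ 2 / N + (2 * C / N + (A * s) ^ J / fact J) + 20 * real d ^ 4 / N"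
      using 1 2 3 by linarith
    also have "\<dots> = B + (A * s) ^ J / fact J" by (simp add: B_def add_divide_distrib)
    finally show ?thesis using p0[OF e] by (intro mult_left_mono)
  qed simp
  have "\<bar>bad_gf V X r t - exp (- (\<mu> * t))\<bar> \<le> (A * B + 11 * real d ^ 4 / N) * t + (A * t) ^ Suc J / fact (Suc J)"
  proof (rule growth_from_derivative_bound[where f' = f' and f = "\<lambda>s. bad_gf V X r s - exp (- (\<mu> * s))"])
    show "bad_gf V X r 0 - exp (- (\<mu> * 0)) = 0" by (simp add: bad_gf_zero[OF V ev])
    show "0 \<le> t" by fact
    fix s assume s: "0 \<le> s" "s \<le> t"
    have N4: "(\<Sum>v\<in>V. r v) \<ge> 4" using N10 by linarith
    have D: "(bad_gf V X r has_real_derivative - (\<Sum>e\<in>pair_or_loop V. p e * g e s)) (at s)"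
      unfolding p_def g_def by (rule bad_gf_deriv[OF V ev N4])
    show "((\<lambda>s. bad_gf V X r s - exp (- (\<mu> * s))) has_real_derivative f' s) (at s)"
      unfolding f'_def by (rule derivative_eq_intros D refl)+ (simp add: mult.commute)
    \<comment> \<open>The errors of the single averages are separated from the error of the total
      rate; only the former carry the iterated term.\<close>
    have f': "f' s = - (\<Sum>e\<in>pair_or_loop V. p e * (g e s - exp (- (\<mu> * s)))) - ((\<Sum>e\<in>pair_or_loop V. p e) - \<mu>) * exp (- (\<mu> * s))"
      by (simp add: f'_def algebra_simps sum_subtractf sum_distrib_left sum_distrib_right)
    have "\<bar>\<Sum>e\<in>pair_or_loop V. p e * (g e s - exp (- (\<mu> * s)))\<bar> \<le> (\<Sum>e\<in>pair_or_loop V. \<bar>p e * (g e s - exp (- (\<mu> * s)))\<bar>)"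
      by (rule sum_abs)
    also have "\<dots> = (\<Sum>e\<in>pair_or_loop V. p e * \<bar>g e s - exp (- (\<mu> * s))\<bar>)"
      by (intro sum.cong) (auto simp: abs_mult p0)
    also have "\<dots> \<le> (\<Sum>e\<in>pair_or_loop V. p e * (B + (A * s) ^ J / fact J))"
      using s t by (intro sum_mono key) auto
    also have "\<dots> = (\<Sum>e\<in>pair_or_loop V. p e) * (B + (A * s) ^ J / fact J)" by (simp add: sum_distrib_right)
    also have "\<dots> \<le> A * (B + (A * s) ^ J / fact J)"
      using pA C N s by (intro mult_right_mono) (auto simp: B_def A_def)
    finally have 1: "\<bar>\<Sum>e\<in>pair_or_loop V. p e * (g e s - exp (- (\<mu> * s)))\<bar> \<le> A * (B + (A * s) ^ J / fact J)" .
    have "\<bar>((\<Sum>e\<in>pair_or_loop V. p e) - \<mu>) * exp (- (\<mu> * s))\<bar> \<le> (11 * real d ^ 4 / N) * 1"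
      unfolding abs_mult using psum \<mu>0 s N by (intro mult_mono) auto
    then show "\<bar>f' s\<bar> \<le> A * B + 11 * real d ^ 4 / N + A * ((A * s) ^ J / fact J)"
      using 1 unfolding f' by (simp add: distrib_left)
  qed
  also have "\<dots> \<le> (A * B + 11 * real d ^ 4 / N) * 1 + (A * t) ^ Suc J / fact (Suc J)"
    using t C N by (intro add_right_mono mult_left_mono) (auto simp: A_def B_def)
  also have "\<dots> = (13 * real d ^ 4 * (2 * real d ^ 2 + 2 * C + 20 * real d ^ 4) + 11 * real d ^ 4) / N +
       (13 * real d ^ 4 * t) ^ Suc J / fact (Suc J)"
    by (simp only: A_def B_def times_divide_eq_right add_divide_distrib[symmetric] mult_1_right)
  finally show ?thesis unfolding \<mu>_def N_def .
qed

text \<open>The start is trivial, since both quantities lie between 0 and 1. The threshold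
  \<open>N0\<close> grows in every round because the hypothesis is applied after up to 4 half-edges
  have been removed. The constants do not depend on \<open>V\<close>, \<open>X\<close>,
  \<open>r\<close> or \<open>t\<close>.\<close>

lemma bad_gf_iterate:
  assumes d: "d \<ge> 1"
  shows "\<exists>C\<ge>0. \<exists>N0. \<forall>(V::'a set) X r t. admissible d V X r \<longrightarrow> (\<Sum>v\<in>V. r v) \<ge> N0 \<longrightarrow> 0 \<le> t \<longrightarrow> t \<le> 1 \<longrightarrow>
    \<bar>bad_gf V X r t - exp (- (bad_mean V X r * t))\<bar> \<le>
      C / real (\<Sum>v\<in>V. r v) + (13 * real d ^ 4 * t) ^ J / fact J"
proof (induction J)
  case 0
  have "\<bar>bad_gf V X r t - exp (- (bad_mean V X r * t))\<bar> \<le> 1"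
    if "admissible d V X r" "0 \<le> t" "t \<le> 1" for V :: "'a set" and X r t
  proof -
    have "0 \<le> bad_gf V X r t" "bad_gf V X r t \<le> 1"
      using that by (auto simp: admissible_def intro!: bad_gf_bounds)
    moreover have "0 \<le> exp (- (bad_mean V X r * t))" "exp (- (bad_mean V X r * t)) \<le> 1"
      using bad_mean_nonneg[OF that(1)] that(2) by auto
    ultimately show ?thesis by linarith
  qed
  then show ?case by (intro exI[of _ 0]) auto
next
  case (Suc J)
  then obtain C N0 where C: "C \<ge> 0" and IH: "\<And>(V::'a set) X r t. admissible d V X r \<Longrightarrow>
    (\<Sum>v\<in>V. r v) \<ge> N0 \<Longrightarrow> 0 \<le> t \<Longrightarrow> t \<le> 1 \<Longrightarrow>
    \<bar>bad_gf V X r t - exp (- (bad_mean V X r * t))\<bar> \<le> C / real (\<Sum>v\<in>V. r v) + (13 * real d ^ 4 * t) ^ J / fact J"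
    by blast
  define C' where "C' = 13 * real d ^ 4 * (2 * real d ^ 2 + 2 * C + 20 * real d ^ 4) + 11 * real d ^ 4"
  show ?case
  proof (intro exI[of _ C'] exI[of _ "N0 + 10"] conjI allI impI)
    show "0 \<le> C'" using C by (auto simp: C'_def)
    fix V :: "'a set" and X r and t :: real
    assume a: "admissible d V X r" "N0 + 10 \<le> (\<Sum>v\<in>V. r v)" "0 \<le> t" "t \<le> 1"
    show "\<bar>bad_gf V X r t - exp (- (bad_mean V X r * t))\<bar> \<le> C' / real (\<Sum>v\<in>V. r v) + (13 * real d ^ 4 * t) ^ Suc J / fact (Suc J)"
      unfolding C'_def by (rule bad_gf_iterate_step[OF a(1) d _ a(3,4) C IH]) (use a in auto)
  qed
qed

text \<open>The order of choices matters: \<open>J\<close> is fixed first to make the factorial term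
  small, and only then is the number of half-edges made large enough for the constant
  \<open>C\<close> that belongs to this \<open>J\<close>.\<close>

lemma bad_gf_one_limit:
  assumes d: "d \<ge> 1" and "\<epsilon> > 0"
  shows "\<exists>N0. \<forall>(V::'a set) X r. admissible d V X r \<longrightarrow> (\<Sum>v\<in>V. r v) \<ge> N0 \<longrightarrow>
    \<bar>bad_gf V X r 1 - exp (- bad_mean V X r)\<bar> \<le> \<epsilon>"
proof -
  have "(\<lambda>J. (13 * real d ^ 4) ^ J / fact J) \<longlonglongrightarrow> 0"
    using summable_LIMSEQ_zero[OF summable_exp[of "13 * real d ^ 4"]] by (simp add: divide_inverse mult.commute)
  then obtain J where J: "(13 * real d ^ 4) ^ J / fact J < \<epsilon> / 2"
    using assms(2) by (metis (no_types, lifting) eventually_happens' half_gt_zero order_tendstoD(2) sequentially_bot)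
  obtain C N0 where C: "C \<ge> 0" and IH: "\<And>(V::'a set) X r t. admissible d V X r \<Longrightarrow>
    (\<Sum>v\<in>V. r v) \<ge> N0 \<Longrightarrow> 0 \<le> t \<Longrightarrow> t \<le> 1 \<Longrightarrow>
    \<bar>bad_gf V X r t - exp (- (bad_mean V X r * t))\<bar> \<le> C / real (\<Sum>v\<in>V. r v) + (13 * real d ^ 4 * t) ^ J / fact J"
    using bad_gf_iterate[OF d, of J] by blast
  obtain N1 :: nat where N1: "real N1 > 2 * C / \<epsilon>" using reals_Archimedean2 by blast
  show ?thesis
  proof (intro exI[of _ "N0 + N1 + 1"] allI impI)
    fix V :: "'a set" and X r
    assume a: "admissible d V X r" "N0 + N1 + 1 \<le> (\<Sum>v\<in>V. r v)"
    define N where "N = real (\<Sum>v\<in>V. r v)"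
    have "N \<ge> real N1 + 1" using a(2) unfolding N_def by linarith
    then have "2 * C / \<epsilon> \<le> N" "N > 0" using N1 by auto
    then have "C / N \<le> \<epsilon> / 2" using assms(2) by (simp add: field_simps)
    moreover have "\<bar>bad_gf V X r 1 - exp (- bad_mean V X r)\<bar> \<le> C / N + (13 * real d ^ 4) ^ J / fact J"
      using IH[OF a(1), of 1] a(2) by (simp add: N_def)
    ultimately show "\<bar>bad_gf V X r 1 - exp (- bad_mean V X r)\<bar> \<le> \<epsilon>"
      using J by linarith
  qed
qed

text \<open>Simple graphs are the 0-1-valued multigraphs without loops, and these have weight 1. By
  \<open>0 ^ 0 = 1\<close> the power of 0 is the indicator of having no bad configuration.\<close>

lemma card_simple_graphs_avoiding:
  assumes V: "finite V" and X: "X \<subseteq> vertex_pairs V"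
  shows "real (card {E \<in> simple_graphs V. E \<inter> X = {} \<and> (\<forall>v\<in>V. graph_degree E v = r v)}) =
    mg_sum V r (\<lambda>m. 0 ^ bad_count V X m)"
proof -
  let ?G = "{E \<in> simple_graphs V. E \<inter> X = {} \<and> (\<forall>v\<in>V. graph_degree E v = r v)}"
  let ?M = "{m \<in> multigraphs V r. bad_count V X m = 0}"
  have zero: "bad_count V X m = 0 \<longleftrightarrow> (\<forall>e\<in>pair_or_loop V. if bad_single X e then m e = 0 else m e \<le> 1)" for m
  proof -
    have "(m e choose 2 = 0) = (m e \<le> 1)" for e by (auto simp: binomial_eq_0_iff)
    then show ?thesis using V by (auto simp: bad_count_def bad_copies_def)
  qed
  have fin: "finite e" if "e \<in> pair_or_loop V" for e using that by (auto elim!: pair_or_loop_cases)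
  have deg: "(\<Sum>e\<in>pair_or_loop V. incidence e v * (if e \<in> E then 1 else 0)) = graph_degree E v"
    if E: "E \<subseteq> vertex_pairs V" for E v
  proof -
    have "(\<Sum>e\<in>pair_or_loop V. incidence e v * (if e \<in> E then 1 else 0)) = (\<Sum>e\<in>{e\<in>E. v \<in> e}. 1)"
      using V E vertex_pairs_subset[of V]
      by (intro sum.mono_neutral_cong_right) (auto simp: incidence_def vertex_pairs_def)
    then show ?thesis by (simp add: graph_degree_def)
  qed
  have bij: "bij_betw (\<lambda>E e. if e \<in> E then 1 else 0) ?G ?M"
  proof (rule bij_betw_byWitness[where f' = "\<lambda>m. {e. m e = 1}"])
    show "\<forall>E\<in>?G. {e. (if e \<in> E then 1 else 0) = (1::nat)} = E" by auto
    show "\<forall>m\<in>?M. (\<lambda>e. if e \<in> {e. m e = 1} then 1 else 0) = m"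
    proof
      fix m assume m: "m \<in> ?M"
      have "m e \<le> 1" for e
        using m zero[of m] by (cases "e \<in> pair_or_loop V") (force simp: multigraphs_def split: if_splits)+
      then have "m e = 0 \<or> m e = 1" for e by (metis le_neq_implies_less less_one)
      then show "(\<lambda>e. if e \<in> {e. m e = 1} then 1 else 0) = m" by (auto simp: fun_eq_iff)
    qed
    show "(\<lambda>E e. if e \<in> E then 1 else 0) ` ?G \<subseteq> ?M"
    proof
      fix m assume "m \<in> (\<lambda>E e. if e \<in> E then 1 else 0::nat) ` ?G"
      then obtain E where m: "m = (\<lambda>e. if e \<in> E then 1 else 0)" and E: "E \<in> ?G" by auto
      have Ev: "E \<subseteq> vertex_pairs V" using E by (auto simp: simple_graphs_def vertex_pairs_def)
      have "m \<in> multigraphs V r"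
        using Ev E vertex_pairs_subset[of V] by (auto simp: multigraphs_def m deg[OF Ev])
      moreover have "bad_count V X m = 0"
        unfolding zero using Ev E by (auto simp: m bad_single_def vertex_pairs_def)
      ultimately show "m \<in> ?M" by simp
    qed
    show "(\<lambda>m. {e. m e = 1}) ` ?M \<subseteq> ?G"
    proof
      fix E assume "E \<in> (\<lambda>m. {e. m e = 1}) ` ?M"
      then obtain m where E: "E = {e. m e = 1}" and m: "m \<in> ?M" by auto
      have pl: "e \<in> pair_or_loop V" if "e \<in> E" for e
        using that m by (force simp: E multigraphs_def)
      have ns: "\<not> bad_single X e" if "e \<in> E" for e
        using pl[OF that] that m zero[of m] by (auto simp: E)
      have Ev: "E \<subseteq> vertex_pairs V"
        using pl ns by (fastforce simp: pair_or_loop_def bad_single_def)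
      have me: "m e = (if e \<in> E then 1 else 0)" for e
      proof (cases "e \<in> pair_or_loop V")
        case True
        then have "m e \<le> 1" using m zero[of m] by (force split: if_splits)
        then show ?thesis by (auto simp: E)
      qed (use m in \<open>auto simp: E multigraphs_def\<close>)
      have "graph_degree E v = r v" if "v \<in> V" for v
        using m that deg[OF Ev, of v] by (auto simp: multigraphs_def me[symmetric])
      moreover have "E \<inter> X = {}" using ns by (auto simp: bad_single_def)
      ultimately show "E \<in> ?G" using Ev by (auto simp: simple_graphs_def vertex_pairs_def)
    qed
  qed
  have "mg_sum V r (\<lambda>m. 0 ^ bad_count V X m) = (\<Sum>m\<in>?M. 1)"
    unfolding mg_sum_def
  proof (rule sum.mono_neutral_cong_right)
    fix m assume m: "m \<in> ?M"
    have "(\<Prod>e\<in>pair_or_loop V. edge_coeff e ^ m e / fact (m e)) = (\<Prod>e\<in>pair_or_loop V. 1)"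
    proof (rule prod.cong[OF refl])
      fix e assume e: "e \<in> pair_or_loop V"
      have "if bad_single X e then m e = 0 else m e \<le> 1" using e m zero[of m] by blast
      then have "m e = 0 \<or> (m e = 1 \<and> card e \<noteq> 1)" by (auto simp: bad_single_def le_Suc_eq split: if_splits)
      then show "edge_coeff e ^ m e / fact (m e) = 1" by (auto simp: edge_coeff_def)
    qed
    then show "mg_weight V m * 0 ^ bad_count V X m = 1" using m by (simp add: mg_weight_def)
  qed (use V in auto)
  also have "\<dots> = real (card ?G)" using bij_betw_same_card[OF bij] by simp
  finally show ?thesis by simp
qed

lemma card_simple_graphs_avoiding_eq:
  assumes V: "finite V" and X: "X \<subseteq> vertex_pairs V" and ev: "even (\<Sum>v\<in>V. r v)"
  shows "real (card {E \<in> simple_graphs V. E \<inter> X = {} \<and> (\<forall>v\<in>V. graph_degree E v = r v)}) =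
    matching_count (\<Sum>v\<in>V. r v) / (\<Prod>v\<in>V. fact (r v)) * bad_gf V X r 1"
  unfolding card_simple_graphs_avoiding[OF V X] bad_gf_def mg_avg_def
  using mg_sum_one_pos[OF V ev] by (simp add: mg_sum_one[OF V ev, symmetric])

section \<open>Trees with given degrees\<close>

lemma graph_degree_pos_iff:
  assumes "finite E"
  shows "graph_degree E v > 0 \<longleftrightarrow> (\<exists>e\<in>E. v \<in> e)"
  using assms by (auto simp: graph_degree_def card_gt_0_iff)

text \<open>In a longest path the first vertex \<open>x\<close> has an edge other than the one to
  its successor. The other end \<open>y\<close> of it cannot extend the path, so it lies on the
  path, and the initial segment up to \<open>y\<close> closes to a cycle.\<close>

lemma min_degree_two_imp_cycle:
  assumes V: "finite V" "V \<noteq> {}" and E: "E \<subseteq> vertex_pairs V" and deg: "\<forall>v\<in>V. graph_degree E v \<ge> 2"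
  shows "\<exists>vs. graph_cycle E vs"
proof -
  define path where "path vs \<longleftrightarrow> vs \<noteq> [] \<and> distinct vs \<and> set vs \<subseteq> V \<and>
    (\<forall>i. Suc i < length vs \<longrightarrow> {vs ! i, vs ! Suc i} \<in> E)" for vs
  obtain v0 where "v0 \<in> V" using V by auto
  then have "path [v0]" by (auto simp: path_def)
  moreover have "\<forall>vs. path vs \<longrightarrow> length vs < Suc (card V)"
    using V by (auto simp: path_def less_Suc_eq_le distinct_card[symmetric] intro: card_mono)
  ultimately obtain vs where vs: "path vs" and max: "\<And>ws. path ws \<Longrightarrow> length ws \<le> length vs"
    using ex_has_greatest_nat[of path "[v0]" length "Suc (card V)"] by blast
  define x where "x = vs ! 0"
  have ne: "vs \<noteq> []" and dist: "distinct vs" and sub: "set vs \<subseteq> V"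
    and edge: "\<And>i. Suc i < length vs \<Longrightarrow> {vs ! i, vs ! Suc i} \<in> E" using vs by (auto simp: path_def)
  have xV: "x \<in> V" using ne sub by (auto simp: x_def)
  \<comment> \<open>For a path with a single vertex this is an unspecified value; the argument holds
    for every value of it.\<close>
  define z where "z = vs ! 1"
  have "\<exists>e\<in>E. x \<in> e \<and> e \<noteq> {x, z}"
  proof (rule ccontr)
    assume "\<not> ?thesis"
    then have "{e \<in> E. x \<in> e} \<subseteq> {{x, z}}" by auto
    then have "card {e \<in> E. x \<in> e} \<le> card {{x, z}}" by (intro card_mono) auto
    then show False using deg xV by (auto simp: graph_degree_def)
  qed
  then obtain e where e: "e \<in> E" "x \<in> e" "e \<noteq> {x, z}" by blast
  obtain a b where ab: "e = {a, b}" "a \<noteq> b" "a \<in> V" "b \<in> V" using e(1) E by (meson subsetD vertex_pairsE)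
  define y where "y = (if a = x then b else a)"
  have y: "e = {x, y}" "y \<noteq> x" "y \<in> V" "y \<noteq> z" using ab e by (auto simp: y_def)
  show ?thesis
  proof (cases "y \<in> set vs")
    case False
    have "path (y # vs)"
      unfolding path_def
    proof (intro conjI allI impI)
      fix i assume "Suc i < length (y # vs)"
      then show "{(y # vs) ! i, (y # vs) ! Suc i} \<in> E"
        using edge[of "i - 1"] e(1) y(1) by (cases i) (auto simp: x_def insert_commute)
    qed (use False dist sub y in auto)
    then show ?thesis using max[of "y # vs"] by simp
  next
    case True
    then obtain i where i: "i < length vs" "y = vs ! i" by (auto simp: in_set_conv_nth)
    have "i \<noteq> 0" using y(2) i(2) by (metis x_def)
    moreover have "i \<noteq> 1" using y(4) i(2) by (metis z_def)
    ultimately have i2: "i \<ge> 2" by simp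
    have "graph_cycle E (take (Suc i) vs)"
      unfolding graph_cycle_def
    proof (intro conjI allI impI)
      show "3 \<le> length (take (Suc i) vs)" using i2 i by simp
      show "distinct (take (Suc i) vs)" using dist by simp
      fix j assume "j < length (take (Suc i) vs)"
      then have j: "j \<le> i" using i by simp
      show "{take (Suc i) vs ! j, take (Suc i) vs ! (Suc j mod length (take (Suc i) vs))} \<in> E"
      proof (cases "j = i")
        case True
        then show ?thesis using i e(1) y(1) by (simp add: x_def insert_commute)
      next
        case False
        then show ?thesis using edge[of j] i j by simp
      qed
    qed
    then show ?thesis by blast
  qed
qed

lemma simple_graphs_eq_Pow: "simple_graphs V = Pow (vertex_pairs V)"
  by (auto simp: simple_graphs_def vertex_pairs_def)

lemma graph_tree_subset: "graph_tree V T \<Longrightarrow> T \<subseteq> vertex_pairs V"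
  by (simp add: graph_tree_def simple_graphs_eq_Pow)

lemma graph_tree_finite: "finite V \<Longrightarrow> graph_tree V T \<Longrightarrow> finite T"
  using finite_subset[OF graph_tree_subset finite_vertex_pairs] by blast

lemma tree_degree_pos:
  assumes V: "finite V" and T: "graph_tree V T" and "card V \<ge> 2" and v: "v \<in> V"
  shows "graph_degree T v > 0"
proof -
  have "V \<noteq> {v}" using assms(3) by auto
  then obtain w where w: "w \<in> V" "w \<noteq> v" using v by blast
  have "(v, w) \<in> {(x, y). {x, y} \<in> T}\<^sup>*" using T v w by (auto simp: graph_tree_def graph_connected_def)
  then obtain y where "{v, y} \<in> T" using w(2) by (auto elim: converse_rtranclE)
  then show ?thesis unfolding graph_degree_pos_iff[OF graph_tree_finite[OF V T]] by blast
qed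

text \<open>Connectedness excludes degree 0, and minimum degree 2 would force a cycle.\<close>

lemma tree_has_leaf:
  assumes V: "finite V" and T: "graph_tree V T" and c: "card V \<ge> 2"
  obtains v where "v \<in> V" "graph_degree T v = 1"
proof -
  have "V \<noteq> {}" using c by auto
  then have "\<not> (\<forall>v\<in>V. graph_degree T v \<ge> 2)"
    using min_degree_two_imp_cycle[OF V _ graph_tree_subset[OF T]] T by (auto simp: graph_tree_def)
  then obtain v where "v \<in> V" "graph_degree T v < 2" by auto
  moreover have "graph_degree T v > 0" by (rule tree_degree_pos[OF V T c]) fact
  ultimately show ?thesis using that[of v] by auto
qed

lemma leaf_edge:
  assumes T: "T \<subseteq> vertex_pairs V" and deg: "graph_degree T v = 1"
  obtains u where "u \<in> V" "u \<noteq> v" "{e \<in> T. v \<in> e} = {{v, u}}"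
proof -
  obtain e where e: "{e \<in> T. v \<in> e} = {e}" using deg by (auto simp: graph_degree_def card_1_singleton_iff)
  then have "e \<in> T" "v \<in> e" by auto
  then obtain a b where ab: "e = {a, b}" "a \<noteq> b" "a \<in> V" "b \<in> V" using T by (meson subsetD vertex_pairsE)
  define u where "u = (if a = v then b else a)"
  have "e = {v, u}" "u \<in> V" "u \<noteq> v" using ab \<open>v \<in> e\<close> by (auto simp: u_def)
  then show ?thesis using that[of u] e by simp
qed

text \<open>Sending \<open>v\<close> to its only neighbour \<open>u\<close> maps walks of
  \<open>T\<close> to walks that avoid \<open>v\<close>, because the steps through \<open>v\<close>
  collapse. So connectedness survives.\<close>

lemma tree_remove_leaf:
  assumes T: "graph_tree V T" and u: "u \<in> V" "u \<noteq> v" and leaf: "{e \<in> T. v \<in> e} = {{v, u}}"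
  shows "graph_tree (V - {v}) (T - {{v, u}})"
proof -
  let ?T = "T - {{v, u}}"
  have notin: "v \<notin> e" if "e \<in> ?T" for e using leaf that by blast
  have simple: "?T \<in> simple_graphs (V - {v})"
    using graph_tree_subset[OF T] notin by (auto simp: simple_graphs_def vertex_pairs_def)
  define \<pi> where "\<pi> z = (if z = v then u else z)" for z
  have red: "(x, \<pi> y) \<in> {(x, y). {x, y} \<in> ?T}\<^sup>*" if "(x, y) \<in> {(x, y). {x, y} \<in> T}\<^sup>*" "x \<noteq> v" for x y
    using that(1)
  proof (induction rule: rtrancl_induct)
    case base
    show ?case using that(2) by (simp add: \<pi>_def)
  next
    case (step y z)
    then have yz: "{y, z} \<in> T" by simp
    show ?case
    proof (cases "y = v \<or> z = v")
      case True
      then have "{y, z} \<in> {e \<in> T. v \<in> e}" using yz by auto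
      then have "{y, z} = {v, u}" unfolding leaf by simp
      then have "\<pi> y = \<pi> z" by (auto simp: \<pi>_def doubleton_eq_iff)
      then show ?thesis using step.IH by simp
    next
      case False
      then have "(\<pi> y, \<pi> z) \<in> {(x, y). {x, y} \<in> ?T}" using yz by (auto simp: \<pi>_def)
      then show ?thesis using step.IH by (rule rtrancl_into_rtrancl[rotated])
    qed
  qed
  have "(x, y) \<in> {(x, y). {x, y} \<in> ?T}\<^sup>*" if "x \<in> V - {v}" "y \<in> V - {v}" for x y
    using red[of x y] that T by (auto simp: \<pi>_def graph_tree_def graph_connected_def)
  then have conn: "graph_connected (V - {v}) ?T" using u by (auto simp: graph_connected_def)
  have "\<nexists>vs. graph_cycle ?T vs" using T by (auto simp: graph_tree_def graph_cycle_def)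
  then show ?thesis using simple conn by (simp add: graph_tree_def)
qed

text \<open>On a cycle through \<open>v\<close> both neighbours of \<open>v\<close> would be
  \<open>u\<close>, as \<open>{v, u}\<close> is the only edge at \<open>v\<close>; but they stand at
  different places of a list without repetition.\<close>

lemma tree_add_leaf:
  assumes T: "graph_tree (V - {v}) T" and u: "u \<in> V - {v}" and v: "v \<in> V"
  shows "graph_tree V (insert {v, u} T)"
proof -
  let ?T = "insert {v, u} T"
  have sub: "T \<subseteq> vertex_pairs (V - {v})" by (rule graph_tree_subset[OF T])
  then have notin: "v \<notin> e" if "e \<in> T" for e using that by (auto simp: vertex_pairs_def)
  have simple: "?T \<in> simple_graphs V"
    using sub u v by (auto simp: simple_graphs_def vertex_pairs_def)
  let ?R = "{(x, y). {x, y} \<in> ?T}"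
  have "sym ?R" by (auto simp: sym_def insert_commute)
  then have symR: "(x, y) \<in> ?R\<^sup>* \<Longrightarrow> (y, x) \<in> ?R\<^sup>*" for x y by (metis sym_rtrancl symD)
  have to_u: "(x, u) \<in> ?R\<^sup>*" if "x \<in> V" for x
  proof (cases "x = v")
    case True
    then show ?thesis by (auto intro: r_into_rtrancl)
  next
    case False
    then have "(x, u) \<in> {(x, y). {x, y} \<in> T}\<^sup>*" using T u that by (auto simp: graph_tree_def graph_connected_def)
    then show ?thesis by (rule subsetD[OF rtrancl_mono, rotated]) auto
  qed
  then have conn: "graph_connected V ?T" using v symR by (auto simp: graph_connected_def intro: rtrancl_trans)
  have "\<not> graph_cycle ?T vs" for vs
  proof
    assume cyc: "graph_cycle ?T vs"
    define n where "n = length vs"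
    have n: "n \<ge> 3" and dist: "distinct vs"
      and edge: "\<And>i. i < n \<Longrightarrow> {vs ! i, vs ! (Suc i mod n)} \<in> ?T" using cyc by (auto simp: graph_cycle_def n_def)
    show False
    proof (cases "v \<in> set vs")
      case False
      have "{vs ! i, vs ! (Suc i mod n)} \<in> T" if "i < n" for i
      proof -
        have "Suc i mod n < n" using n by simp
        then have "vs ! i \<in> set vs" "vs ! (Suc i mod n) \<in> set vs" using that by (auto simp: n_def)
        then have "{vs ! i, vs ! (Suc i mod n)} \<noteq> {v, u}" using False by (metis doubleton_eq_iff)
        then show ?thesis using edge[OF that] by simp
      qed
      then have "graph_cycle T vs" using n dist by (simp add: graph_cycle_def n_def)
      then show False using T by (simp add: graph_tree_def)
    next
      case True
      then obtain i where i: "i < n" "vs ! i = v" by (auto simp: in_set_conv_nth n_def)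
      define k where "k = Suc i mod n"
      \<comment> \<open>The cyclic predecessor of \<open>i\<close>. It differs from the successor
        \<open>k\<close> because \<open>n \<ge> 3\<close>.\<close>
      define j where "j = (if i = 0 then n - 1 else i - 1)"
      have jk: "j < n" "k < n" "Suc j mod n = i" "j \<noteq> k"
        using i n by (auto simp: j_def k_def mod_Suc split: if_splits)
      have "vs ! k = u"
        using edge[OF i(1)] notin i unfolding k_def by (auto simp: doubleton_eq_iff)
      moreover have "vs ! j = u"
        using edge[OF jk(1)] notin i unfolding jk(3) by (auto simp: doubleton_eq_iff)
      ultimately show False using dist jk by (metis n_def nth_eq_iff_index_eq)
    qed
  qed
  then show ?thesis using simple conn by (simp add: graph_tree_def)
qed

lemma graph_degree_insert:
  assumes "finite T" "e \<notin> T"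
  shows "graph_degree (insert e T) x = graph_degree T x + (if x \<in> e then 1 else 0)"
proof -
  have "{e' \<in> insert e T. x \<in> e'} = (if x \<in> e then insert e {e' \<in> T. x \<in> e'} else {e' \<in> T. x \<in> e'})" by auto
  then show ?thesis using assms by (simp add: graph_degree_def)
qed

lemma graph_tree_singleton: "graph_tree {a} T \<longleftrightarrow> T = {}"
proof
  assume "graph_tree {a} T"
  then have "T \<subseteq> vertex_pairs {a}" by (rule graph_tree_subset)
  moreover have "vertex_pairs {a} = {}" by (auto simp: vertex_pairs_def card_2_iff)
  ultimately show "T = {}" by simp
next
  assume "T = {}"
  then show "graph_tree {a} T"
    by (auto simp: graph_tree_def graph_connected_def graph_cycle_def simple_graphs_def intro!: exI[of _ 0])
qed

text \<open>Prescribed edges \<open>F\<close> serve the second moment: there \<open>F\<close> is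
  empty, a single edge, or two disjoint edges.\<close>

definition trees_with :: "'a set \<Rightarrow> ('a \<Rightarrow> nat) \<Rightarrow> 'a set set \<Rightarrow> 'a set set set" where
  "trees_with V \<delta> F = {T. graph_tree V T \<and> F \<subseteq> T \<and> (\<forall>v\<in>V. graph_degree T v = \<delta> v)}"

lemma finite_graph_trees: "finite V \<Longrightarrow> finite {T. graph_tree V T}"
  by (rule finite_subset[of _ "Pow (vertex_pairs V)"]) (auto dest: graph_tree_subset)

lemma finite_trees_with: "finite V \<Longrightarrow> finite (trees_with V \<delta> F)"
  by (rule finite_subset[OF _ finite_graph_trees]) (auto simp: trees_with_def)

text \<open>The trees are sorted by the neighbour \<open>u\<close> of the leaf \<open>l\<close>. An
  edge of \<open>F\<close> at \<open>l\<close> stays in \<open>F - {{l, u}}\<close> for every other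
  \<open>u\<close> and makes that summand 0, since trees on \<open>V - {l}\<close> have no edge at
  \<open>l\<close>.\<close>

lemma card_trees_with_leaf:
  assumes V: "finite V" and l: "l \<in> V" "\<delta> l = 1" and pos: "\<forall>v\<in>V. \<delta> v \<ge> 1"
  shows "card (trees_with V \<delta> F) =
    (\<Sum>u\<in>V - {l}. card (trees_with (V - {l}) (\<delta>(u := \<delta> u - 1)) (F - {{l, u}})))"
proof -
  define S where "S u = trees_with (V - {l}) (\<delta>(u := \<delta> u - 1)) (F - {{l, u}})" for u
  have notin: "l \<notin> e" if "T \<in> S u" "e \<in> T" for T u e
    using that graph_tree_subset[of "V - {l}" T] by (auto simp: S_def trees_with_def vertex_pairs_def)
  have finS: "finite (S u)" for u unfolding S_def using V by (intro finite_trees_with) auto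
  have eq: "trees_with V \<delta> F = (\<Union>u\<in>V - {l}. insert {l, u} ` S u)"
  proof (intro equalityI subsetI)
    fix T assume "T \<in> trees_with V \<delta> F"
    then have T: "graph_tree V T" "F \<subseteq> T" "\<And>v. v \<in> V \<Longrightarrow> graph_degree T v = \<delta> v" by (auto simp: trees_with_def)
    have "graph_degree T l = 1" using T(3) l by simp
    then obtain u where u: "u \<in> V" "u \<noteq> l" and leaf: "{e \<in> T. l \<in> e} = {{l, u}}"
      using leaf_edge[OF graph_tree_subset[OF T(1)]] by blast
    have tree: "graph_tree (V - {l}) (T - {{l, u}})" by (rule tree_remove_leaf[OF T(1) u leaf])
    have lu: "{l, u} \<in> T" using leaf by blast
    have Teq: "T = insert {l, u} (T - {{l, u}})" using lu by auto
    have finT: "finite (T - {{l, u}})" using graph_tree_finite[OF V T(1)] by simp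
    have "graph_degree T x = graph_degree (T - {{l, u}}) x + (if x \<in> {l, u} then 1 else 0)" for x
      by (subst Teq, rule graph_degree_insert[OF finT]) simp
    then have "graph_degree (T - {{l, u}}) x = (\<delta>(u := \<delta> u - 1)) x" if "x \<in> V - {l}" for x
      using that T(3)[of x] by (auto split: if_splits)
    then have "T - {{l, u}} \<in> S u" using tree T(2) by (auto simp: S_def trees_with_def)
    then show "T \<in> (\<Union>u\<in>V - {l}. insert {l, u} ` S u)" using u Teq by blast
  next
    fix T assume "T \<in> (\<Union>u\<in>V - {l}. insert {l, u} ` S u)"
    then obtain u T' where u: "u \<in> V - {l}" and T': "T' \<in> S u" and Teq: "T = insert {l, u} T'" by auto
    have tree': "graph_tree (V - {l}) T'" and F: "F - {{l, u}} \<subseteq> T'"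
      and deg: "\<And>v. v \<in> V - {l} \<Longrightarrow> graph_degree T' v = (\<delta>(u := \<delta> u - 1)) v"
      using T' by (auto simp: S_def trees_with_def)
    have "graph_tree V T" unfolding Teq by (rule tree_add_leaf[OF tree' u l(1)])
    moreover have "F \<subseteq> T" using F Teq by auto
    moreover have "graph_degree T x = \<delta> x" if "x \<in> V" for x
    proof -
      have fin: "finite T'" using graph_tree_finite[OF _ tree'] V by simp
      have "{e \<in> T'. l \<in> e} = {}" using notin[OF T'] by blast
      then have "graph_degree T' l = 0" unfolding graph_degree_def by (simp only: card.empty)
      moreover have "{l, u} \<notin> T'" using notin[OF T'] by blast
      ultimately show ?thesis using deg[of x] that l(2) pos u unfolding Teq graph_degree_insert[OF fin \<open>{l, u} \<notin> T'\<close>]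
        by (cases "x = l") (auto split: if_splits)
    qed
    ultimately show "T \<in> trees_with V \<delta> F" by (simp add: trees_with_def)
  qed
  have "card (trees_with V \<delta> F) = (\<Sum>u\<in>V - {l}. card (insert {l, u} ` S u))"
    unfolding eq
  proof (rule card_UN_disjoint)
    show "\<forall>u\<in>V - {l}. \<forall>w\<in>V - {l}. u \<noteq> w \<longrightarrow> insert {l, u} ` S u \<inter> insert {l, w} ` S w = {}"
    proof (intro ballI impI)
      fix u w assume uw: "u \<in> V - {l}" "w \<in> V - {l}" "u \<noteq> w"
      show "insert {l, u} ` S u \<inter> insert {l, w} ` S w = {}"
      proof (rule ccontr)
        assume "\<not> ?thesis"
        then obtain A B where AB: "A \<in> S u" "B \<in> S w" "insert {l, u} A = insert {l, w} B" by blast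
        then have "{l, u} \<in> insert {l, w} B" by blast
        then show False using notin[OF AB(2), of "{l, u}"] uw by (auto simp: doubleton_eq_iff)
      qed
    qed
  qed (use V finS in auto)
  also have "\<dots> = (\<Sum>u\<in>V - {l}. card (S u))"
  proof (intro sum.cong refl card_image inj_onI)
    fix u A B assume "A \<in> S u" "B \<in> S u" "insert {l, u} A = insert {l, u} B"
    moreover have "{l, u} \<notin> A" "{l, u} \<notin> B" using notin[OF \<open>A \<in> S u\<close>] notin[OF \<open>B \<in> S u\<close>] by blast+
    ultimately show "A = B" by (metis insert_ident)
  qed
  finally show ?thesis by (simp add: S_def)
qed

text \<open>Removing a leaf lowers both sides by 2. The form with \<open>+ 2\<close> avoids
  subtraction of natural numbers.\<close>

lemma sum_tree_degrees:
  assumes "finite V" "graph_tree V T"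
  shows "(\<Sum>v\<in>V. graph_degree T v) + 2 = 2 * card V"
  using assms
proof (induction "card V" arbitrary: V T rule: less_induct)
  case less
  have "V \<noteq> {}" using less.prems by (simp add: graph_tree_def graph_connected_def)
  then have "card V \<noteq> 0" using less.prems by simp
  show ?case
  proof (cases "card V = 1")
    case True
    then obtain a where "V = {a}" by (auto simp: card_1_singleton_iff)
    then show ?thesis using less.prems(2) by (simp add: graph_tree_singleton graph_degree_def)
  next
    case False
    then have c2: "card V \<ge> 2" using \<open>card V \<noteq> 0\<close> by simp
    obtain l where l: "l \<in> V" "graph_degree T l = 1" using tree_has_leaf[OF less.prems c2] by blast
    obtain u where u: "u \<in> V" "u \<noteq> l" and leaf: "{e \<in> T. l \<in> e} = {{l, u}}"
      using leaf_edge[OF graph_tree_subset[OF less.prems(2)] l(2)] by blast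
    let ?T = "T - {{l, u}}"
    have tree: "graph_tree (V - {l}) ?T" by (rule tree_remove_leaf[OF less.prems(2) u leaf])
    have lu: "{l, u} \<in> T" using leaf by blast
    have Teq: "T = insert {l, u} ?T" using lu by auto
    have finT: "finite ?T" using graph_tree_finite[OF less.prems] by simp
    have deg: "graph_degree T x = graph_degree ?T x + (if x \<in> {l, u} then 1 else 0)" for x
      by (subst Teq, rule graph_degree_insert[OF finT]) simp
    have IH: "(\<Sum>v\<in>V - {l}. graph_degree ?T v) + 2 = 2 * card (V - {l})"
      using less.hyps[OF _ _ tree] less.prems l c2 by simp
    have "(\<Sum>v\<in>V. graph_degree T v) = graph_degree T l + (\<Sum>v\<in>V - {l}. graph_degree T v)"
      using less.prems l by (simp add: sum.remove)
    also have "(\<Sum>v\<in>V - {l}. graph_degree T v) = (\<Sum>v\<in>V - {l}. graph_degree ?T v + (if v = u then 1 else 0))"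
      by (intro sum.cong) (auto simp: deg)
    also have "\<dots> = (\<Sum>v\<in>V - {l}. graph_degree ?T v) + 1"
      using less.prems u by (simp add: sum.distrib)
    finally show ?thesis using IH l c2 less.prems by simp
  qed
qed

lemma trees_with_empty:
  assumes "finite V" "card V \<ge> 2" "v \<in> V" "\<delta> v = 0"
  shows "trees_with V \<delta> F = {}"
  using tree_degree_pos[OF assms(1) _ assms(2,3)] assms(3,4) by (fastforce simp: trees_with_def)

lemma trees_with_no_edge:
  assumes "f \<in> F" "\<not> f \<subseteq> V"
  shows "trees_with V \<delta> F = {}"
proof -
  have "f \<notin> T" if "graph_tree V T" for T
    using graph_tree_subset[OF that] assms(2) by (auto simp: vertex_pairs_def)
  then show ?thesis using assms(1) by (auto simp: trees_with_def)
qed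

lemma card_trees_with_two:
  assumes V: "finite V" "card V = 2" and F: "F \<subseteq> vertex_pairs V" and d: "\<forall>v\<in>V. \<delta> v = 1"
  shows "card (trees_with V \<delta> F) = 1"
proof -
  obtain l u where lu: "V = {l, u}" "l \<noteq> u" using V by (auto simp: card_2_iff)
  have "vertex_pairs V \<subseteq> {{l, u}}"
    using lu by (auto elim!: vertex_pairsE)
  then have F0: "F - {{l, u}} = {}" using F by auto
  have "V - {l} = {u}" using lu by auto
  then have "card (trees_with V \<delta> F) = card (trees_with {u} (\<delta>(u := \<delta> u - 1)) {})"
    using card_trees_with_leaf[OF V(1), of l \<delta> F] lu d F0 by simp
  also have "trees_with {u} (\<delta>(u := \<delta> u - 1)) {} = {{}}"
    using d lu by (auto simp: trees_with_def graph_tree_singleton graph_degree_def)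
  finally show ?thesis by simp
qed

text \<open>By disjointness \<open>u\<close> lowers at most one factor. For fixed \<open>f\<close>,
  the loss summed over \<open>u \<in> f\<close> is the factor of \<open>f\<close> times all the
  others, so each member of \<open>F\<close> costs one full product.\<close>

lemma sum_weighted_prod_decrement:
  fixes e :: "'a \<Rightarrow> real"
  assumes U: "finite U" and F: "finite F" and sub: "\<forall>f\<in>F. f \<subseteq> U" and disj: "pairwise disjnt F"
  shows "(\<Sum>u\<in>U. e u * (\<Prod>f\<in>F. (\<Sum>v\<in>f. e v) - (if u \<in> f then 1 else 0))) =
    ((\<Sum>u\<in>U. e u) - real (card F)) * (\<Prod>f\<in>F. \<Sum>v\<in>f. e v)"
proof -
  define s where "s f = (\<Sum>v\<in>f. e v)" for f
  have expand: "(\<Prod>f\<in>F. s f - (if u \<in> f then 1 else 0)) =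
     (\<Prod>f\<in>F. s f) - (\<Sum>f\<in>F. if u \<in> f then \<Prod>g\<in>F - {f}. s g else 0)" for u
  proof (cases "\<exists>f\<in>F. u \<in> f")
    case False
    then have "(\<Prod>f\<in>F. s f - (if u \<in> f then 1 else 0)) = (\<Prod>f\<in>F. s f)" by (intro prod.cong) auto
    moreover have "(\<Sum>f\<in>F. if u \<in> f then \<Prod>g\<in>F - {f}. s g else 0) = 0" using False by (intro sum.neutral) auto
    ultimately show ?thesis by simp
  next
    case True
    then obtain f where f: "f \<in> F" "u \<in> f" by auto
    have other: "u \<notin> g" if "g \<in> F - {f}" for g
      using that f disj by (auto simp: pairwise_def disjnt_def)
    have "(\<Prod>f\<in>F. s f - (if u \<in> f then 1 else 0)) = (s f - 1) * (\<Prod>g\<in>F - {f}. s g - (if u \<in> g then 1 else 0))"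
      using F f by (simp add: prod.remove)
    also have "(\<Prod>g\<in>F - {f}. s g - (if u \<in> g then 1 else 0)) = (\<Prod>g\<in>F - {f}. s g)"
      using other by (intro prod.cong) auto
    moreover have "(\<Sum>f\<in>F. if u \<in> f then \<Prod>g\<in>F - {f}. s g else 0) = (\<Prod>g\<in>F - {f}. s g)"
    proof -
      have "(\<Sum>f\<in>F. if u \<in> f then \<Prod>g\<in>F - {f}. s g else 0) = (\<Sum>f\<in>{f}. if u \<in> f then \<Prod>g\<in>F - {f}. s g else 0)"
        using F f other by (intro sum.mono_neutral_right) auto
      then show ?thesis using f by simp
    qed
    moreover have "(\<Prod>f\<in>F. s f) = s f * (\<Prod>g\<in>F - {f}. s g)" using F f by (simp add: prod.remove)
    ultimately show ?thesis by (simp add: algebra_simps)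
  qed
  have "(\<Sum>u\<in>U. e u * (\<Prod>f\<in>F. s f - (if u \<in> f then 1 else 0))) =
     (\<Sum>u\<in>U. e u) * (\<Prod>f\<in>F. s f) - (\<Sum>u\<in>U. \<Sum>f\<in>F. e u * (if u \<in> f then \<Prod>g\<in>F - {f}. s g else 0))"
    unfolding expand by (simp add: algebra_simps sum_subtractf sum_distrib_left sum_distrib_right)
  also have "(\<Sum>u\<in>U. \<Sum>f\<in>F. e u * (if u \<in> f then \<Prod>g\<in>F - {f}. s g else 0)) =
     (\<Sum>f\<in>F. \<Sum>u\<in>U. if u \<in> f then e u * (\<Prod>g\<in>F - {f}. s g) else 0)"
    by (subst sum.swap) (intro sum.cong, auto)
  also have "\<dots> = (\<Sum>f\<in>F. \<Prod>f\<in>F. s f)"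
  proof (rule sum.cong[OF refl])
    fix f assume f: "f \<in> F"
    have "U \<inter> f = f" using f sub by auto
    then have "(\<Sum>u\<in>U. if u \<in> f then e u * (\<Prod>g\<in>F - {f}. s g) else 0) = (\<Sum>u\<in>f. e u * (\<Prod>g\<in>F - {f}. s g))"
      using U by (subst sum.inter_restrict[symmetric]) auto
    also have "\<dots> = s f * (\<Prod>g\<in>F - {f}. s g)" by (simp add: s_def sum_distrib_right)
    also have "\<dots> = (\<Prod>f\<in>F. s f)" using F f by (simp add: prod.remove)
    finally show "(\<Sum>u\<in>U. if u \<in> f then e u * (\<Prod>g\<in>F - {f}. s g) else 0) = (\<Prod>f\<in>F. s f)" .
  qed
  finally show ?thesis by (simp add: s_def algebra_simps)
qed

lemma prod_fact_decrement:
  assumes "finite U" "u \<in> U" "\<delta> u \<ge> 2"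
  shows "(\<Prod>v\<in>U. fact (\<delta> v - 1) :: real) = (real (\<delta> u) - 1) * (\<Prod>v\<in>U. fact ((\<delta>(u := \<delta> u - 1)) v - 1))"
proof -
  obtain k where k: "\<delta> u = Suc (Suc k)" using assms(3) by (metis add_2_eq_Suc le_Suc_ex)
  have "(\<Prod>v\<in>U - {u}. fact ((\<delta>(u := \<delta> u - 1)) v - 1) :: real) = (\<Prod>v\<in>U - {u}. fact (\<delta> v - 1))"
    by (intro prod.cong) auto
  then show ?thesis using assms(1,2) k by (simp add: prod.remove)
qed

text \<open>A degree sequence of a tree has a leaf \<open>l\<close>. Removing it either forces the edge of \<open>F\<close> at \<open>l\<close>, or
  leaves a choice of its neighbour \<open>u\<close>, which lowers \<open>\<delta> u - 1\<close> and the factor of the edge of \<open>F\<close>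
  through \<open>u\<close> by one.\<close>

lemma card_trees_with:
  assumes "finite V" "card F + 2 \<le> card V" "F \<subseteq> vertex_pairs V" "pairwise disjnt F"
    "\<forall>v\<in>V. \<delta> v \<ge> 1" "(\<Sum>v\<in>V. \<delta> v) + 2 = 2 * card V"
  shows "real (card (trees_with V \<delta> F)) =
    fact (card V - 2 - card F) * (\<Prod>f\<in>F. \<Sum>v\<in>f. real (\<delta> v) - 1) / (\<Prod>v\<in>V. fact (\<delta> v - 1))"
  using assms
proof (induction "card V" arbitrary: V F \<delta> rule: less_induct)
  case less
  note V = less.prems(1) and cF = less.prems(2) and F = less.prems(3) and disj = less.prems(4)
    and pos = less.prems(5) and tot = less.prems(6)
  have finF: "finite F" using F V finite_subset finite_vertex_pairs by blast
  show ?case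
  proof (cases "card V = 2")
    case True
    then have F0: "F = {}" using cF finF by simp
    obtain a b where ab: "V = {a, b}" "a \<noteq> b" using True by (auto simp: card_2_iff)
    then have "\<delta> a + \<delta> b = 2" "\<delta> a \<ge> 1" "\<delta> b \<ge> 1" using tot pos by auto
    then have d1: "\<delta> a = 1" "\<delta> b = 1" by auto
    have "card (trees_with V \<delta> F) = 1"
      by (rule card_trees_with_two[OF V True F]) (use ab d1 in auto)
    then show ?thesis using F0 True ab d1 by simp
  next
    case False
    then have n3: "card V \<ge> 3" using cF by simp
    obtain l where l: "l \<in> V" "\<delta> l = 1"
    proof -
      have "\<exists>l\<in>V. \<delta> l < 2"
      proof (rule ccontr)
        assume "\<not> ?thesis"
        then have "(\<Sum>v\<in>V. 2) \<le> (\<Sum>v\<in>V. \<delta> v)" by (intro sum_mono) auto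
        then show False using tot by simp
      qed
      then obtain l where "l \<in> V" "\<delta> l < 2" by auto
      moreover have "\<delta> l \<ge> 1" using pos calculation by auto
      ultimately show ?thesis using that[of l] by auto
    qed
    let ?U = "V - {l}"
    have U: "finite ?U" "card ?U = card V - 1" using V l by auto
    define P where "P = (\<Prod>v\<in>?U. fact (\<delta> v - 1) :: real)"
    have Ppos: "P > 0" unfolding P_def by (intro prod_pos) auto
    have PV: "(\<Prod>v\<in>V. fact (\<delta> v - 1) :: real) = P" unfolding P_def using V l by (simp add: prod.remove)
    have totU: "(\<Sum>v\<in>?U. \<delta> v) + 3 = 2 * card V" using tot V l by (simp add: sum.remove)
    have tot': "(\<Sum>v\<in>?U. (\<delta>(u := \<delta> u - 1)) v) + 2 = 2 * card ?U" if "u \<in> ?U" for u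
    proof -
      have "(\<Sum>v\<in>?U - {u}. (\<delta>(u := \<delta> u - 1)) v) = (\<Sum>v\<in>?U - {u}. \<delta> v)" by (intro sum.cong) auto
      moreover have "\<delta> u \<ge> 1" using pos that by auto
      moreover have "(\<Sum>v\<in>?U. \<delta> v) = \<delta> u + (\<Sum>v\<in>?U - {u}. \<delta> v)"
        "(\<Sum>v\<in>?U. (\<delta>(u := \<delta> u - 1)) v) = (\<delta> u - 1) + (\<Sum>v\<in>?U - {u}. (\<delta>(u := \<delta> u - 1)) v)"
        using U that by (simp_all add: sum.remove)
      ultimately show ?thesis using totU U n3 by linarith
    qed
    note rec = card_trees_with_leaf[OF V l pos, of F]
    have zero: "trees_with ?U (\<delta>(u := \<delta> u - 1)) G = {}" if "u \<in> ?U" "\<delta> u = 1" for u G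
      using U n3 that by (intro trees_with_empty[of _ u]) auto
    have pos': "\<forall>v\<in>?U. (\<delta>(u := \<delta> u - 1)) v \<ge> 1" if "\<delta> u \<ge> 2" for u using that pos by auto
    show ?thesis
    proof (cases "\<exists>f\<in>F. l \<in> f")
      case True
      then obtain f where f: "f \<in> F" "l \<in> f" by auto
      obtain a b where ab: "f = {a, b}" "a \<noteq> b" "a \<in> V" "b \<in> V" using f F by (meson subsetD vertex_pairsE)
      define w where "w = (if a = l then b else a)"
      have w: "f = {l, w}" "w \<in> V" "w \<noteq> l" using ab f(2) by (auto simp: w_def)
      have wnot: "w \<notin> g" "l \<notin> g" if "g \<in> F - {f}" for g
      proof -
        have "disjnt g f" using that f disj by (auto simp: pairwise_def)
        then show "w \<notin> g" "l \<notin> g" using w by (auto simp: disjnt_def)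
      qed
      \<comment> \<open>The edge of \<open>F\<close> at the leaf dictates its neighbour
        \<open>w\<close>.\<close>
      have "trees_with ?U (\<delta>(u := \<delta> u - 1)) (F - {{l, u}}) = {}" if "u \<in> ?U - {w}" for u
      proof (rule trees_with_no_edge[of f])
        show "f \<in> F - {{l, u}}" using f w that by (auto simp: doubleton_eq_iff)
        show "\<not> f \<subseteq> ?U" using f by auto
      qed
      then have c: "card (trees_with V \<delta> F) = card (trees_with ?U (\<delta>(w := \<delta> w - 1)) (F - {f}))"
        unfolding rec using U w by (subst sum.remove[of _ w]) auto
      have sf: "(\<Sum>v\<in>f. real (\<delta> v) - 1) = real (\<delta> w) - 1" using w l by simp
      have prodF: "(\<Prod>f\<in>F. \<Sum>v\<in>f. real (\<delta> v) - 1) = (real (\<delta> w) - 1) * (\<Prod>f\<in>F - {f}. \<Sum>v\<in>f. real (\<delta> v) - 1)"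
        using finF f sf by (simp add: prod.remove)
      show ?thesis
      proof (cases "\<delta> w = 1")
        case True
        then show ?thesis unfolding c prodF using zero[of w] w by simp
      next
        case False
        then have dw: "\<delta> w \<ge> 2" using pos w by (metis One_nat_def Suc_1 Suc_leI le_neq_implies_less)
        have cF': "card (F - {f}) = card F - 1" "card F \<ge> 1" using finF f by (auto simp: card_gt_0_iff Suc_le_eq)
        have prodF': "(\<Prod>f\<in>F - {f}. \<Sum>v\<in>f. real ((\<delta>(w := \<delta> w - 1)) v) - 1) = (\<Prod>f\<in>F - {f}. \<Sum>v\<in>f. real (\<delta> v) - 1)"
          using wnot by (intro prod.cong sum.cong refl) auto
        have "real (card (trees_with ?U (\<delta>(w := \<delta> w - 1)) (F - {f}))) =
           fact (card ?U - 2 - card (F - {f})) * (\<Prod>f\<in>F - {f}. \<Sum>v\<in>f. real ((\<delta>(w := \<delta> w - 1)) v) - 1) /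
           (\<Prod>v\<in>?U. fact ((\<delta>(w := \<delta> w - 1)) v - 1))"
        proof (rule less.hyps)
          show "card ?U < card V" using U n3 by simp
          show "card (F - {f}) + 2 \<le> card ?U" using U cF cF' by simp
          show "F - {f} \<subseteq> vertex_pairs ?U" using F wnot by (auto simp: vertex_pairs_def)
          show "pairwise disjnt (F - {f})" using disj by (rule pairwise_subset) auto
          show "\<forall>v\<in>?U. (\<delta>(w := \<delta> w - 1)) v \<ge> 1" by (rule pos'[OF dw])
          show "(\<Sum>v\<in>?U. (\<delta>(w := \<delta> w - 1)) v) + 2 = 2 * card ?U" using w by (intro tot') auto
        qed (use U in auto)
        moreover have "card ?U - 2 - card (F - {f}) = card V - 2 - card F" using U cF' by simp
        moreover have "P = (real (\<delta> w) - 1) * (\<Prod>v\<in>?U. fact ((\<delta>(w := \<delta> w - 1)) v - 1))"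
          unfolding P_def by (rule prod_fact_decrement) (use U w dw in auto)
        moreover have "real (\<delta> w) - 1 \<noteq> 0" using dw by auto
        ultimately show ?thesis unfolding c prodF PV prodF' by simp
      qed
    next
      case noleaf: False
      have FU: "\<forall>f\<in>F. f \<subseteq> ?U" using F noleaf by (auto simp: vertex_pairs_def)
      have Fne: "F - {{l, u}} = F" for u using noleaf by auto
      have FpU: "F \<subseteq> vertex_pairs ?U" using F FU by (auto simp: vertex_pairs_def)
      show ?thesis
      \<comment> \<open>The induction hypothesis asks for two more vertices than prescribed edges.
        As the edges of \<open>F\<close> are disjoint and avoid \<open>l\<close>, this fails only
        for \<open>card V = 3\<close> and \<open>card F = 1\<close>, which is computed
        directly.\<close>
      proof (cases "card F + 2 \<le> card ?U")
        case True
        have summand: "real (card (trees_with ?U (\<delta>(u := \<delta> u - 1)) F)) =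
           fact (card V - 3 - card F) / P * ((real (\<delta> u) - 1) * (\<Prod>f\<in>F. (\<Sum>v\<in>f. real (\<delta> v) - 1) - (if u \<in> f then 1 else 0)))"
          if u: "u \<in> ?U" for u
        \<comment> \<open>For \<open>\<delta> u = 1\<close> both sides vanish: the neighbour would
          be left isolated, and the factor \<open>\<delta> u - 1\<close> is 0.\<close>
        proof (cases "\<delta> u = 1")
          case True
          then show ?thesis using zero[OF u] by simp
        next
          case False
          then have du: "\<delta> u \<ge> 2" using pos u by (metis DiffD1 One_nat_def Suc_1 Suc_leI le_neq_implies_less)
          have "real (card (trees_with ?U (\<delta>(u := \<delta> u - 1)) F)) =
             fact (card ?U - 2 - card F) * (\<Prod>f\<in>F. \<Sum>v\<in>f. real ((\<delta>(u := \<delta> u - 1)) v) - 1) /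
             (\<Prod>v\<in>?U. fact ((\<delta>(u := \<delta> u - 1)) v - 1))"
            using U n3 True FpU disj pos'[OF du] tot'[OF u] by (intro less.hyps) auto
          moreover have "card ?U - 2 - card F = card V - 3 - card F" using U by simp
          moreover have "P = (real (\<delta> u) - 1) * (\<Prod>v\<in>?U. fact ((\<delta>(u := \<delta> u - 1)) v - 1))"
            unfolding P_def by (rule prod_fact_decrement) (use U u du in auto)
          moreover have "real (\<delta> u) - 1 \<noteq> 0" using du by auto
          moreover have "(\<Prod>f\<in>F. \<Sum>v\<in>f. real ((\<delta>(u := \<delta> u - 1)) v) - 1) =
             (\<Prod>f\<in>F. (\<Sum>v\<in>f. real (\<delta> v) - 1) - (if u \<in> f then 1 else 0))"
          proof (rule prod.cong[OF refl])
            fix f assume "f \<in> F"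
            then have ff: "finite f" using FU U(1) finite_subset by blast
            have "(\<Sum>v\<in>f. real ((\<delta>(u := \<delta> u - 1)) v) - 1) = (\<Sum>v\<in>f. (real (\<delta> v) - 1) - (if v = u then 1 else 0))"
              using du by (intro sum.cong) (auto simp: of_nat_diff)
            then show "(\<Sum>v\<in>f. real ((\<delta>(u := \<delta> u - 1)) v) - 1) = (\<Sum>v\<in>f. real (\<delta> v) - 1) - (if u \<in> f then 1 else 0)"
              using ff by (simp add: sum_subtractf)
          qed
          ultimately show ?thesis by simp
        qed
        have "real (card (trees_with V \<delta> F)) = (\<Sum>u\<in>?U. real (card (trees_with ?U (\<delta>(u := \<delta> u - 1)) F)))"
          unfolding rec Fne by simp
        also have "\<dots> = fact (card V - 3 - card F) / P *
           (\<Sum>u\<in>?U. (real (\<delta> u) - 1) * (\<Prod>f\<in>F. (\<Sum>v\<in>f. real (\<delta> v) - 1) - (if u \<in> f then 1 else 0)))"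
          unfolding sum_distrib_left by (intro sum.cong refl summand)
        also have "\<dots> = fact (card V - 3 - card F) / P *
           (((\<Sum>u\<in>?U. real (\<delta> u) - 1) - real (card F)) * (\<Prod>f\<in>F. \<Sum>v\<in>f. real (\<delta> v) - 1))"
          by (subst sum_weighted_prod_decrement[OF U(1) finF FU disj]) simp
        \<comment> \<open>The degrees on \<open>?U\<close> add up to \<open>2 * card V - 3\<close>
          over \<open>card V - 1\<close> vertices. The result is the factor by which the factorial
          grows.\<close>
        also have "(\<Sum>u\<in>?U. real (\<delta> u) - 1) - real (card F) = real (card V - 2 - card F)"
        proof -
          have "real ((\<Sum>v\<in>?U. \<delta> v) + 3) = real (2 * card V)" unfolding totU ..
          then show ?thesis using U True by (simp add: sum_subtractf of_nat_diff)
        qed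
        also have "fact (card V - 3 - card F) / P * (real (card V - 2 - card F) * (\<Prod>f\<in>F. \<Sum>v\<in>f. real (\<delta> v) - 1)) =
          fact (card V - 2 - card F) * (\<Prod>f\<in>F. \<Sum>v\<in>f. real (\<delta> v) - 1) / P"
        proof -
          have "card V - 2 - card F = Suc (card V - 3 - card F)" using True U by linarith
          then show ?thesis by simp
        qed
        finally show ?thesis unfolding PV .
      next
        case False
        have "2 * card F \<le> card ?U"
        proof -
          have "card (\<Union>F) = (\<Sum>f\<in>F. card f)"
            using disj FU U(1) finite_subset by (intro card_Union_disjoint) blast+
          also have "\<dots> = (\<Sum>f\<in>F. 2)" using F by (intro sum.cong) (auto simp: vertex_pairs_def)
          finally have "card (\<Union>F) = 2 * card F" by simp
          moreover have "\<Union>F \<subseteq> ?U" using FU by blast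
          ultimately show ?thesis using card_mono[OF U(1), of "\<Union>F"] by simp
        qed
        then have n3': "card V = 3" "card F = 1" using False cF U n3 by linarith+
        then obtain f where Ff: "F = {f}" by (auto simp: card_1_singleton_iff)
        then have "f \<in> vertex_pairs ?U" using FpU by simp
        then obtain a b where ab: "f = {a, b}" "a \<noteq> b" "a \<in> ?U" "b \<in> ?U" by (rule vertex_pairsE)
        have Uab: "?U = {a, b}" using ab U n3' by (intro card_seteq[symmetric]) auto
        have s3: "\<delta> a + \<delta> b = 3" "\<delta> a \<ge> 1" "\<delta> b \<ge> 1" using totU n3' pos ab Uab by auto
        have one: "card (trees_with ?U (\<delta>(u := \<delta> u - 1)) F) = 1" if "u \<in> ?U" "\<delta> u = 2" for u
          using U n3' FpU s3 ab Uab that by (intro card_trees_with_two) auto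
        have "card (trees_with V \<delta> F) = card (trees_with ?U (\<delta>(a := \<delta> a - 1)) F) + card (trees_with ?U (\<delta>(b := \<delta> b - 1)) F)"
          unfolding rec Fne using Uab ab by simp
        moreover have "(\<delta> a = 2 \<and> \<delta> b = 1) \<or> (\<delta> a = 1 \<and> \<delta> b = 2)" using s3 by auto
        ultimately have "card (trees_with V \<delta> F) = 1"
          using one[of a] one[of b] zero[of a F] zero[of b F] ab by auto
        moreover have "(\<Prod>f\<in>F. \<Sum>v\<in>f. real (\<delta> v) - 1) = 1" using s3 ab Ff by simp
        moreover have "P = 1" unfolding P_def Uab using s3 ab \<open>(\<delta> a = 2 \<and> \<delta> b = 1) \<or> (\<delta> a = 1 \<and> \<delta> b = 2)\<close> by auto
        ultimately show ?thesis unfolding PV using n3' by simp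
      qed
    qed
  qed
qed

section \<open>Edge sums over the trees with given degrees\<close>

lemma sum_trees_edges:
  fixes a :: "'a set \<Rightarrow> real"
  assumes V: "finite V"
  shows "(\<Sum>T\<in>trees_with V \<delta> {}. \<Sum>f\<in>T. a f) = (\<Sum>f\<in>vertex_pairs V. a f * real (card (trees_with V \<delta> {f})))"
proof -
  let ?S = "trees_with V \<delta> {}"
  have "(\<Sum>T\<in>?S. \<Sum>f\<in>T. a f) = (\<Sum>T\<in>?S. \<Sum>f\<in>vertex_pairs V. if f \<in> T then a f else 0)"
  proof (rule sum.cong[OF refl])
    fix T assume "T \<in> ?S"
    then have "vertex_pairs V \<inter> T = T" using graph_tree_subset[of V T] by (auto simp: trees_with_def)
    then show "(\<Sum>f\<in>T. a f) = (\<Sum>f\<in>vertex_pairs V. if f \<in> T then a f else 0)"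
      using V by (subst sum.inter_restrict[symmetric]) auto
  qed
  also have "\<dots> = (\<Sum>f\<in>vertex_pairs V. \<Sum>T\<in>?S. if f \<in> T then a f else 0)" by (rule sum.swap)
  also have "\<dots> = (\<Sum>f\<in>vertex_pairs V. a f * real (card (trees_with V \<delta> {f})))"
  proof (rule sum.cong[OF refl])
    fix f
    have "{T \<in> ?S. f \<in> T} = trees_with V \<delta> {f}" by (auto simp: trees_with_def)
    then show "(\<Sum>T\<in>?S. if f \<in> T then a f else 0) = a f * real (card (trees_with V \<delta> {f}))"
      using finite_trees_with[OF V, of \<delta> "{}"] by (simp add: sum.inter_filter[symmetric] mult.commute)
  qed
  finally show ?thesis .
qed

lemma sum_trees_edge_pairs:
  fixes a :: "'a set \<Rightarrow> real"
  assumes V: "finite V"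
  shows "(\<Sum>T\<in>trees_with V \<delta> {}. \<Sum>f\<in>T. \<Sum>g\<in>{g\<in>T. disjnt f g}. a f * a g) =
    (\<Sum>f\<in>vertex_pairs V. \<Sum>g\<in>{g\<in>vertex_pairs V. disjnt f g}. a f * a g * real (card (trees_with V \<delta> {f, g})))"
proof -
  let ?S = "trees_with V \<delta> {}" and ?P = "vertex_pairs V"
  have "(\<Sum>T\<in>?S. \<Sum>f\<in>T. \<Sum>g\<in>{g\<in>T. disjnt f g}. a f * a g) =
     (\<Sum>T\<in>?S. \<Sum>f\<in>?P. \<Sum>g\<in>{g\<in>?P. disjnt f g}. if f \<in> T \<and> g \<in> T then a f * a g else 0)"
  proof (rule sum.cong[OF refl])
    fix T assume "T \<in> ?S"
    then have T: "T \<subseteq> ?P" using graph_tree_subset[of V T] by (auto simp: trees_with_def)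
    show "(\<Sum>f\<in>T. \<Sum>g\<in>{g\<in>T. disjnt f g}. a f * a g) =
      (\<Sum>f\<in>?P. \<Sum>g\<in>{g\<in>?P. disjnt f g}. if f \<in> T \<and> g \<in> T then a f * a g else 0)"
    proof (rule sum.mono_neutral_cong_left)
      fix f assume "f \<in> T"
      then show "(\<Sum>g\<in>{g\<in>T. disjnt f g}. a f * a g) =
         (\<Sum>g\<in>{g\<in>?P. disjnt f g}. if f \<in> T \<and> g \<in> T then a f * a g else 0)"
        using T V by (intro sum.mono_neutral_cong_left) auto
    qed (use T V in auto)
  qed
  also have "\<dots> = (\<Sum>f\<in>?P. \<Sum>T\<in>?S. \<Sum>g\<in>{g\<in>?P. disjnt f g}. if f \<in> T \<and> g \<in> T then a f * a g else 0)"
    by (rule sum.swap)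
  also have "\<dots> = (\<Sum>f\<in>?P. \<Sum>g\<in>{g\<in>?P. disjnt f g}. \<Sum>T\<in>?S. if f \<in> T \<and> g \<in> T then a f * a g else 0)"
    by (intro sum.cong refl) (rule sum.swap)
  also have "\<dots> = (\<Sum>f\<in>?P. \<Sum>g\<in>{g\<in>?P. disjnt f g}. a f * a g * real (card (trees_with V \<delta> {f, g})))"
  proof (rule sum.cong[OF refl], rule sum.cong[OF refl])
    fix f g
    have "{T \<in> ?S. f \<in> T \<and> g \<in> T} = trees_with V \<delta> {f, g}" by (auto simp: trees_with_def)
    then show "(\<Sum>T\<in>?S. if f \<in> T \<and> g \<in> T then a f * a g else 0) = a f * a g * real (card (trees_with V \<delta> {f, g}))"
      using finite_trees_with[OF V, of \<delta> "{}"] by (simp add: sum.inter_filter[symmetric] mult.commute)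
  qed
  finally show ?thesis .
qed

text \<open>The edges meeting \<open>f\<close>, with \<open>f\<close> among them, are at most as
  many as the degrees at its ends add up to. Summing over \<open>f\<close> gives the sum of the
  squared degrees.\<close>

lemma intersecting_edge_pairs_bound:
  fixes a :: "'a set \<Rightarrow> real"
  assumes V: "finite V" and T: "T \<subseteq> vertex_pairs V" and deg: "\<forall>v\<in>V. graph_degree T v \<le> d"
    and a: "\<forall>f\<in>T. 0 \<le> a f \<and> a f \<le> b"
  shows "(\<Sum>f\<in>T. \<Sum>g\<in>{g\<in>T. \<not> disjnt f g}. a f * a g) \<le> b\<^sup>2 * (real (card V) * real d ^ 2)"
proof -
  have fT: "finite T" using T V finite_subset finite_vertex_pairs by blast
  have "(\<Sum>f\<in>T. \<Sum>g\<in>{g\<in>T. \<not> disjnt f g}. a f * a g) \<le> (\<Sum>f\<in>T. b\<^sup>2 * (\<Sum>v\<in>f. real (graph_degree T v)))"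
  proof (rule sum_mono)
    fix f assume f: "f \<in> T"
    then have b0: "0 \<le> b" using a by force
    have "f \<subseteq> V" using f T by (auto simp: vertex_pairs_def)
    then have ff: "finite f" using V finite_subset by blast
    have "(\<Sum>g\<in>{g\<in>T. \<not> disjnt f g}. a f * a g) \<le> (\<Sum>g\<in>{g\<in>T. \<not> disjnt f g}. b * b)"
      using a f b0 by (intro sum_mono mult_mono) auto
    also have "\<dots> = b\<^sup>2 * real (card {g\<in>T. \<not> disjnt f g})" by (simp add: power2_eq_square)
    also have "\<dots> \<le> b\<^sup>2 * (\<Sum>v\<in>f. real (graph_degree T v))"
    proof (rule mult_left_mono)
      have "card {g\<in>T. \<not> disjnt f g} \<le> card (\<Union>v\<in>f. {g\<in>T. v \<in> g})"
        using fT ff by (intro card_mono) (auto simp: disjnt_def)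
      also have "\<dots> \<le> (\<Sum>v\<in>f. card {g\<in>T. v \<in> g})" by (rule card_UN_le[OF ff])
      finally have "real (card {g\<in>T. \<not> disjnt f g}) \<le> real (\<Sum>v\<in>f. card {g\<in>T. v \<in> g})" by linarith
      then show "real (card {g\<in>T. \<not> disjnt f g}) \<le> (\<Sum>v\<in>f. real (graph_degree T v))"
        by (simp add: graph_degree_def)
    qed simp
    finally show "(\<Sum>g\<in>{g\<in>T. \<not> disjnt f g}. a f * a g) \<le> b\<^sup>2 * (\<Sum>v\<in>f. real (graph_degree T v))" .
  qed
  also have "\<dots> = b\<^sup>2 * (\<Sum>v\<in>V. real (graph_degree T v) * real (graph_degree T v))"
    unfolding sum_distrib_left[symmetric] sum_edges_vertices[OF V T] ..
  also have "\<dots> \<le> b\<^sup>2 * (\<Sum>v\<in>V. real d * real d)"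
    using deg by (intro mult_left_mono sum_mono mult_mono) auto
  finally show ?thesis by (simp add: power2_eq_square)
qed

text \<open>With \<open>s f = \<delta> u + \<delta> v - 2\<close> for \<open>f = {u, v}\<close> and
  \<open>m\<close> vertices, \<open>card_trees_with\<close> says that a random tree contains
  \<open>f\<close> with probability \<open>s f / (m - 2)\<close>, and two disjoint edges with
  probability \<open>s f * s g / ((m - 2) * (m - 3))\<close>. So \<open>K\<close> is the mean,
  disjoint pairs contribute at most \<open>K\<^sup>2 * (m - 2) / (m - 3)\<close>, and for
  intersecting pairs a crude bound suffices.\<close>

lemma tree_edge_sum_variance:
  fixes a :: "'a set \<Rightarrow> real" and \<delta> :: "'a \<Rightarrow> nat"
  assumes V: "finite V" and n: "card V \<ge> 4" and \<delta>: "\<forall>v\<in>V. 1 \<le> \<delta> v \<and> \<delta> v \<le> d"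
    and tot: "(\<Sum>v\<in>V. \<delta> v) + 2 = 2 * card V"
    and a: "\<forall>f\<in>vertex_pairs V. 0 \<le> a f \<and> a f \<le> b"
    and K: "K = (\<Sum>f\<in>vertex_pairs V. a f * (\<Sum>v\<in>f. real (\<delta> v) - 1)) / (real (card V) - 2)"
  shows "(\<Sum>T\<in>trees_with V \<delta> {}. ((\<Sum>f\<in>T. a f) - K)\<^sup>2) \<le>
    real (card (trees_with V \<delta> {})) * (K\<^sup>2 / (real (card V) - 3) + b\<^sup>2 * (real (card V) * real d ^ 2))"
proof -
  let ?S = "trees_with V \<delta> {}" and ?P = "vertex_pairs V"
  define t where "t = real (card ?S)"
  define m where "m = real (card V)"
  define s where "s f = (\<Sum>v\<in>f. real (\<delta> v) - 1)" for f
  have m: "m \<ge> 4" using n by (simp add: m_def)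
  have pos: "\<forall>v\<in>V. \<delta> v \<ge> 1" using \<delta> by auto
  define Q where "Q = (\<Prod>v\<in>V. fact (\<delta> v - 1) :: real)"
  have Q: "Q > 0" unfolding Q_def by (intro prod_pos) auto
  have t: "t = fact (card V - 2) / Q"
    unfolding t_def Q_def using card_trees_with[OF V, of "{}" \<delta>] n pos tot by simp
  have s0: "s f \<ge> 0" if "f \<in> ?P" for f
    unfolding s_def using that pos by (intro sum_nonneg) (auto simp: vertex_pairs_def)
  obtain k where k: "card V = k + 4" using n by (metis add.commute le_Suc_ex)
  have c1: "real (card (trees_with V \<delta> {f})) = t * s f / (m - 2)" if "f \<in> ?P" for f
  proof -
    have "real (card (trees_with V \<delta> {f})) = fact (card V - 2 - 1) * s f / Q"
      using card_trees_with[OF V, of "{f}" \<delta>] that n pos tot by (simp add: Q_def s_def)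
    also have "(fact (card V - 2 - 1) :: real) = fact (card V - 2) / (m - 2)"
      unfolding m_def k by (simp add: field_simps)
    finally show ?thesis unfolding t by simp
  qed
  have c2: "real (card (trees_with V \<delta> {f, g})) = t * s f * s g / ((m - 2) * (m - 3))"
    if "f \<in> ?P" "g \<in> ?P" "disjnt f g" for f g
  proof -
    have fg: "f \<noteq> g" using that by (auto simp: vertex_pairs_def disjnt_def)
    have "real (card (trees_with V \<delta> {f, g})) = fact (card V - 2 - 2) * (s f * s g) / Q"
      using card_trees_with[OF V, of "{f, g}" \<delta>] that n pos tot fg
      by (simp add: Q_def s_def pairwise_insert disjnt_sym)
    also have "(fact (card V - 2 - 2) :: real) = fact (card V - 2) / ((m - 2) * (m - 3))"
    proof -
      have "(fact (k + 2) :: real) = ((real k + 2) * (real k + 1)) * fact k" by (simp add: numeral_2_eq_2 algebra_simps)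
      moreover have "(real k + 2) * (real k + 1) \<noteq> 0" by (simp add: add_nonneg_eq_0_iff)
      moreover have "m - 2 = real k + 2" "m - 3 = real k + 1" "card V - 2 - 2 = k" "card V - 2 = k + 2"
        unfolding m_def k by simp_all
      ultimately show ?thesis by (metis nonzero_mult_div_cancel_left)
    qed
    finally show ?thesis unfolding t by (simp add: mult_ac)
  qed
  have K': "(\<Sum>f\<in>?P. a f * s f) = K * (m - 2)" using m by (simp add: K s_def m_def)
  have first: "(\<Sum>T\<in>?S. \<Sum>f\<in>T. a f) = t * K"
  proof -
    have "(\<Sum>T\<in>?S. \<Sum>f\<in>T. a f) = (\<Sum>f\<in>?P. a f * (t * s f / (m - 2)))"
      unfolding sum_trees_edges[OF V] using c1 by (intro sum.cong) auto
    also have "\<dots> = t / (m - 2) * (\<Sum>f\<in>?P. a f * s f)" by (simp add: sum_distrib_left mult_ac)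
    also have "\<dots> = t * K" unfolding K' using m by simp
    finally show ?thesis .
  qed
  have second: "(\<Sum>T\<in>?S. \<Sum>f\<in>T. \<Sum>g\<in>{g\<in>T. disjnt f g}. a f * a g) \<le> t * (K\<^sup>2 * (m - 2) / (m - 3))"
  proof -
    have "(\<Sum>T\<in>?S. \<Sum>f\<in>T. \<Sum>g\<in>{g\<in>T. disjnt f g}. a f * a g) =
       (\<Sum>f\<in>?P. \<Sum>g\<in>{g\<in>?P. disjnt f g}. t / ((m - 2) * (m - 3)) * ((a f * s f) * (a g * s g)))"
      unfolding sum_trees_edge_pairs[OF V] by (intro sum.cong refl) (auto simp: c2)
    \<comment> \<open>All terms are nonnegative, so the pairs that meet may be added to complete a
      product of two sums.\<close>
    also have "\<dots> \<le> (\<Sum>f\<in>?P. \<Sum>g\<in>?P. t / ((m - 2) * (m - 3)) * ((a f * s f) * (a g * s g)))"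
      using V a s0 m by (intro sum_mono sum_mono2) (auto simp: t_def)
    also have "\<dots> = t / ((m - 2) * (m - 3)) * ((\<Sum>f\<in>?P. a f * s f) * (\<Sum>f\<in>?P. a f * s f))"
      unfolding sum_product by (simp only: sum_distrib_left)
    also have "\<dots> = t * (K\<^sup>2 * (m - 2) / (m - 3))"
    proof -
      have "t / (p * q) * ((K * p) * (K * p)) = t * (K\<^sup>2 * p / q)" if "p > 0" "q > 0" for p q
        using that by (simp add: power2_eq_square)
      from this[of "m - 2" "m - 3"] show ?thesis unfolding K' using m by simp
    qed
    finally show ?thesis .
  qed
  have third: "(\<Sum>f\<in>T. \<Sum>g\<in>{g\<in>T. \<not> disjnt f g}. a f * a g) \<le> b\<^sup>2 * (m * real d ^ 2)" if "T \<in> ?S" for T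
  proof -
    have T: "T \<subseteq> ?P" "\<forall>v\<in>V. graph_degree T v \<le> d"
      using that graph_tree_subset[of V T] \<delta> by (auto simp: trees_with_def)
    show ?thesis unfolding m_def
      by (rule intersecting_edge_pairs_bound[OF V T]) (use a T in auto)
  qed
  have split: "(\<Sum>f\<in>T. a f)\<^sup>2 = (\<Sum>f\<in>T. \<Sum>g\<in>{g\<in>T. disjnt f g}. a f * a g) + (\<Sum>f\<in>T. \<Sum>g\<in>{g\<in>T. \<not> disjnt f g}. a f * a g)"
    if "T \<in> ?S" for T
  proof -
    have fT: "finite T" using that graph_tree_finite[OF V] by (auto simp: trees_with_def)
    have "(\<Sum>f\<in>T. a f)\<^sup>2 = (\<Sum>f\<in>T. \<Sum>g\<in>T. a f * a g)" by (simp add: power2_eq_square sum_product)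
    also have "\<dots> = (\<Sum>f\<in>T. (\<Sum>g\<in>{g\<in>T. disjnt f g}. a f * a g) + (\<Sum>g\<in>{g\<in>T. \<not> disjnt f g}. a f * a g))"
      using fT by (intro sum.cong refl) (subst sum.union_disjoint[symmetric], auto intro: sum.cong)
    finally show ?thesis by (simp add: sum.distrib)
  qed
  have "(\<Sum>T\<in>?S. ((\<Sum>f\<in>T. a f) - K)\<^sup>2) = (\<Sum>T\<in>?S. (\<Sum>f\<in>T. a f)\<^sup>2) - 2 * K * (\<Sum>T\<in>?S. \<Sum>f\<in>T. a f) + t * K\<^sup>2"
    by (simp add: power2_diff sum.distrib sum_subtractf sum_distrib_left t_def mult_ac)
  also have "(\<Sum>T\<in>?S. (\<Sum>f\<in>T. a f)\<^sup>2) \<le> t * (K\<^sup>2 * (m - 2) / (m - 3)) + t * (b\<^sup>2 * (m * real d ^ 2))"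
  proof -
    have "(\<Sum>T\<in>?S. (\<Sum>f\<in>T. a f)\<^sup>2) = (\<Sum>T\<in>?S. \<Sum>f\<in>T. \<Sum>g\<in>{g\<in>T. disjnt f g}. a f * a g) +
       (\<Sum>T\<in>?S. \<Sum>f\<in>T. \<Sum>g\<in>{g\<in>T. \<not> disjnt f g}. a f * a g)"
      using split by (simp add: sum.distrib)
    moreover have "(\<Sum>T\<in>?S. \<Sum>f\<in>T. \<Sum>g\<in>{g\<in>T. \<not> disjnt f g}. a f * a g) \<le> (\<Sum>T\<in>?S. b\<^sup>2 * (m * real d ^ 2))"
      by (intro sum_mono third)
    ultimately show ?thesis using second by (simp add: t_def)
  qed
  finally have "(\<Sum>T\<in>?S. ((\<Sum>f\<in>T. a f) - K)\<^sup>2) \<le>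
      t * (K\<^sup>2 * (m - 2) / (m - 3)) + t * (b\<^sup>2 * (m * real d ^ 2)) - 2 * K * (t * K) + t * K\<^sup>2"
    unfolding first by simp
  also have "\<dots> = t * (K\<^sup>2 / (m - 3) + b\<^sup>2 * (m * real d ^ 2))"
  proof -
    have "K\<^sup>2 * (m - 2) / (m - 3) = K\<^sup>2 + K\<^sup>2 / (m - 3)" using m by (simp add: field_simps)
    then show ?thesis by (simp add: algebra_simps power2_eq_square)
  qed
  finally show ?thesis unfolding t_def m_def .
qed

text \<open>The variance bound is applied to \<open>a f = (\<Prod>v\<in>f. real (r v)) / N\<close>.
  As \<open>\<delta> v - 1 = (d - 1) - r v\<close>, the mean is nearly the sum of the
  \<open>r v * ((d - 1) - r v)\<close> over the number of vertices, which is determined by the pair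
  moment. The constant 106 is twice 17 from the variance plus twice 36 from the squared
  bias.\<close>

lemma tree_edge_moment_concentration:
  fixes r :: "'a \<Rightarrow> nat"
  assumes V: "finite V" and n: "card V \<ge> 4" and d: "d \<ge> 3" and r: "\<forall>v\<in>V. r v \<le> d - 1"
    and tot: "(\<Sum>v\<in>V. r v) = (d - 2) * card V + 2"
  shows "(\<Sum>T\<in>trees_with V (\<lambda>v. d - r v) {}. (edge_moment T r / real (\<Sum>v\<in>V. r v) -
      (real d - 2) * ((real d - 2) - pair_moment V r / real (\<Sum>v\<in>V. r v)))\<^sup>2) \<le>
    real (card (trees_with V (\<lambda>v. d - r v) {})) * (106 * real d ^ 6 / real (card V))"
proof -
  define \<delta> where "\<delta> v = d - r v" for v
  define N where "N = real (\<Sum>v\<in>V. r v)"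
  define m where "m = real (card V)"
  define D where "D = real d"
  have m: "m \<ge> 4" using n by (simp add: m_def)
  have D: "D \<ge> 3" using d by (simp add: D_def)
  have Nm: "N = (D - 2) * m + 2" unfolding N_def tot D_def m_def using d by (simp add: of_nat_diff)
  have "1 * m \<le> (D - 2) * m" using D m by (intro mult_right_mono) auto
  then have N: "N \<ge> m" unfolding Nm by linarith
  then have N: "N \<ge> m" "N > 0" using m by auto
  have \<delta>: "\<forall>v\<in>V. 1 \<le> \<delta> v \<and> \<delta> v \<le> d" using r d by (force simp: \<delta>_def)
  have e: "real (\<delta> v) - 1 = (D - 1) - real (r v)" "real (r v) \<le> D - 1" if "v \<in> V" for v
  proof -
    have "r v \<le> d - 1" using r that by auto
    then show "real (\<delta> v) - 1 = (D - 1) - real (r v)" "real (r v) \<le> D - 1"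
      using d by (auto simp: \<delta>_def D_def of_nat_diff)
  qed
  have tot': "(\<Sum>v\<in>V. \<delta> v) + 2 = 2 * card V"
  proof -
    have "real (\<Sum>v\<in>V. \<delta> v) = (\<Sum>v\<in>V. D - real (r v))"
      unfolding of_nat_sum by (intro sum.cong refl) (use e in force)
    also have "\<dots> = D * m - N" by (simp add: sum_subtractf m_def N_def)
    finally have "real (\<Sum>v\<in>V. \<delta> v) = 2 * m - 2" unfolding Nm by (simp add: algebra_simps)
    then have "real ((\<Sum>v\<in>V. \<delta> v) + 2) = real (2 * card V)" unfolding m_def by simp
    then show ?thesis by (simp only: of_nat_eq_iff)
  qed
  define a where "a f = (\<Prod>v\<in>f. real (r v)) / N" for f
  define K where "K = (\<Sum>f\<in>vertex_pairs V. a f * (\<Sum>v\<in>f. real (\<delta> v) - 1)) / (m - 2)"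
  have a: "\<forall>f\<in>vertex_pairs V. 0 \<le> a f \<and> a f \<le> D\<^sup>2 / m"
  proof
    fix f assume "f \<in> vertex_pairs V"
    then obtain u v where uv: "f = {u, v}" "u \<noteq> v" "u \<in> V" "v \<in> V" by (rule vertex_pairsE)
    have "real (r u) * real (r v) \<le> D * D" using e(2)[OF uv(3)] e(2)[OF uv(4)] D by (intro mult_mono) auto
    then have "a f \<le> D * D / N" unfolding a_def using uv N by (simp add: divide_right_mono)
    also have "\<dots> \<le> D * D / m" using N m D by (intro divide_left_mono) auto
    finally show "0 \<le> a f \<and> a f \<le> D\<^sup>2 / m" using N by (auto simp: a_def power2_eq_square prod_nonneg)
  qed
  define x where "x v = real (r v) * ((D - 1) - real (r v))" for v
  have x: "0 \<le> x v" "x v \<le> D\<^sup>2" "x v * real (r v) \<le> D ^ 3" if "v \<in> V" for v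
  proof -
    show x0: "0 \<le> x v" unfolding x_def using e(2)[OF that] by simp
    show x1: "x v \<le> D\<^sup>2" unfolding x_def power2_eq_square using e(2)[OF that] D by (intro mult_mono) auto
    have "x v * real (r v) \<le> D\<^sup>2 * D" using e(2)[OF that] x0 x1 D by (intro mult_mono) auto
    then show "x v * real (r v) \<le> D ^ 3" by (simp add: power2_eq_square power3_eq_cube)
  qed
  define S where "S = pair_moment V r"
  have sx: "(\<Sum>v\<in>V. x v) = (D - 2) * N - S"
  proof -
    have "x v = (D - 2) * real (r v) - real (r v) * (real (r v) - 1)" for v by (simp add: x_def algebra_simps)
    then show ?thesis by (simp add: sum_subtractf S_def pair_moment_def N_def sum_distrib_left)
  qed
  \<comment> \<open>The pair \<open>{u, v}\<close> contributes
    \<open>(x u * r v + x v * r u) / N\<close>. Over ordered pairs the two terms have equal sums,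
    and the missing diagonal shows as \<open>N - r v\<close>.\<close>
  have Kx: "K = (\<Sum>v\<in>V. x v * (N - real (r v))) / (N * (m - 2))"
  proof -
    have "2 * (\<Sum>f\<in>vertex_pairs V. a f * (\<Sum>v\<in>f. real (\<delta> v) - 1)) =
      (\<Sum>u\<in>V. \<Sum>v\<in>V - {u}. (x u * real (r v) + x v * real (r u)) / N)"
      unfolding sum_vertex_pairs[OF V]
    proof (intro sum.cong refl)
      fix u v assume uv: "u \<in> V" "v \<in> V - {u}"
      have sa: "(\<Sum>v\<in>{u, v}. real (\<delta> v) - 1) = ((D - 1) - real (r u)) + ((D - 1) - real (r v))"
        "a {u, v} = real (r u) * real (r v) / N"
        using uv e(1) by (auto simp: a_def)
      show "a {u, v} * (\<Sum>v\<in>{u, v}. real (\<delta> v) - 1) = (x u * real (r v) + x v * real (r u)) / N"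
        unfolding sa using N(2) by (simp add: x_def field_simps)
    qed
    also have "\<dots> = (\<Sum>u\<in>V. \<Sum>v\<in>V - {u}. x u * real (r v) / N) + (\<Sum>u\<in>V. \<Sum>v\<in>V - {u}. x v * real (r u) / N)"
      by (simp add: sum.distrib add_divide_distrib)
    also have "(\<Sum>u\<in>V. \<Sum>v\<in>V - {u}. x v * real (r u) / N) = (\<Sum>u\<in>V. \<Sum>v\<in>V - {u}. x u * real (r v) / N)"
    proof -
      have sw: "(\<Sum>u\<in>V. \<Sum>v\<in>V - {u}. h u v) = (\<Sum>u\<in>V. \<Sum>v\<in>V. if v = u then 0 else h u v)" for h :: "'a \<Rightarrow> 'a \<Rightarrow> real"
        using V by (intro sum.cong[OF refl] sum.mono_neutral_cong_left) auto
      show ?thesis unfolding sw by (subst sum.swap) (intro sum.cong, auto)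
    qed
    also have "(\<Sum>u\<in>V. \<Sum>v\<in>V - {u}. x u * real (r v) / N) = (\<Sum>u\<in>V. x u * (N - real (r u))) / N"
      unfolding sum_divide_distrib
    proof (rule sum.cong[OF refl])
      fix u assume "u \<in> V"
      then have "(\<Sum>v\<in>V - {u}. real (r v)) = N - real (r u)" using V by (simp add: N_def sum_diff1)
      then show "(\<Sum>v\<in>V - {u}. x u * real (r v) / N) = x u * (N - real (r u)) / N"
        by (simp add: sum_distrib_left[symmetric] sum_divide_distrib[symmetric])
    qed
    finally have "(\<Sum>f\<in>vertex_pairs V. a f * (\<Sum>v\<in>f. real (\<delta> v) - 1)) = (\<Sum>u\<in>V. x u * (N - real (r u))) / N" by simp
    then show ?thesis by (simp add: K_def)
  qed
  define y where "y = (D - 2) - S / N"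
  define R where "R = (\<Sum>v\<in>V. x v * real (r v))"
  have R: "0 \<le> R" "R \<le> m * D ^ 3"
  proof -
    show "0 \<le> R" unfolding R_def using x by (intro sum_nonneg) auto
    have "R \<le> (\<Sum>v\<in>V. D ^ 3)" unfolding R_def using x by (intro sum_mono) auto
    then show "R \<le> m * D ^ 3" by (simp add: m_def)
  qed
  have Ny: "(\<Sum>v\<in>V. x v) = N * y" unfolding sx y_def using N by (simp add: field_simps)
  have Ny_bounds: "0 \<le> N * y" "N * y \<le> m * D\<^sup>2"
  proof -
    show "0 \<le> N * y" unfolding Ny[symmetric] using x by (intro sum_nonneg) auto
    have "(\<Sum>v\<in>V. x v) \<le> (\<Sum>v\<in>V. D\<^sup>2)" using x by (intro sum_mono) auto
    then show "N * y \<le> m * D\<^sup>2" unfolding Ny by (simp add: m_def)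
  qed
  have y: "0 \<le> y" "y \<le> D"
  proof -
    show "0 \<le> y" using Ny_bounds N by (simp add: zero_le_mult_iff)
    have "S \<ge> 0" unfolding S_def pair_moment_def by (intro sum_nonneg nat_mult_pred_nonneg)
    then have "S / N \<ge> 0" using N by simp
    then show "y \<le> D" unfolding y_def by linarith
  qed
  have K2: "K = (N * y - R / N) / (m - 2)"
  proof -
    have "(\<Sum>v\<in>V. x v * (N - real (r v))) = N * (N * y) - R"
      by (simp add: right_diff_distrib sum_subtractf R_def Ny[symmetric] sum_distrib_left mult_ac)
    then have "K = (N * (N * y) - R) / (N * (m - 2))" unfolding Kx by simp
    also have "\<dots> = (N * y - R / N) / (m - 2)" using N m by (simp add: field_simps)
    finally show ?thesis .
  qed
  have RN: "0 \<le> R / N" "R / N \<le> D ^ 3"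
  proof -
    show "0 \<le> R / N" using R N by simp
    have "m * D ^ 3 \<le> N * D ^ 3" using N D by (intro mult_right_mono) auto
    then have "R \<le> N * D ^ 3" using R(2) by linarith
    then show "R / N \<le> D ^ 3" using N by (simp add: field_simps)
  qed
  have m2: "m - 2 \<ge> m / 2" "m - 3 \<ge> m / 4" using m by auto
  have Kb: "\<bar>K\<bar> \<le> 2 * D ^ 3"
  proof -
    have "1 * D ^ 3 \<le> m * D ^ 3" using D m by (intro mult_right_mono) auto
    then have "R / N \<le> m * D ^ 3" using RN(2) by linarith
    moreover have "N * y \<le> m * D ^ 3"
    proof -
      have "D\<^sup>2 \<le> D ^ 3" using D by (intro power_increasing) auto
      then have "m * D\<^sup>2 \<le> m * D ^ 3" using m by (intro mult_left_mono) auto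
      then show ?thesis using Ny_bounds(2) by linarith
    qed
    ultimately have "\<bar>N * y - R / N\<bar> \<le> m * D ^ 3" using Ny_bounds(1) RN(1) unfolding abs_le_iff by linarith
    also have "\<dots> \<le> (2 * D ^ 3) * (m - 2)"
    proof -
      have "m * D ^ 3 \<le> (2 * (m - 2)) * D ^ 3" using m2 D by (intro mult_right_mono) auto
      then show ?thesis by (simp only: mult_ac)
    qed
    finally show ?thesis unfolding K2 using m by (simp add: abs_divide divide_le_eq)
  qed
  \<comment> \<open>The total of the degrees enters here:
    \<open>N - (D - 2) * (m - 2) = 2 * D - 2\<close> is bounded.\<close>
  have bias: "\<bar>K - (D - 2) * y\<bar> \<le> 6 * D ^ 3 / m"
  proof -
    have "K - (D - 2) * y = ((2 * D - 2) * y - R / N) / (m - 2)"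
      unfolding K2 Nm using m by (simp add: field_simps)
    moreover have "\<bar>(2 * D - 2) * y - R / N\<bar> \<le> 3 * D ^ 3"
    proof -
      have "(2 * D - 2) * y \<le> (2 * D) * D" using y D by (intro mult_mono) auto
      also have "\<dots> \<le> 2 * D ^ 3" using D by (simp add: power3_eq_cube)
      finally have "(2 * D - 2) * y \<le> 2 * D ^ 3" .
      moreover have "0 \<le> (2 * D - 2) * y" using y D by simp
      moreover have "0 \<le> D ^ 3" using D by simp
      ultimately show ?thesis using RN unfolding abs_le_iff by linarith
    qed
    ultimately have "\<bar>K - (D - 2) * y\<bar> \<le> 3 * D ^ 3 / (m - 2)"
      using m by (simp add: abs_divide divide_right_mono)
    also have "\<dots> \<le> 3 * D ^ 3 / (m / 2)" using m m2 D by (intro divide_left_mono) auto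
    finally show ?thesis by simp
  qed
  let ?S = "trees_with V \<delta> {}"
  define t where "t = real (card ?S)"
  have var: "(\<Sum>T\<in>?S. ((\<Sum>f\<in>T. a f) - K)\<^sup>2) \<le> t * (K\<^sup>2 / (m - 3) + (D\<^sup>2 / m)\<^sup>2 * (m * D\<^sup>2))"
    unfolding t_def m_def D_def
    by (rule tree_edge_sum_variance[OF V n \<delta> tot']) (use a in \<open>auto simp: K_def m_def D_def\<close>)
  have "K\<^sup>2 / (m - 3) \<le> (2 * D ^ 3)\<^sup>2 / (m / 4)"
    using Kb m m2 D by (intro frac_le power2_le_iff_abs_le[THEN iffD2]) (auto simp: power2_le_iff_abs_le)
  also have "(2 * D ^ 3)\<^sup>2 / (m / 4) = 16 * D ^ 6 / m" by (simp add: power_mult_distrib flip: power_mult)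
  finally have k1: "K\<^sup>2 / (m - 3) \<le> 16 * D ^ 6 / m" .
  have k2: "(D\<^sup>2 / m)\<^sup>2 * (m * D\<^sup>2) = D ^ 6 / m"
  proof -
    have "D ^ 6 = D\<^sup>2 * D\<^sup>2 * D\<^sup>2" by (simp flip: power_add)
    then show ?thesis using m by (simp add: power2_eq_square field_simps)
  qed
  have var2: "(\<Sum>T\<in>?S. ((\<Sum>f\<in>T. a f) - K)\<^sup>2) \<le> t * (17 * D ^ 6 / m)"
  proof -
    have "t * (K\<^sup>2 / (m - 3) + (D\<^sup>2 / m)\<^sup>2 * (m * D\<^sup>2)) \<le> t * (17 * D ^ 6 / m)"
      unfolding k2 using k1 by (intro mult_left_mono) (auto simp: t_def)
    then show ?thesis using var by linarith
  qed
  have bias2: "(K - (D - 2) * y)\<^sup>2 \<le> 36 * D ^ 6 / m"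
  proof -
    have "(K - (D - 2) * y)\<^sup>2 \<le> (6 * D ^ 3 / m)\<^sup>2"
      using bias m D by (subst power2_le_iff_abs_le) auto
    also have "\<dots> = 36 * D ^ 6 / m * (1 / m)"
      by (simp add: power_divide power_mult_distrib power2_eq_square[of m] flip: power_mult)
    also have "\<dots> \<le> 36 * D ^ 6 / m * 1" using m D by (intro mult_left_mono) auto
    finally show ?thesis by simp
  qed
  have "(\<Sum>T\<in>?S. ((\<Sum>f\<in>T. a f) - (D - 2) * y)\<^sup>2) \<le>
     (\<Sum>T\<in>?S. 2 * ((\<Sum>f\<in>T. a f) - K)\<^sup>2 + 2 * (K - (D - 2) * y)\<^sup>2)"
  proof (rule sum_mono)
    fix T
    have sq: "(p + q)\<^sup>2 \<le> 2 * p\<^sup>2 + 2 * q\<^sup>2" for p q :: real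
      using zero_le_power2[of "p - q"] by (simp add: power2_eq_square algebra_simps)
    show "((\<Sum>f\<in>T. a f) - (D - 2) * y)\<^sup>2 \<le> 2 * ((\<Sum>f\<in>T. a f) - K)\<^sup>2 + 2 * (K - (D - 2) * y)\<^sup>2"
      using sq[of "(\<Sum>f\<in>T. a f) - K" "K - (D - 2) * y"] by simp
  qed
  also have "\<dots> = 2 * (\<Sum>T\<in>?S. ((\<Sum>f\<in>T. a f) - K)\<^sup>2) + t * (2 * (K - (D - 2) * y)\<^sup>2)"
    by (simp add: sum.distrib sum_distrib_left t_def)
  also have "\<dots> \<le> 2 * (t * (17 * D ^ 6 / m)) + t * (2 * (36 * D ^ 6 / m))"
    using var2 bias2 by (intro add_mono mult_left_mono) (auto simp: t_def)
  also have "\<dots> = t * (106 * D ^ 6 / m)" by simp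
  finally have fin: "(\<Sum>T\<in>?S. ((\<Sum>f\<in>T. a f) - (D - 2) * y)\<^sup>2) \<le> t * (106 * D ^ 6 / m)" .
  have "(\<Sum>f\<in>T. a f) = edge_moment T r / N" for T by (simp add: a_def edge_moment_def sum_divide_distrib)
  moreover have "?S = trees_with V (\<lambda>v. d - r v) {}" by (simp add: \<delta>_def[abs_def])
  ultimately show ?thesis using fin unfolding t_def y_def S_def N_def m_def D_def by simp
qed

section \<open>Random degree sequences\<close>

text \<open>Capacities vary with the vertex because a shift lowers one of them. The value 0 outside
  \<open>V\<close> keeps the set finite and lets each sequence occur once.\<close>

definition degree_seqs :: "'a set \<Rightarrow> ('a \<Rightarrow> nat) \<Rightarrow> nat \<Rightarrow> ('a \<Rightarrow> nat) set" where
  "degree_seqs V c s = {r. (\<forall>v. v \<notin> V \<longrightarrow> r v = 0) \<and> (\<forall>v\<in>V. r v \<le> c v) \<and> (\<Sum>v\<in>V. r v) = s}"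

definition seq_weight :: "'a set \<Rightarrow> ('a \<Rightarrow> nat) \<Rightarrow> ('a \<Rightarrow> nat) \<Rightarrow> real" where
  "seq_weight V c r = (\<Prod>v\<in>V. real (c v choose r v))"

definition seq_sum :: "'a set \<Rightarrow> ('a \<Rightarrow> nat) \<Rightarrow> nat \<Rightarrow> (('a \<Rightarrow> nat) \<Rightarrow> real) \<Rightarrow> real" where
  "seq_sum V c s f = (\<Sum>r\<in>degree_seqs V c s. seq_weight V c r * f r)"

lemma finite_degree_seqs:
  assumes "finite V"
  shows "finite (degree_seqs V c s)"
proof (rule finite_subset)
  show "degree_seqs V c s \<subseteq> {r. \<forall>v. (v \<in> V \<longrightarrow> r v \<in> {..s}) \<and> (v \<notin> V \<longrightarrow> r v = 0)}"
    using assms by (auto simp: degree_seqs_def intro: member_le_sum)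
  show "finite {r. \<forall>v. (v \<in> V \<longrightarrow> r v \<in> {..s}) \<and> (v \<notin> V \<longrightarrow> r v = (0::nat))}"
    by (rule finite_set_of_finite_funs) (use assms in auto)
qed

lemma seq_weight_nonneg: "seq_weight V c r \<ge> 0"
  unfolding seq_weight_def by (intro prod_nonneg) auto

lemma seq_sum_mono:
  assumes "\<And>r. r \<in> degree_seqs V c s \<Longrightarrow> f r \<le> g r"
  shows "seq_sum V c s f \<le> seq_sum V c s g"
  unfolding seq_sum_def by (intro sum_mono mult_left_mono assms seq_weight_nonneg)

lemma seq_sum_add: "seq_sum V c s (\<lambda>r. f r + g r) = seq_sum V c s f + seq_sum V c s g"
  by (simp add: seq_sum_def distrib_left sum.distrib)

lemma seq_sum_cmult: "seq_sum V c s (\<lambda>r. a * f r) = a * seq_sum V c s f"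
  by (simp add: seq_sum_def sum_distrib_left mult_ac)

lemma seq_sum_sum: "seq_sum V c s (\<lambda>r. \<Sum>i\<in>I. f i r) = (\<Sum>i\<in>I. seq_sum V c s (f i))"
  unfolding seq_sum_def sum_distrib_left by (rule sum.swap)

text \<open>The counterpart of \<open>mg_sum_shift\<close>, by the absorption rule
  \<open>k * (c choose k) = c * ((c - 1) choose (k - 1))\<close>.\<close>

lemma seq_sum_shift:
  assumes V: "finite V" and v: "v \<in> V" and s: "s \<ge> 1"
  shows "seq_sum V c s (\<lambda>r. real (r v) * f r) =
    real (c v) * seq_sum V (c(v := c v - 1)) (s - 1) (\<lambda>r. f (r(v := r v + 1)))"
proof (cases "c v = 0")
  case True
  then have "r v = 0" if "r \<in> degree_seqs V c s" for r using that v by (auto simp: degree_seqs_def)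
  then have "seq_sum V c s (\<lambda>r. real (r v) * f r) = 0" by (auto simp: seq_sum_def intro!: sum.neutral)
  then show ?thesis using True by simp
next
  case False
  let ?c = "c(v := c v - 1)"
  have split: "(\<Sum>u\<in>V. r u) = r v + (\<Sum>u\<in>V - {v}. r u)" for r :: "'a \<Rightarrow> nat"
    using V v by (simp add: sum.remove)
  have rest: "(\<Sum>u\<in>V - {v}. (r(v := x)) u) = (\<Sum>u\<in>V - {v}. r u)" for r :: "'a \<Rightarrow> nat" and x
    by (intro sum.cong) auto
  have weight: "seq_weight V c r * real (r v) = real (c v) * seq_weight V ?c (r(v := r v - 1))" if "r v > 0" for r
  proof -
    have *: "seq_weight V c' r' = real (c' v choose r' v) * (\<Prod>u\<in>V - {v}. real (c' u choose r' u))" for c' r'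
      unfolding seq_weight_def using V v by (simp add: prod.remove)
    have "(\<Prod>u\<in>V - {v}. real (?c u choose (r(v := r v - 1)) u)) = (\<Prod>u\<in>V - {v}. real (c u choose r u))"
      by (intro prod.cong) auto
    moreover have "real (r v) * real (c v choose r v) = real (c v) * real ((c v - 1) choose (r v - 1))"
      using times_binomial_minus1_eq[OF that, of "c v"] by (metis of_nat_mult)
    ultimately show ?thesis unfolding *[of c r] *[of ?c] by (simp add: mult_ac)
  qed
  have "seq_sum V c s (\<lambda>r. real (r v) * f r) =
      (\<Sum>r\<in>{r \<in> degree_seqs V c s. r v > 0}. seq_weight V c r * (real (r v) * f r))"
    unfolding seq_sum_def using finite_degree_seqs[OF V] by (intro sum.mono_neutral_right) auto
  also have "\<dots> = (\<Sum>r\<in>degree_seqs V ?c (s - 1). real (c v) * (seq_weight V ?c r * f (r(v := r v + 1))))"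
  proof (rule sum.reindex_bij_witness[of _ "\<lambda>r. r(v := r v + 1)" "\<lambda>r. r(v := r v - 1)"])
    fix r assume "r \<in> {r \<in> degree_seqs V c s. r v > 0}"
    then have r: "r \<in> degree_seqs V c s" "r v > 0" by auto
    show eq: "(r(v := r v - 1))(v := (r(v := r v - 1)) v + 1) = r" using r by auto
    show "r(v := r v - 1) \<in> degree_seqs V ?c (s - 1)"
      using r v split[of r] split[of "r(v := r v - 1)"] rest[of r]
      by (auto simp: degree_seqs_def diff_le_mono)
    show "real (c v) * (seq_weight V ?c (r(v := r v - 1)) * f ((r(v := r v - 1))(v := (r(v := r v - 1)) v + 1))) =
      seq_weight V c r * (real (r v) * f r)"
      unfolding eq using weight[of r] r(2) by (simp add: mult_ac)
  next
    fix r assume r: "r \<in> degree_seqs V ?c (s - 1)"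
    show "(r(v := r v + 1))(v := (r(v := r v + 1)) v - 1) = r" by auto
    have "r v + 1 \<le> c v" using r v False by (auto simp: degree_seqs_def)
    then show "r(v := r v + 1) \<in> {r \<in> degree_seqs V c s. r v > 0}"
      using r v s split[of r] split[of "r(v := r v + 1)"] rest[of r]
      by (auto simp: degree_seqs_def split: if_splits)
  qed
  finally show ?thesis by (simp add: seq_sum_def sum_distrib_left)
qed

lemma sum_fun_upd_diff:
  fixes c :: "'a \<Rightarrow> nat"
  assumes "finite V" "v \<in> V" "x \<le> c v"
  shows "(\<Sum>u\<in>V. (c(v := c v - x)) u) = (\<Sum>u\<in>V. c u) - x"
proof -
  have "(\<Sum>u\<in>V - {v}. (c(v := c v - x)) u) = (\<Sum>u\<in>V - {v}. c u)" by (intro sum.cong) auto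
  then show ?thesis using assms by (simp add: sum.remove)
qed

text \<open>Vandermonde's identity with many summands. As the degrees add up to \<open>s\<close>,
  the shift yields the recursion of the binomial coefficient.\<close>

lemma seq_sum_one:
  assumes V: "finite V"
  shows "seq_sum V c s (\<lambda>_. 1) = real ((\<Sum>v\<in>V. c v) choose s)"
proof (induction s arbitrary: c)
  case 0
  have "degree_seqs V c 0 = {\<lambda>_. 0}" using V by (auto simp: degree_seqs_def fun_eq_iff)
  then show ?case by (simp add: seq_sum_def seq_weight_def)
next
  case (Suc s)
  let ?D = "\<Sum>v\<in>V. c v"
  have "real (Suc s) * seq_sum V c (Suc s) (\<lambda>_. 1) = seq_sum V c (Suc s) (\<lambda>r. \<Sum>v\<in>V. real (r v) * 1)"
    unfolding seq_sum_def sum_distrib_left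
  proof (rule sum.cong[OF refl])
    fix r assume "r \<in> degree_seqs V c (Suc s)"
    then have "real (Suc s) = (\<Sum>v\<in>V. real (r v))" by (auto simp: degree_seqs_def simp flip: of_nat_sum)
    then show "real (Suc s) * (seq_weight V c r * 1) = (\<Sum>v\<in>V. seq_weight V c r * (real (r v) * 1))"
      by (simp add: sum_distrib_left mult.commute)
  qed
  also have "\<dots> = (\<Sum>v\<in>V. seq_sum V c (Suc s) (\<lambda>r. real (r v) * 1))" by (rule seq_sum_sum)
  also have "\<dots> = (\<Sum>v\<in>V. real (c v) * real ((?D - 1) choose s))"
  proof (rule sum.cong[OF refl])
    fix v assume v: "v \<in> V"
    show "seq_sum V c (Suc s) (\<lambda>r. real (r v) * 1) = real (c v) * real ((?D - 1) choose s)"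
    proof (cases "c v = 0")
      case True
      then show ?thesis using seq_sum_shift[OF V v, of "Suc s" c "\<lambda>_. 1"] by simp
    next
      case False
      then have eq: "(\<Sum>u\<in>V. (c(v := c v - 1)) u) = ?D - 1" by (intro sum_fun_upd_diff[OF V v]) auto
      have "seq_sum V (c(v := c v - 1)) s (\<lambda>_. 1) = real ((?D - 1) choose s)" unfolding Suc.IH eq ..
      then show ?thesis using seq_sum_shift[OF V v, of "Suc s" c "\<lambda>_. 1"] by simp
    qed
  qed
  also have "\<dots> = real ?D * real ((?D - 1) choose s)" by (simp add: sum_distrib_right)
  also have "\<dots> = real (Suc s) * real (?D choose Suc s)"
    using times_binomial_minus1_eq[of "Suc s" ?D] by (metis diff_Suc_1 of_nat_mult zero_less_Suc)
  finally show ?case by (simp del: of_nat_Suc)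
qed

lemma seq_sum_shift_twice:
  assumes V: "finite V" and v: "v \<in> V" and s: "s \<ge> 2"
  shows "seq_sum V c s (\<lambda>r. real (r v) * (real (r v) - 1) * g r) =
    real (c v) * (real (c v) - 1) * seq_sum V (c(v := c v - 2)) (s - 2) (\<lambda>r. g (r(v := r v + 2)))"
proof (cases "c v = 0")
  case True
  then show ?thesis using seq_sum_shift[OF V v, of s c "\<lambda>r. (real (r v) - 1) * g r"] s by (simp add: mult.assoc)
next
  case False
  have "seq_sum V c s (\<lambda>r. real (r v) * (real (r v) - 1) * g r) = seq_sum V c s (\<lambda>r. real (r v) * ((real (r v) - 1) * g r))"
    by (simp add: mult.assoc)
  also have "\<dots> = real (c v) * seq_sum V (c(v := c v - 1)) (s - 1) (\<lambda>r. real (r v) * g (r(v := r v + 1)))"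
    using s by (subst seq_sum_shift[OF V v]) auto
  also have "seq_sum V (c(v := c v - 1)) (s - 1) (\<lambda>r. real (r v) * g (r(v := r v + 1))) =
      real (c v - 1) * seq_sum V (c(v := c v - 2)) (s - 2) (\<lambda>r. g (r(v := r v + 2)))"
    using s by (subst seq_sum_shift[OF V v]) (auto simp: numeral_2_eq_2 diff_diff_eq)
  finally show ?thesis using False by (simp add: of_nat_diff mult.assoc)
qed

lemma binomial_minus_two:
  assumes "2 \<le> s" "s \<le> D"
  shows "real ((D - 2) choose (s - 2)) * (real D * (real D - 1)) = real (D choose s) * (real s * (real s - 1))"
proof -
  have a: "real x * real (y choose x) = real y * real ((y - 1) choose (x - 1))" if "0 < x" for x y :: nat
    using times_binomial_minus1_eq[OF that, of y] by (metis of_nat_mult)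
  have "real (D choose s) * (real s * (real s - 1)) = (real s * real (D choose s)) * real (s - 1)"
    using assms by (simp add: of_nat_diff)
  also have "\<dots> = real D * (real (s - 1) * real ((D - 1) choose (s - 1)))"
    using a[of s D] assms by simp
  also have "\<dots> = real D * (real (D - 1) * real ((D - 2) choose (s - 2)))"
    using a[of "s - 1" "D - 1"] assms by (simp add: numeral_2_eq_2)
  finally show ?thesis using assms by (simp add: of_nat_diff mult_ac)
qed

text \<open>For a random set of \<open>s\<close> out of \<open>k * card V\<close> points in blocks
  of size \<open>k\<close>, the pair moment counts ordered pairs of chosen points in a common block,
  and \<open>A\<close> is its exact mean. Without replacement, four given points are chosen at most
  as often as two independent pairs would be. So the off-diagonal terms give at most the squared
  mean, and only \<open>k ^ 4\<close> per vertex remains.\<close>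

lemma pair_moment_concentration:
  assumes V: "finite V" and k: "k \<ge> 2" and s: "4 \<le> s" "s \<le> k * card V"
    and A: "A = real (card V) * (real k * (real k - 1)) *
      ((real s * (real s - 1)) / (real (k * card V) * (real (k * card V) - 1)))"
  shows "seq_sum V (\<lambda>_. k) s (\<lambda>r. (pair_moment V r - A)\<^sup>2) \<le>
    real ((k * card V) choose s) * (real (card V) * real k ^ 4)"
proof -
  define D where "D = k * card V"
  define n where "n = real (card V)"
  define kk where "kk = real k * (real k - 1)"
  define Q where "Q = real (D choose s)"
  have D4: "D \<ge> 4" "s \<le> D" using s by (auto simp: D_def)
  have Q: "Q > 0" using D4 by (simp add: Q_def zero_less_binomial_iff)
  have sumk: "card V * k = D" by (simp add: D_def mult.commute)
  have kk0: "kk \<ge> 0" unfolding kk_def by (rule nat_mult_pred_nonneg)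
  \<comment> \<open>The probability that two given points are both chosen.\<close>
  define \<rho> where "\<rho> = (real s * (real s - 1)) / (real D * (real D - 1))"
  have \<rho>0: "\<rho> \<ge> 0" unfolding \<rho>_def using D4 s by simp
  have A': "A = n * kk * \<rho>" by (simp add: A n_def kk_def \<rho>_def D_def)
  have b2: "real ((D - 2) choose (s - 2)) = Q * \<rho>"
  proof -
    have "real ((D - 2) choose (s - 2)) * (real D * (real D - 1)) = Q * (real s * (real s - 1))"
      unfolding Q_def using D4 s by (intro binomial_minus_two) auto
    moreover have "real D * (real D - 1) > 0" using D4 by simp
    ultimately show ?thesis unfolding \<rho>_def by (metis less_irrefl nonzero_eq_divide_eq times_divide_eq_right)
  qed
  have b4: "real ((D - 4) choose (s - 4)) \<le> Q * \<rho>\<^sup>2"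
  proof -
    define x where "x = real (s - 2) * (real (s - 2) - 1)"
    define y where "y = real (D - 2) * (real (D - 2) - 1)"
    have y: "y > 0" unfolding y_def using D4 by simp
    have "real ((D - 2 - 2) choose (s - 2 - 2)) * y = real ((D - 2) choose (s - 2)) * x"
      unfolding x_def y_def using D4 s by (intro binomial_minus_two) auto
    then have eq: "real ((D - 4) choose (s - 4)) = Q * \<rho> * (x / y)" unfolding b2 using y by (simp add: field_simps)
    \<comment> \<open>Negative correlation: once two points are chosen, a smaller share of the
      others is.\<close>
    have frac: "(p - 2) / (q - 2) \<le> p / q" if "2 < q" "p \<le> q" for p q :: real
      using that by (simp add: field_simps)
    have "x / y = ((real s - 2) / (real D - 2)) * ((real s - 1 - 2) / (real D - 1 - 2))"
      unfolding x_def y_def using D4 s by (simp add: of_nat_diff)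
    also have "\<dots> \<le> (real s / real D) * ((real s - 1) / (real D - 1))"
      using D4 s by (intro mult_mono frac) auto
    also have "\<dots> = \<rho>" by (simp add: \<rho>_def)
    finally have "x / y \<le> \<rho>" .
    then have "Q * \<rho> * (x / y) \<le> Q * \<rho> * \<rho>" using Q \<rho>0 by (intro mult_left_mono) auto
    then show ?thesis unfolding eq by (simp add: power2_eq_square mult_ac)
  qed
  let ?E = "seq_sum V (\<lambda>_. k) s"
  define f where "f r v = real (r v) * (real (r v) - 1)" for r :: "'a \<Rightarrow> nat" and v
  have first1: "?E (\<lambda>r. f r v) = kk * (Q * \<rho>)" if v: "v \<in> V" for v
  proof -
    have "?E (\<lambda>r. f r v) = ?E (\<lambda>r. real (r v) * (real (r v) - 1) * 1)" by (simp add: f_def)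
    also have "\<dots> = kk * seq_sum V ((\<lambda>_. k)(v := k - 2)) (s - 2) (\<lambda>_. 1)"
      unfolding kk_def using s by (intro seq_sum_shift_twice[OF V v]) auto
    also have "seq_sum V ((\<lambda>_. k)(v := k - 2)) (s - 2) (\<lambda>_. 1) = real ((D - 2) choose (s - 2))"
      using sum_fun_upd_diff[OF V v, of 2 "\<lambda>_. k"] k by (simp add: seq_sum_one[OF V] sumk)
    finally show ?thesis unfolding b2 .
  qed
  have first: "?E (\<lambda>r. pair_moment V r) = Q * A"
  proof -
    have "?E (\<lambda>r. pair_moment V r) = (\<Sum>v\<in>V. ?E (\<lambda>r. f r v))"
      unfolding pair_moment_def f_def by (rule seq_sum_sum)
    also have "\<dots> = n * (kk * (Q * \<rho>))" using first1 by (simp add: n_def)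
    finally show ?thesis by (simp add: A' mult_ac)
  qed
  have off: "?E (\<lambda>r. f r u * f r v) \<le> kk\<^sup>2 * (Q * \<rho>\<^sup>2)" if uv: "u \<in> V" "v \<in> V" "u \<noteq> v" for u v
  proof -
    let ?c = "(\<lambda>_. k)(u := k - 2)"
    have "?E (\<lambda>r. f r u * f r v) = kk * seq_sum V ?c (s - 2) (\<lambda>r. f (r(u := r u + 2)) v)"
      unfolding kk_def f_def[of _ u] using s by (intro seq_sum_shift_twice[OF V uv(1)]) auto
    also have "(\<lambda>r. f (r(u := r u + 2)) v) = (\<lambda>r. real (r v) * (real (r v) - 1) * 1)"
      using uv by (simp add: f_def)
    also have "seq_sum V ?c (s - 2) \<dots> = real (?c v) * (real (?c v) - 1) * seq_sum V (?c(v := ?c v - 2)) (s - 2 - 2) (\<lambda>_. 1)"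
      using s by (intro seq_sum_shift_twice[OF V uv(2)]) auto
    also have "real (?c v) * (real (?c v) - 1) = kk" using uv by (simp add: kk_def)
    also have "seq_sum V (?c(v := ?c v - 2)) (s - 2 - 2) (\<lambda>_. 1) = real ((D - 4) choose (s - 4))"
    proof -
      have "(\<Sum>w\<in>V. (?c(v := ?c v - 2)) w) = (\<Sum>w\<in>V. ?c w) - 2"
        using k uv by (intro sum_fun_upd_diff[OF V uv(2)]) auto
      also have "(\<Sum>w\<in>V. ?c w) = D - 2"
        using sum_fun_upd_diff[OF V uv(1), of 2 "\<lambda>_. k"] k by (simp add: sumk)
      finally have eq: "(\<Sum>w\<in>V. (?c(v := ?c v - 2)) w) = D - 2 - 2" .
      show ?thesis unfolding seq_sum_one[OF V] eq by simp
    qed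
    finally have "?E (\<lambda>r. f r u * f r v) = kk\<^sup>2 * real ((D - 4) choose (s - 4))"
      by (simp add: power2_eq_square)
    also have "\<dots> \<le> kk\<^sup>2 * (Q * \<rho>\<^sup>2)" by (intro mult_left_mono b4) auto
    finally show ?thesis .
  qed
  have diag: "?E (\<lambda>r. f r v * f r v) \<le> Q * real k ^ 4" if v: "v \<in> V" for v
  proof -
    have "?E (\<lambda>r. f r v * f r v) \<le> ?E (\<lambda>r. real k ^ 4 * 1)"
    proof (rule seq_sum_mono)
      fix r assume "r \<in> degree_seqs V (\<lambda>_. k) s"
      then have rk: "r v \<le> k" using v by (auto simp: degree_seqs_def)
      have f0: "0 \<le> f r v" unfolding f_def by (rule nat_mult_pred_nonneg)
      have f1: "f r v \<le> real k * real k"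
      proof (cases "r v = 0")
        case False
        then show ?thesis unfolding f_def using rk by (intro mult_mono) auto
      qed (simp add: f_def)
      have "f r v * f r v \<le> (real k * real k) * (real k * real k)" using f0 f1 by (intro mult_mono) auto
      then show "f r v * f r v \<le> real k ^ 4 * 1" by (simp add: power4_eq_xxxx mult_ac)
    qed
    also have "\<dots> = real k ^ 4 * Q" unfolding seq_sum_cmult by (simp add: seq_sum_one[OF V] sumk Q_def)
    finally show ?thesis by (simp add: mult.commute)
  qed
  have second: "?E (\<lambda>r. (pair_moment V r)\<^sup>2) \<le> n * (Q * real k ^ 4) + n * n * (kk\<^sup>2 * (Q * \<rho>\<^sup>2))"
  proof -
    have "?E (\<lambda>r. (pair_moment V r)\<^sup>2) = ?E (\<lambda>r. \<Sum>u\<in>V. \<Sum>v\<in>V. f r u * f r v)"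
      unfolding pair_moment_def f_def by (simp add: power2_eq_square sum_product)
    also have "\<dots> = (\<Sum>u\<in>V. \<Sum>v\<in>V. ?E (\<lambda>r. f r u * f r v))" unfolding seq_sum_sum ..
    also have "\<dots> \<le> (\<Sum>u\<in>V. Q * real k ^ 4 + n * (kk\<^sup>2 * (Q * \<rho>\<^sup>2)))"
    proof (rule sum_mono)
      fix u assume u: "u \<in> V"
      have "(\<Sum>v\<in>V. ?E (\<lambda>r. f r u * f r v)) = ?E (\<lambda>r. f r u * f r u) + (\<Sum>v\<in>V - {u}. ?E (\<lambda>r. f r u * f r v))"
        using V u by (simp add: sum.remove)
      also have "\<dots> \<le> Q * real k ^ 4 + (\<Sum>v\<in>V - {u}. kk\<^sup>2 * (Q * \<rho>\<^sup>2))"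
        using u by (intro add_mono diag sum_mono off) auto
      also have "(\<Sum>v\<in>V - {u}. kk\<^sup>2 * (Q * \<rho>\<^sup>2)) \<le> (\<Sum>v\<in>V. kk\<^sup>2 * (Q * \<rho>\<^sup>2))"
        using V Q by (intro sum_mono2) auto
      finally show "(\<Sum>v\<in>V. ?E (\<lambda>r. f r u * f r v)) \<le> Q * real k ^ 4 + n * (kk\<^sup>2 * (Q * \<rho>\<^sup>2))"
        by (simp add: n_def)
    qed
    also have "\<dots> = n * (Q * real k ^ 4) + n * n * (kk\<^sup>2 * (Q * \<rho>\<^sup>2))" by (simp add: n_def algebra_simps)
    finally show ?thesis .
  qed
  have "?E (\<lambda>r. (pair_moment V r - A)\<^sup>2) = ?E (\<lambda>r. (pair_moment V r)\<^sup>2 + ((- 2 * A) * pair_moment V r + A\<^sup>2 * 1))"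
    by (simp add: power2_diff algebra_simps)
  also have "\<dots> = ?E (\<lambda>r. (pair_moment V r)\<^sup>2) + ((- 2 * A) * (Q * A) + A\<^sup>2 * Q)"
    unfolding seq_sum_add seq_sum_cmult first by (simp add: seq_sum_one[OF V] sumk Q_def)
  also have "\<dots> \<le> n * (Q * real k ^ 4) + n * n * (kk\<^sup>2 * (Q * \<rho>\<^sup>2)) + ((- 2 * A) * (Q * A) + A\<^sup>2 * Q)"
    using second by simp
  also have "\<dots> = Q * (n * real k ^ 4)" unfolding A' by (simp add: power2_eq_square algebra_simps)
  finally show ?thesis unfolding Q_def n_def D_def .
qed

section \<open>Stirling's formula\<close>

text \<open>Its limit is the square root of 2 pi. In the final count two of these ratios stand over
  two others, so any positive limit cancels.\<close>

definition stirling_ratio :: "nat \<Rightarrow> real" where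
  "stirling_ratio m = fact m / (sqrt (real m) * (real m / exp 1) ^ m)"

text \<open>The logarithms have differences of order 1 / m^2, so they converge as partial sums of a
  summable series. The index is moved by one to keep away from the logarithm of 0.\<close>

lemma stirling_ratio_limit: "\<exists>c>0. stirling_ratio \<longlonglongrightarrow> c"
proof -
  define a where "a m = ln (fact (Suc m)) - (real (Suc m) + 1/2) * ln (real (Suc m)) + real (Suc m)" for m
  have diff: "a (Suc m) - a m = 1 - (real (Suc m) + 1/2) * (ln (real (Suc (Suc m))) - ln (real (Suc m)))" for m
  proof -
    have "ln (fact (Suc (Suc m))) = ln (real (Suc (Suc m))) + ln (fact (Suc m) :: real)"
      by (subst fact_Suc) (simp add: ln_mult del: fact_Suc)
    then show ?thesis unfolding a_def by (simp add: algebra_simps del: fact_Suc)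
  qed
  have "(\<lambda>m. 1 - (real (Suc m) + 1/2) * (ln (real (Suc (Suc m))) - ln (real (Suc m)))) \<in> O(\<lambda>m. 1 / real m ^ 2)"
    by real_asymp
  then have "(\<lambda>m. a (Suc m) - a m) \<in> O(\<lambda>m. 1 / real m ^ 2)" using diff by simp
  then have "summable (\<lambda>m. a (Suc m) - a m)"
  proof (rule summable_comparison_test_bigo[rotated])
    show "summable (\<lambda>m. norm (1 / real m ^ 2))"
      using inverse_power_summable[of 2, where ?'a = real] by (simp add: divide_inverse)
  qed
  then have "(\<lambda>m. \<Sum>k<m. a (Suc k) - a k) \<longlonglongrightarrow> (\<Sum>k. a (Suc k) - a k)" by (rule summable_LIMSEQ)
  then have "(\<lambda>m. a m - a 0) \<longlonglongrightarrow> (\<Sum>k. a (Suc k) - a k)" by (simp add: sum_lessThan_telescope)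
  then have "(\<lambda>m. (a m - a 0) + a 0) \<longlonglongrightarrow> (\<Sum>k. a (Suc k) - a k) + a 0" by (intro tendsto_intros)
  then have lim: "(\<lambda>m. exp (a m)) \<longlonglongrightarrow> exp ((\<Sum>k. a (Suc k) - a k) + a 0)" by (intro tendsto_intros) simp
  have "exp (a m) = stirling_ratio (Suc m)" for m
  proof -
    define x where "x = real (Suc m)"
    have x: "x > 0" and rx: "real (Suc m) = x" by (simp_all add: x_def)
    have "ln (stirling_ratio (Suc m)) = ln (fact (Suc m)) - (ln (sqrt x) + real (Suc m) * ln (x / exp 1))"
      unfolding stirling_ratio_def x_def[symmetric] using x
      by (simp add: ln_div ln_mult ln_realpow rx del: fact_Suc of_nat_Suc power_Suc)
    also have "\<dots> = a m" unfolding a_def rx using x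
      by (simp add: ln_sqrt ln_div algebra_simps del: fact_Suc of_nat_Suc)
    finally have "ln (stirling_ratio (Suc m)) = a m" .
    moreover have "stirling_ratio (Suc m) > 0" unfolding stirling_ratio_def by (simp del: fact_Suc of_nat_Suc power_Suc)
    ultimately show ?thesis by (metis exp_ln)
  qed
  then have "(\<lambda>m. stirling_ratio (Suc m)) \<longlonglongrightarrow> exp ((\<Sum>k. a (Suc k) - a k) + a 0)" using lim by simp
  then have "stirling_ratio \<longlonglongrightarrow> exp ((\<Sum>k. a (Suc k) - a k) + a 0)"
    by (rule LIMSEQ_imp_Suc)
  then show ?thesis by (metis exp_gt_zero)
qed

text \<open>Each factorial is written as \<open>stirling_ratio\<close> times Stirling's expression,
  and the expressions are compared through logarithms. Since \<open>D + p = h + 2 * p\<close>, the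
  powers of \<open>n\<close> and of \<open>exp 1\<close> cancel; the factor 1 / n of the theorem
  stems from \<open>fact (h + 1) = (h + 1) * fact h\<close>.\<close>

lemma stirling_identity:
  fixes d n p h D :: nat
  assumes d: "d \<ge> 3" and n: "n > 0" and p: "2 * p = d * n" and h: "h + n = p" and D: "D = (d - 1) * n"
  shows "real d ^ n * 2 ^ n / 2 * (fact D * fact p / (fact (h + 1) * fact (2 * p))) =
    ((real d - 1) powr (1/2) / (real n * (real d - 2) powr (3/2))
       * ((real d - 1) ^ (d - 1) / (real d ^ 2 - 2 * real d) powr (real d / 2 - 1)) ^ n)
    * (stirling_ratio D * stirling_ratio p / (stirling_ratio h * stirling_ratio (2 * p))) * (real h / (real h + 1))"
proof -
  define st where "st m = sqrt (real m) * (real m / exp 1) ^ m" for m :: nat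
  define \<nu> where "\<nu> = real n"
  define x where "x = real d"
  have x: "x \<ge> 3" and \<nu>: "\<nu> > 0" using d n by (auto simp: x_def \<nu>_def)
  have rp: "real p = x * \<nu> / 2"
  proof -
    have "real (2 * p) = real (d * n)" unfolding p ..
    then show ?thesis by (simp add: x_def \<nu>_def)
  qed
  have rh: "real h = (x - 2) * \<nu> / 2"
  proof -
    have "real h + \<nu> = real p" unfolding \<nu>_def h[symmetric] by simp
    then show ?thesis unfolding rp by (simp add: field_simps)
  qed
  have rD: "real D = (x - 1) * \<nu>" unfolding D x_def \<nu>_def using d by (simp add: of_nat_diff)
  have r2p: "real (2 * p) = x * \<nu>" using rp by simp
  have pos: "real p > 0" "real h > 0" "real D > 0" "real (2 * p) > 0"
    unfolding rp rh rD r2p using x \<nu> by auto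
  have pos': "p > 0" "h > 0" "D > 0" using pos by auto
  have fact: "fact m = stirling_ratio m * st m" if "m > 0" for m
    using that by (simp add: stirling_ratio_def st_def)
  have lnst: "ln (st m) = ln (real m) / 2 + real m * (ln (real m) - 1)" if "m > 0" for m
    unfolding st_def using that by (simp add: ln_mult ln_sqrt ln_realpow ln_div)
  have stpos: "st m > 0" if "m > 0" for m unfolding st_def using that by simp
  define L where "L = real d ^ n * 2 ^ n / 2 * (st D * st p / (st h * st (2 * p)))"
  define T where "T = (real d - 1) powr (1/2) / (real n * (real d - 2) powr (3/2))
       * ((real d - 1) ^ (d - 1) / (real d ^ 2 - 2 * real d) powr (real d / 2 - 1)) ^ n"
  have Lpos: "L > 0" unfolding L_def using d stpos pos' by (simp add: stpos)
  have xx: "x\<^sup>2 - 2 * x = x * (x - 2)" by (simp add: power2_eq_square algebra_simps)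
  have Tpos: "T > 0" unfolding T_def x_def[symmetric] \<nu>_def[symmetric] xx using x \<nu> by simp
  have "ln L = \<nu> * ln x + \<nu> * ln 2 - ln 2 + (ln (st D) + ln (st p) - (ln (st h) + ln (st (2 * p))))"
    unfolding L_def using d stpos[OF pos'(1)] stpos[OF pos'(2)] stpos[OF pos'(3)] stpos[of "2 * p"] pos'
    by (simp add: ln_mult ln_div ln_realpow x_def \<nu>_def)
  also have "\<dots> = \<nu> * ln x + \<nu> * ln 2 - ln 2 +
      (ln (real D) / 2 + real D * (ln (real D) - 1) + (ln (real p) / 2 + real p * (ln (real p) - 1)) -
      (ln (real h) / 2 + real h * (ln (real h) - 1) + (ln (real (2 * p)) / 2 + real (2 * p) * (ln (real (2 * p)) - 1))))"
    using pos' by (simp add: lnst del: of_nat_mult)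
  also have "ln (real D) = ln (x - 1) + ln \<nu>" unfolding rD using x \<nu> by (simp add: ln_mult)
  also have "ln (real p) = ln x + ln \<nu> - ln 2" unfolding rp using x \<nu> by (simp add: ln_mult ln_div)
  also have "ln (real h) = ln (x - 2) + ln \<nu> - ln 2" unfolding rh using x \<nu> by (simp add: ln_mult ln_div)
  also have "ln (real (2 * p)) = ln x + ln \<nu>" unfolding r2p using x \<nu> by (simp add: ln_mult)
  finally have lnL: "ln L = \<nu> * ln x + \<nu> * ln 2 - ln 2 +
      ((ln (x - 1) + ln \<nu>) / 2 + (x - 1) * \<nu> * (ln (x - 1) + ln \<nu> - 1) +
       ((ln x + ln \<nu> - ln 2) / 2 + x * \<nu> / 2 * (ln x + ln \<nu> - ln 2 - 1)) -
       ((ln (x - 2) + ln \<nu> - ln 2) / 2 + (x - 2) * \<nu> / 2 * (ln (x - 2) + ln \<nu> - ln 2 - 1) +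
        ((ln x + ln \<nu>) / 2 + x * \<nu> * (ln x + ln \<nu> - 1))))"
    unfolding rD rp rh r2p .
  have lnT: "ln T = ln (x - 1) / 2 - (ln \<nu> + 3/2 * ln (x - 2)) +
      \<nu> * ((x - 1) * ln (x - 1) - (x / 2 - 1) * (ln x + ln (x - 2)))"
  proof -
    have "ln T = ln ((x - 1) powr (1/2)) - (ln \<nu> + ln ((x - 2) powr (3/2))) +
       \<nu> * (ln ((x - 1) ^ (d - 1)) - ln ((x * (x - 2)) powr (x / 2 - 1)))"
      unfolding T_def x_def[symmetric] \<nu>_def[symmetric] xx
      using x \<nu> by (simp add: ln_mult ln_div ln_realpow \<nu>_def)
    also have "ln ((x - 1) ^ (d - 1)) = (x - 1) * ln (x - 1)"
      using x d by (simp add: ln_realpow x_def of_nat_diff)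
    also have "ln ((x * (x - 2)) powr (x / 2 - 1)) = (x / 2 - 1) * (ln x + ln (x - 2))"
      using x by (simp add: ln_powr ln_mult)
    finally show ?thesis using x by (simp add: ln_powr)
  qed
  have "ln (T * real h) = ln T + (ln (x - 2) + ln \<nu> - ln 2)"
    unfolding rh using Tpos x \<nu> by (simp add: ln_mult ln_div)
  also have "\<dots> = ln L" unfolding lnL lnT by (simp add: field_simps)
  finally have "L = T * real h" using Lpos Tpos pos(2) by (metis ln_inj_iff mult_pos_pos)
  moreover have "real d ^ n * 2 ^ n / 2 * (fact D * fact p / (fact (h + 1) * fact (2 * p))) =
     L * (stirling_ratio D * stirling_ratio p / (stirling_ratio h * stirling_ratio (2 * p))) / (real h + 1)"
  proof -
    have f1: "fact (h + 1) = (real h + 1) * (fact h :: real)" by simp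
    have "2 * p > 0" using pos' by simp
    then show ?thesis unfolding f1 L_def using fact[of D] fact[of p] fact[of h] fact[of "2 * p"] pos'
      by (simp add: mult_ac)
  qed
  ultimately show ?thesis unfolding T_def by (simp add: mult_ac)
qed

section \<open>Spanning trees of regular graphs\<close>

lemma graph_degree_Un:
  assumes "finite E" "finite T" "E \<inter> T = {}"
  shows "graph_degree (E \<union> T) v = graph_degree E v + graph_degree T v"
proof -
  have "{e \<in> E \<union> T. v \<in> e} = {e \<in> E. v \<in> e} \<union> {e \<in> T. v \<in> e}" by auto
  then show ?thesis unfolding graph_degree_def using assms by (simp add: card_Un_disjoint disjoint_iff)
qed

lemma card_regular_supergraphs:
  assumes V: "finite V" and T: "T \<subseteq> vertex_pairs V" and deg: "\<forall>v\<in>V. graph_degree T v + r v = d"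
  shows "card {G \<in> regular_graphs d V. T \<subseteq> G} =
    card {E \<in> simple_graphs V. E \<inter> T = {} \<and> (\<forall>v\<in>V. graph_degree E v = r v)}"
proof -
  have fT: "finite T" using T V finite_subset finite_vertex_pairs by blast
  have fE: "finite E" if "E \<subseteq> vertex_pairs V" for E using that V finite_subset finite_vertex_pairs by blast
  have "bij_betw (\<lambda>G. G - T) {G \<in> regular_graphs d V. T \<subseteq> G}
     {E \<in> simple_graphs V. E \<inter> T = {} \<and> (\<forall>v\<in>V. graph_degree E v = r v)}"
  proof (rule bij_betw_byWitness[where f' = "\<lambda>E. E \<union> T"])
    show "(\<lambda>G. G - T) ` {G \<in> regular_graphs d V. T \<subseteq> G} \<subseteq>
       {E \<in> simple_graphs V. E \<inter> T = {} \<and> (\<forall>v\<in>V. graph_degree E v = r v)}"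
    proof clarify
      fix G assume G: "G \<in> regular_graphs d V" "T \<subseteq> G"
      then have GV: "G \<subseteq> vertex_pairs V" "\<And>v. v \<in> V \<Longrightarrow> graph_degree G v = d"
        by (auto simp: regular_graphs_def simple_graphs_eq_Pow)
      have "graph_degree (G - T) v = r v" if "v \<in> V" for v
      proof -
        have "graph_degree ((G - T) \<union> T) v = graph_degree (G - T) v + graph_degree T v"
          using fE[OF GV(1)] fT by (intro graph_degree_Un) auto
        moreover have "(G - T) \<union> T = G" using G(2) by auto
        ultimately show ?thesis using GV(2)[OF that] deg that by force
      qed
      then show "G - T \<in> simple_graphs V \<and> (G - T) \<inter> T = {} \<and> (\<forall>v\<in>V. graph_degree (G - T) v = r v)"
        using GV by (auto simp: simple_graphs_eq_Pow)
    qed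
    show "(\<lambda>E. E \<union> T) ` {E \<in> simple_graphs V. E \<inter> T = {} \<and> (\<forall>v\<in>V. graph_degree E v = r v)} \<subseteq>
       {G \<in> regular_graphs d V. T \<subseteq> G}"
      using T fE fT deg by (auto simp: regular_graphs_def simple_graphs_eq_Pow graph_degree_Un add.commute)
  qed auto
  then show ?thesis by (rule bij_betw_same_card)
qed

lemma finite_regular_graphs: "finite V \<Longrightarrow> finite (regular_graphs d V)"
  by (rule finite_subset[of _ "Pow (vertex_pairs V)"]) (auto simp: regular_graphs_def simple_graphs_eq_Pow)

text \<open>Trees are grouped by the residual degrees \<open>r v = d - graph_degree T v\<close>,
  whose total is \<open>d * n - (2 * n - 2)\<close> for \<open>n\<close> vertices. A tree inside a
  \<open>d\<close>-regular graph has degrees between 1 and \<open>d\<close>, hence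
  \<open>r v \<le> d - 1\<close>; all other trees contribute 0.\<close>

lemma sum_card_spanning_trees:
  fixes V :: "'a set"
  assumes V: "finite V" and n: "card V \<ge> 2" and d: "d \<ge> 2" and s: "s = (d - 2) * card V + 2"
  shows "(\<Sum>G\<in>regular_graphs d V. real (card (spanning_trees V G))) =
    (\<Sum>r\<in>degree_seqs V (\<lambda>_. d - 1) s. \<Sum>T\<in>trees_with V (\<lambda>v. d - r v) {}.
       real (card {E \<in> simple_graphs V. E \<inter> T = {} \<and> (\<forall>v\<in>V. graph_degree E v = r v)}))"
proof -
  let ?Tr = "{T. graph_tree V T}" and ?RG = "regular_graphs d V"
  let ?DS = "degree_seqs V (\<lambda>_. d - 1) s"
  have fTr: "finite ?Tr" by (rule finite_graph_trees[OF V])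
  have fRG: "finite ?RG" by (rule finite_regular_graphs[OF V])
  have "(\<Sum>G\<in>?RG. real (card (spanning_trees V G))) = (\<Sum>G\<in>?RG. \<Sum>T\<in>?Tr. if T \<subseteq> G then 1 else 0)"
  proof (rule sum.cong[OF refl])
    fix G
    have "spanning_trees V G = {T \<in> ?Tr. T \<subseteq> G}" by (auto simp: spanning_trees_def)
    then show "real (card (spanning_trees V G)) = (\<Sum>T\<in>?Tr. if T \<subseteq> G then 1 else 0)"
      using fTr by (simp add: sum.inter_filter[symmetric])
  qed
  also have "\<dots> = (\<Sum>T\<in>?Tr. \<Sum>G\<in>?RG. if T \<subseteq> G then 1 else 0)" by (rule sum.swap)
  also have "\<dots> = (\<Sum>T\<in>?Tr. real (card {G \<in> ?RG. T \<subseteq> G}))"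
    using fRG by (simp add: sum.inter_filter[symmetric])
  also have "\<dots> = (\<Sum>T\<in>(\<Union>r\<in>?DS. trees_with V (\<lambda>v. d - r v) {}). real (card {G \<in> ?RG. T \<subseteq> G}))"
  proof (rule sum.mono_neutral_right[OF fTr])
    show "(\<Union>r\<in>?DS. trees_with V (\<lambda>v. d - r v) {}) \<subseteq> ?Tr" by (auto simp: trees_with_def)
    show "\<forall>T\<in>?Tr - (\<Union>r\<in>?DS. trees_with V (\<lambda>v. d - r v) {}). real (card {G \<in> ?RG. T \<subseteq> G}) = 0"
    proof
      fix T assume T: "T \<in> ?Tr - (\<Union>r\<in>?DS. trees_with V (\<lambda>v. d - r v) {})"
      then have tree: "graph_tree V T" by simp
      have "{G \<in> ?RG. T \<subseteq> G} = {}"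
      proof (rule ccontr)
        assume "{G \<in> ?RG. T \<subseteq> G} \<noteq> {}"
        then obtain G where G: "G \<in> ?RG" "T \<subseteq> G" by auto
        then have GV: "G \<subseteq> vertex_pairs V" "\<And>v. v \<in> V \<Longrightarrow> graph_degree G v = d"
          by (auto simp: regular_graphs_def simple_graphs_eq_Pow)
        have fG: "finite G" using GV V finite_subset finite_vertex_pairs by blast
        have le: "graph_degree T v \<le> d" "graph_degree T v \<ge> 1" if "v \<in> V" for v
        proof -
          have "graph_degree T v \<le> graph_degree G v"
            unfolding graph_degree_def using fG G(2) by (intro card_mono) auto
          then show "graph_degree T v \<le> d" using GV(2)[OF that] by simp
          show "graph_degree T v \<ge> 1" using tree_degree_pos[OF V tree n that] by simp
        qed
        define r where "r v = (if v \<in> V then d - graph_degree T v else 0)" for v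
        have "(\<Sum>v\<in>V. r v + graph_degree T v) = (\<Sum>v\<in>V. d)"
          using le by (intro sum.cong) (auto simp: r_def)
        then have "(\<Sum>v\<in>V. r v) + (\<Sum>v\<in>V. graph_degree T v) = d * card V" by (simp add: sum.distrib mult.commute)
        moreover have "d * card V = (d - 2) * card V + 2 * card V" using d by (metis add_mult_distrib le_add_diff_inverse2)
        ultimately have "(\<Sum>v\<in>V. r v) = s" using sum_tree_degrees[OF V tree] unfolding s by linarith
        then have "r \<in> ?DS" using le by (auto simp: degree_seqs_def r_def intro: diff_le_mono2)
        moreover have "T \<in> trees_with V (\<lambda>v. d - r v) {}" using tree le by (auto simp: trees_with_def r_def)
        ultimately show False using T by auto
      qed
      then show "real (card {G \<in> ?RG. T \<subseteq> G}) = 0" by (simp only: card.empty)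
    qed
  qed
  also have "\<dots> = (\<Sum>r\<in>?DS. \<Sum>T\<in>trees_with V (\<lambda>v. d - r v) {}. real (card {G \<in> ?RG. T \<subseteq> G}))"
  proof (rule sum.UNION_disjoint)
    show "finite ?DS" by (rule finite_degree_seqs[OF V])
    show "\<forall>r\<in>?DS. finite (trees_with V (\<lambda>v. d - r v) {})" using finite_trees_with[OF V] by blast
    show "\<forall>r\<in>?DS. \<forall>r'\<in>?DS. r \<noteq> r' \<longrightarrow> trees_with V (\<lambda>v. d - r v) {} \<inter> trees_with V (\<lambda>v. d - r' v) {} = {}"
    proof (intro ballI impI, rule ccontr)
      fix r r' assume r: "r \<in> ?DS" "r' \<in> ?DS" "r \<noteq> r'"
        and "trees_with V (\<lambda>v. d - r v) {} \<inter> trees_with V (\<lambda>v. d - r' v) {} \<noteq> {}"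
      then obtain T where "T \<in> trees_with V (\<lambda>v. d - r v) {}" "T \<in> trees_with V (\<lambda>v. d - r' v) {}" by auto
      then have eq: "d - r v = d - r' v" if "v \<in> V" for v using that by (auto simp: trees_with_def)
      have "r v = r' v" for v
      proof (cases "v \<in> V")
        case True
        then have "r v \<le> d - 1" "r' v \<le> d - 1" using r by (auto simp: degree_seqs_def)
        then show ?thesis using eq[OF True] d by linarith
      qed (use r in \<open>auto simp: degree_seqs_def\<close>)
      then show False using r(3) by auto
    qed
  qed
  also have "\<dots> = (\<Sum>r\<in>?DS. \<Sum>T\<in>trees_with V (\<lambda>v. d - r v) {}.
       real (card {E \<in> simple_graphs V. E \<inter> T = {} \<and> (\<forall>v\<in>V. graph_degree E v = r v)}))"
  proof (rule sum.cong[OF refl], rule sum.cong[OF refl])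
    fix r T assume r: "r \<in> ?DS" and T: "T \<in> trees_with V (\<lambda>v. d - r v) {}"
    have "\<forall>v\<in>V. graph_degree T v + r v = d"
    proof
      fix v assume v: "v \<in> V"
      then have "graph_degree T v = d - r v" "r v \<le> d - 1" using r T by (auto simp: trees_with_def degree_seqs_def)
      then show "graph_degree T v + r v = d" using d by linarith
    qed
    then show "real (card {G \<in> ?RG. T \<subseteq> G}) =
       real (card {E \<in> simple_graphs V. E \<inter> T = {} \<and> (\<forall>v\<in>V. graph_degree E v = r v)})"
      using T graph_tree_subset[of V T] by (subst card_regular_supergraphs[OF V]) (auto simp: trees_with_def)
  qed
  finally show ?thesis .
qed

text \<open>With degrees \<open>d - r v\<close> the tree count has \<open>fact (d - 1 - r v)\<close>
  in its denominator, and the configuration model supplies \<open>fact (r v)\<close>; together they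
  form the binomial coefficients up to a power of \<open>fact (d - 1)\<close>. This is the origin of
  the random subset.\<close>

lemma card_trees_with_weight:
  fixes V :: "'a set"
  assumes V: "finite V" and n: "card V \<ge> 2" and d: "d \<ge> 2"
    and r: "r \<in> degree_seqs V (\<lambda>_. d - 1) ((d - 2) * card V + 2)"
  shows "real (card (trees_with V (\<lambda>v. d - r v) {})) / (\<Prod>v\<in>V. fact (r v)) =
    fact (card V - 2) / fact (d - 1) ^ card V * seq_weight V (\<lambda>_. d - 1) r"
proof -
  have rv: "r v \<le> d - 1" if "v \<in> V" for v using r that by (auto simp: degree_seqs_def)
  have "(\<Sum>v\<in>V. (d - r v) + r v) = (\<Sum>v\<in>V. d)"
  proof (rule sum.cong[OF refl])
    fix v assume "v \<in> V"
    then show "(d - r v) + r v = d" using rv[of v] d by linarith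
  qed
  then have "(\<Sum>v\<in>V. d - r v) + (\<Sum>v\<in>V. r v) = d * card V" by (simp add: sum.distrib mult.commute)
  moreover have "d * card V = (d - 2) * card V + 2 * card V" using d by (metis add_mult_distrib le_add_diff_inverse2)
  moreover have "(\<Sum>v\<in>V. r v) = (d - 2) * card V + 2" using r by (auto simp: degree_seqs_def)
  ultimately have tot: "(\<Sum>v\<in>V. d - r v) + 2 = 2 * card V" by linarith
  have pos: "\<forall>v\<in>V. d - r v \<ge> 1"
  proof
    fix v assume "v \<in> V"
    then show "d - r v \<ge> 1" using rv[of v] d by linarith
  qed
  have c: "real (card (trees_with V (\<lambda>v. d - r v) {})) = fact (card V - 2) / (\<Prod>v\<in>V. fact (d - r v - 1))"
    using card_trees_with[OF V, of "{}" "\<lambda>v. d - r v"] n pos tot by simp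
  have "seq_weight V (\<lambda>_. d - 1) r = (\<Prod>v\<in>V. fact (d - 1) / (fact (r v) * fact (d - r v - 1)))"
    unfolding seq_weight_def
  proof (rule prod.cong[OF refl])
    fix v assume "v \<in> V"
    then show "real ((d - 1) choose r v) = fact (d - 1) / (fact (r v) * fact (d - r v - 1))"
      using binomial_fact[OF rv[of v], where ?'a = real] by (simp add: diff_commute)
  qed
  also have "\<dots> = fact (d - 1) ^ card V / ((\<Prod>v\<in>V. fact (r v)) * (\<Prod>v\<in>V. fact (d - r v - 1)))"
    by (simp add: prod_dividef prod.distrib)
  finally show ?thesis unfolding c by simp
qed

text \<open>The edge moment is close to its conditional mean, which involves the actual
  \<open>l\<close> and not the limit \<open>l0\<close>. The passage from \<open>l\<close> to
  \<open>l0\<close> is then a multiple of \<open>l - l0\<close> with a bounded factor.\<close>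

lemma mean_target_diff:
  fixes l l0 k x :: real
  assumes "x \<ge> 3" "0 \<le> l" "l \<le> x / 2" "0 \<le> l0" "l0 \<le> x / 2"
  shows "\<bar>(l + l\<^sup>2 + k) - (l0 + l0\<^sup>2 + (x - 2) * ((x - 2) - 2 * l0))\<bar> \<le>
    5 * x * \<bar>l - l0\<bar> + \<bar>k - (x - 2) * ((x - 2) - 2 * l)\<bar>"
proof -
  have "(l + l\<^sup>2 + k) - (l0 + l0\<^sup>2 + (x - 2) * ((x - 2) - 2 * l0)) =
     (l - l0) * (1 + l + l0 - 2 * (x - 2)) + (k - (x - 2) * ((x - 2) - 2 * l))"
    by (simp add: power2_eq_square algebra_simps)
  moreover have "\<bar>(l - l0) * (1 + l + l0 - 2 * (x - 2))\<bar> \<le> \<bar>l - l0\<bar> * (5 * x)"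
    unfolding abs_mult using assms by (intro mult_left_mono) auto
  ultimately show ?thesis by (simp add: mult.commute)
qed

text \<open>Passes from second to first moments term by term, which suits weighted sums that are not
  normalised.\<close>

lemma abs_le_eps_plus_square:
  fixes x e :: real
  assumes "e > 0"
  shows "\<bar>x\<bar> \<le> e + x\<^sup>2 / e"
proof (cases "\<bar>x\<bar> \<le> e")
  case True
  then show ?thesis using assms by (simp add: add_increasing2)
next
  case False
  have "\<bar>x\<bar> * e \<le> \<bar>x\<bar> * \<bar>x\<bar>" using False by (intro mult_left_mono) auto
  then have "\<bar>x\<bar> \<le> x\<^sup>2 / e" using assms by (simp add: field_simps power2_eq_square)
  then show ?thesis using assms by simp
qed

text \<open>The limit of \<open>bad_mean\<close> for the complement of a typical spanning tree: \<open>l\<close> is the limit of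
  \<open>pair_moment V r / (2 * N)\<close>, and the last summand that of \<open>edge_moment T r / N\<close>.\<close>

definition planted_mean :: "nat \<Rightarrow> real" where
  "planted_mean d = (let l = (real d - 2)\<^sup>2 / (2 * (real d - 1)) in
     l + l\<^sup>2 + (real d - 2) * ((real d - 2) - 2 * l))"

text \<open>\<open>P\<close> is the total weight of the pairs (tree, complement) in the
  configuration model. Each pair deviates from \<open>exp (- planted_mean d)\<close> by the Poisson
  error and by the distance of its mean from the planted one; the latter is averaged first over the
  trees with equal degrees, then over the degree sequences. In the bound \<open>10 * d * e\<close>
  stems from \<open>5 * d * (e + 2 / n)\<close> with \<open>n = card V\<close>, the rest from three
  errors \<open>e\<close>.\<close>

lemma planted_estimate:
  fixes V :: "'a set"
  assumes d: "d \<ge> 3" and V: "finite V" and n: "card V \<ge> 4" and ev: "even (d * card V)" and e: "e > 0"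
    and s: "s = (d - 2) * card V + 2"
    and unif: "\<And>X r. admissible d V X r \<Longrightarrow> (\<Sum>v\<in>V. r v) \<ge> s \<Longrightarrow>
      \<bar>bad_gf V X r 1 - exp (- bad_mean V X r)\<bar> \<le> e"
    and large: "2 / real (card V) \<le> e" "(106 * real d ^ 6 + 5 * real d * real d ^ 4) / (real (card V) * e) \<le> e"
    and P: "P = matching_count s * (fact (card V - 2) / fact (d - 1) ^ card V) * real (((d - 1) * card V) choose s)"
  shows "\<bar>(\<Sum>G\<in>regular_graphs d V. real (card (spanning_trees V G))) - P * exp (- planted_mean d)\<bar> \<le>
    P * ((3 + 10 * real d) * e)"
proof -
  define m where "m = real (card V)"
  define x where "x = real d"
  define N where "N = real s"
  \<comment> \<open>There are \<open>n * (d - 1) * (d - 2)\<close> ordered pairs of points in a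
    common block, each chosen with probability about \<open>((d - 2) / (d - 1))\<^sup>2\<close>;
    this is divided by \<open>2 * N\<close> with \<open>N\<close> about
    \<open>(d - 2) * n\<close>.\<close>
  define l0 where "l0 = (x - 2)\<^sup>2 / (2 * (x - 1))"
  define \<mu> where "\<mu> = planted_mean d"
  have \<mu>: "\<mu> = l0 + l0\<^sup>2 + (x - 2) * ((x - 2) - 2 * l0)"
    by (simp add: \<mu>_def planted_mean_def l0_def x_def Let_def)
  have m: "m \<ge> 4" and x: "x \<ge> 3" using n d by (auto simp: m_def x_def)
  have Nm: "N = (x - 2) * m + 2" using d by (simp add: N_def s x_def m_def of_nat_diff)
  have "1 * m \<le> (x - 2) * m" using x m by (intro mult_right_mono) auto
  then have N: "N \<ge> m" unfolding Nm by linarith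
  have l0: "0 \<le> l0" "l0 \<le> x / 2"
  proof -
    show "0 \<le> l0" using x by (simp add: l0_def)
    show "l0 \<le> x / 2" using x by (simp add: l0_def field_simps power2_eq_square)
  qed
  have \<mu>0: "0 \<le> \<mu>"
  proof -
    have "2 * l0 \<le> x - 2" using x by (simp add: l0_def field_simps power2_eq_square)
    then show ?thesis unfolding \<mu> using l0 x by simp
  qed
  obtain j where j: "d = j + 3" using d le_Suc_ex add.commute by metis
  have es: "even s"
  proof -
    have "d * card V + 2 = s + 2 * card V" unfolding s j by (simp add: algebra_simps)
    moreover have "even (d * card V + 2)" using ev by simp
    ultimately have "even (s + 2 * card V)" by (simp only:)
    then show ?thesis by simp
  qed
  \<comment> \<open>The exact mean of the pair moment, as in
    \<open>pair_moment_concentration\<close> for \<open>k = d - 1\<close>.\<close>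
  define A where "A = m * (real (d - 1) * (real (d - 1) - 1)) *
      ((real s * (real s - 1)) / (real ((d - 1) * card V) * (real ((d - 1) * card V) - 1)))"
  have A2N: "\<bar>A / (2 * N) - l0\<bar> \<le> 2 / m"
  proof -
    define y where "y = x - 1"
    have y: "y \<ge> 2" using x by (simp add: y_def)
    have ym: "y * m \<ge> 8" using mult_mono[of 2 y 4 m] y m by simp
    have A': "A = m * (y * (y - 1)) * ((N * (N - 1)) / ((y * m) * (y * m - 1)))"
      using d by (simp add: A_def y_def x_def m_def N_def of_nat_diff)
    have "A / (2 * N) = (y - 1) * (N - 1) / (2 * (y * m - 1))"
    proof -
      have "m * (y * (y - 1)) * ((N * (N - 1)) / ((y * m) * z)) / (2 * N) = (y - 1) * (N - 1) / (2 * z)"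
        if "z > 0" for z using that y m N by (simp add: field_simps)
      from this[of "y * m - 1"] show ?thesis unfolding A' using ym by simp
    qed
    moreover have "(y - 1) * (N - 1) / (2 * z) - (y - 1)\<^sup>2 / (2 * y) = (y - 1) * (2 * y - 1) / (2 * y * z)"
      if "z > 0" "z = y * m - 1" for z
    proof -
      have N1: "y * (N - 1) = (y - 1) * z + (2 * y - 1)"
        unfolding that(2) Nm y_def by (simp add: algebra_simps)
      have "(y - 1) * (N - 1) / (2 * z) - (y - 1)\<^sup>2 / (2 * y) = (y - 1) * (y * (N - 1) - (y - 1) * z) / (2 * y * z)"
        using that(1) y by (simp add: field_simps power2_eq_square)
      then show ?thesis unfolding N1 by simp
    qed
    moreover have "l0 = (y - 1)\<^sup>2 / (2 * y)" by (simp add: l0_def y_def)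
    ultimately have eq: "A / (2 * N) - l0 = (y - 1) * (2 * y - 1) / (2 * y * (y * m - 1))" using ym by simp
    have "(y - 1) * (2 * y - 1) / (2 * y * (y * m - 1)) \<le> y * (2 * y) / (2 * y * (y * m / 2))"
    proof (rule frac_le)
      show "(y - 1) * (2 * y - 1) \<le> y * (2 * y)" using y by (intro mult_mono) auto
      have "y * m / 2 \<le> y * m - 1" using ym by linarith
      then show "2 * y * (y * m / 2) \<le> 2 * y * (y * m - 1)" using y by (intro mult_left_mono) auto
    qed (use y m in auto)
    also have "\<dots> = 2 / m" using y m by (simp add: field_simps)
    finally have "A / (2 * N) - l0 \<le> 2 / m" unfolding eq .
    moreover have "A / (2 * N) - l0 \<ge> 0" unfolding eq using y ym by simp
    ultimately show ?thesis by simp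
  qed
  let ?DS = "degree_seqs V (\<lambda>_. d - 1) s"
  let ?T = "\<lambda>r. trees_with V (\<lambda>v. d - r v) {}"
  have DS: "(\<Sum>v\<in>V. r v) = s" "\<forall>v\<in>V. r v \<le> d - 1" if "r \<in> ?DS" for r using that by (auto simp: degree_seqs_def)
  \<comment> \<open>The bound of \<open>single\<close> averaged over the trees: the squared
    deviation of the edge moment is replaced by its average bound
    \<open>106 * x ^ 6 / m\<close>.\<close>
  define B where "B r = e + 5 * x * (e + (pair_moment V r - A)\<^sup>2 / (4 * N\<^sup>2 * e) + 2 / m) + (e + 106 * x ^ 6 / m / e)" for r
  have adm: "admissible d V T r" if r: "r \<in> ?DS" and T: "T \<in> ?T r" for r T
  proof -
    have "r v \<le> d \<and> graph_degree T v \<le> d" if "v \<in> V" for v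
      using T that DS(2)[OF r] d by (auto simp: trees_with_def intro: order_trans)
    then show ?thesis using T graph_tree_subset[of V T] V es DS(1)[OF r] by (auto simp: admissible_def trees_with_def)
  qed
  have single: "\<bar>bad_gf V T r 1 - exp (- \<mu>)\<bar> \<le> e + 5 * x * (e + (pair_moment V r - A)\<^sup>2 / (4 * N\<^sup>2 * e) + 2 / m) +
      (e + (edge_moment T r / N - (x - 2) * ((x - 2) - pair_moment V r / N))\<^sup>2 / e)"
    if r: "r \<in> ?DS" and T: "T \<in> ?T r" for r T
  proof -
    have ad: "admissible d V T r" by (rule adm[OF r T])
    define l where "l = pair_moment V r / (2 * N)"
    define k where "k = edge_moment T r / N"
    have bm: "bad_mean V T r = l + l\<^sup>2 + k"
      using DS(1)[OF r] by (simp add: bad_mean_def l_def k_def N_def del: of_nat_sum)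
    have rd: "\<forall>v\<in>V. r v \<le> d" using ad by (auto simp: admissible_def)
    have lb: "0 \<le> l" "l \<le> x / 2"
    proof -
      have "0 \<le> pair_moment V r" "pair_moment V r \<le> x * N"
        using pair_moment_bounds[OF rd] DS(1)[OF r] by (auto simp: x_def N_def simp del: of_nat_sum)
      then show "0 \<le> l" "l \<le> x / 2" using N m by (auto simp: l_def field_simps)
    qed
    have "\<bar>bad_gf V T r 1 - exp (- bad_mean V T r)\<bar> \<le> e" using unif[OF ad] DS(1)[OF r] by simp
    moreover have "\<bar>exp (- bad_mean V T r) - exp (- \<mu>)\<bar> \<le> \<bar>bad_mean V T r - \<mu>\<bar>"
      using bad_mean_nonneg[OF ad] \<mu>0 by (intro exp_minus_lipschitz)
    moreover have "\<bar>bad_mean V T r - \<mu>\<bar> \<le> 5 * x * \<bar>l - l0\<bar> + \<bar>k - (x - 2) * ((x - 2) - 2 * l)\<bar>"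
      unfolding bm \<mu> by (rule mean_target_diff[OF x lb l0])
    moreover have "5 * x * \<bar>l - l0\<bar> \<le> 5 * x * (e + (pair_moment V r - A)\<^sup>2 / (4 * N\<^sup>2 * e) + 2 / m)"
    proof (rule mult_left_mono)
      have "\<bar>l - A / (2 * N)\<bar> \<le> e + (l - A / (2 * N))\<^sup>2 / e" by (rule abs_le_eps_plus_square[OF e])
      also have "(l - A / (2 * N))\<^sup>2 / e = (pair_moment V r - A)\<^sup>2 / (4 * N\<^sup>2 * e)"
        by (simp add: l_def diff_divide_distrib[symmetric] power_divide power_mult_distrib)
      finally show "\<bar>l - l0\<bar> \<le> e + (pair_moment V r - A)\<^sup>2 / (4 * N\<^sup>2 * e) + 2 / m" using A2N by linarith
    qed (use x in auto)
    moreover have "\<bar>k - (x - 2) * ((x - 2) - 2 * l)\<bar> \<le> e + (k - (x - 2) * ((x - 2) - 2 * l))\<^sup>2 / e"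
      by (rule abs_le_eps_plus_square[OF e])
    moreover have l2: "pair_moment V r / N = 2 * l" by (simp add: l_def)
    ultimately show ?thesis unfolding k_def[symmetric] l2 by linarith
  qed
  have inner: "(\<Sum>T\<in>?T r. \<bar>bad_gf V T r 1 - exp (- \<mu>)\<bar>) \<le> real (card (?T r)) * B r" if r: "r \<in> ?DS" for r
  proof -
    define c where "c = e + 5 * x * (e + (pair_moment V r - A)\<^sup>2 / (4 * N\<^sup>2 * e) + 2 / m) + e"
    define q where "q T = (edge_moment T r / N - (x - 2) * ((x - 2) - pair_moment V r / N))\<^sup>2" for T
    have "(\<Sum>T\<in>?T r. \<bar>bad_gf V T r 1 - exp (- \<mu>)\<bar>) \<le> (\<Sum>T\<in>?T r. c + q T / e)"
    proof (rule sum_mono)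
      fix T assume "T \<in> ?T r"
      from single[OF r this] show "\<bar>bad_gf V T r 1 - exp (- \<mu>)\<bar> \<le> c + q T / e" unfolding c_def q_def by linarith
    qed
    also have "\<dots> = real (card (?T r)) * c + (\<Sum>T\<in>?T r. q T) / e"
      by (simp add: sum.distrib sum_divide_distrib)
    also have "(\<Sum>T\<in>?T r. q T) \<le> real (card (?T r)) * (106 * x ^ 6 / m)"
      unfolding q_def x_def m_def N_def
      using tree_edge_moment_concentration[OF V n d DS(2)[OF r]] DS(1)[OF r] by (simp add: s)
    finally have "(\<Sum>T\<in>?T r. \<bar>bad_gf V T r 1 - exp (- \<mu>)\<bar>) \<le>
       real (card (?T r)) * c + real (card (?T r)) * (106 * x ^ 6 / m) / e"
      using e by (simp add: divide_right_mono)
    also have "\<dots> = real (card (?T r)) * B r" by (simp add: B_def c_def algebra_simps)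
    finally show ?thesis .
  qed
  define M where "M = matching_count s"
  define F where "F = fact (card V - 2) / (fact (d - 1) ^ card V :: real)"
  define Q where "Q = real (((d - 1) * card V) choose s)"
  have MF: "M > 0" "F > 0" by (auto simp: M_def F_def matching_count_pos)
  have w: "real (card (?T r)) / (\<Prod>v\<in>V. fact (r v)) = F * seq_weight V (\<lambda>_. d - 1) r" if r: "r \<in> ?DS" for r
    unfolding F_def by (rule card_trees_with_weight[OF V]) (use n d r s in auto)
  have count: "real (card {E \<in> simple_graphs V. E \<inter> T = {} \<and> (\<forall>v\<in>V. graph_degree E v = r v)}) =
      M / (\<Prod>v\<in>V. fact (r v)) * bad_gf V T r 1" if r: "r \<in> ?DS" and T: "T \<in> ?T r" for r T
    using card_simple_graphs_avoiding_eq[OF V, of T r] adm[OF r T] DS(1)[OF r] by (simp add: M_def admissible_def)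
  have seqQ: "seq_sum V (\<lambda>_. d - 1) s (\<lambda>_. 1) = Q"
    unfolding seq_sum_one[OF V] Q_def by (simp add: mult.commute)
  have PQ: "P = M * F * Q" by (simp add: P M_def F_def Q_def)
  have tot: "(\<Sum>r\<in>?DS. M / (\<Prod>v\<in>V. fact (r v)) * real (card (?T r)) * g r) = M * F * seq_sum V (\<lambda>_. d - 1) s g" for g
    unfolding seq_sum_def sum_distrib_left
  proof (rule sum.cong[OF refl])
    fix r assume "r \<in> ?DS"
    have "M / (\<Prod>v\<in>V. fact (r v)) * real (card (?T r)) * g r = M * (real (card (?T r)) / (\<Prod>v\<in>V. fact (r v))) * g r" by simp
    also have "\<dots> = M * F * (seq_weight V (\<lambda>_. d - 1) r * g r)" unfolding w[OF \<open>r \<in> ?DS\<close>] by simp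
    finally show "M / (\<Prod>v\<in>V. fact (r v)) * real (card (?T r)) * g r = M * F * (seq_weight V (\<lambda>_. d - 1) r * g r)" .
  qed
  have "(\<Sum>G\<in>regular_graphs d V. real (card (spanning_trees V G))) =
     (\<Sum>r\<in>?DS. \<Sum>T\<in>?T r. M / (\<Prod>v\<in>V. fact (r v)) * bad_gf V T r 1)"
    using count n d by (subst sum_card_spanning_trees[OF V _ _ s]) auto
  moreover have "P * exp (- \<mu>) = (\<Sum>r\<in>?DS. \<Sum>T\<in>?T r. M / (\<Prod>v\<in>V. fact (r v)) * exp (- \<mu>))"
  proof -
    have "P * exp (- \<mu>) = M * F * seq_sum V (\<lambda>_. d - 1) s (\<lambda>_. exp (- \<mu>) * 1)"
      unfolding seq_sum_cmult seqQ PQ by simp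
    also have "\<dots> = (\<Sum>r\<in>?DS. M / (\<Prod>v\<in>V. fact (r v)) * real (card (?T r)) * (exp (- \<mu>) * 1))" by (rule tot[symmetric])
    also have "\<dots> = (\<Sum>r\<in>?DS. \<Sum>T\<in>?T r. M / (\<Prod>v\<in>V. fact (r v)) * exp (- \<mu>))"
      by (intro sum.cong refl) (simp add: mult_ac)
    finally show ?thesis .
  qed
  ultimately have diff: "(\<Sum>G\<in>regular_graphs d V. real (card (spanning_trees V G))) - P * exp (- \<mu>) =
     (\<Sum>r\<in>?DS. \<Sum>T\<in>?T r. M / (\<Prod>v\<in>V. fact (r v)) * (bad_gf V T r 1 - exp (- \<mu>)))"
    by (simp add: right_diff_distrib sum_subtractf)
  have pf: "(\<Prod>v\<in>V. fact (r v) :: real) > 0" for r :: "'a \<Rightarrow> nat" by (intro prod_pos) auto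
  have "\<bar>(\<Sum>G\<in>regular_graphs d V. real (card (spanning_trees V G))) - P * exp (- \<mu>)\<bar> \<le>
     (\<Sum>r\<in>?DS. \<bar>\<Sum>T\<in>?T r. M / (\<Prod>v\<in>V. fact (r v)) * (bad_gf V T r 1 - exp (- \<mu>))\<bar>)"
    unfolding diff by (rule sum_abs)
  also have "\<dots> \<le> (\<Sum>r\<in>?DS. M / (\<Prod>v\<in>V. fact (r v)) * real (card (?T r)) * B r)"
  proof (rule sum_mono)
    fix r assume r: "r \<in> ?DS"
    have "\<bar>\<Sum>T\<in>?T r. M / (\<Prod>v\<in>V. fact (r v)) * (bad_gf V T r 1 - exp (- \<mu>))\<bar> =
       M / (\<Prod>v\<in>V. fact (r v)) * \<bar>\<Sum>T\<in>?T r. bad_gf V T r 1 - exp (- \<mu>)\<bar>"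
      unfolding sum_distrib_left[symmetric] abs_mult using MF pf[of r] by simp
    also have "\<dots> \<le> M / (\<Prod>v\<in>V. fact (r v)) * (\<Sum>T\<in>?T r. \<bar>bad_gf V T r 1 - exp (- \<mu>)\<bar>)"
      using MF pf[of r] by (intro mult_left_mono sum_abs) auto
    also have "\<dots> \<le> M / (\<Prod>v\<in>V. fact (r v)) * (real (card (?T r)) * B r)"
      using MF pf[of r] by (intro mult_left_mono inner[OF r]) auto
    finally show "\<bar>\<Sum>T\<in>?T r. M / (\<Prod>v\<in>V. fact (r v)) * (bad_gf V T r 1 - exp (- \<mu>))\<bar> \<le>
       M / (\<Prod>v\<in>V. fact (r v)) * real (card (?T r)) * B r" by (simp add: mult.assoc)
  qed
  also have "\<dots> = M * F * seq_sum V (\<lambda>_. d - 1) s B" by (rule tot)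
  also have "\<dots> \<le> M * F * (Q * ((3 + 10 * x) * e))"
  proof (rule mult_left_mono)
    \<comment> \<open>\<open>c\<close> is the part of \<open>B\<close> that does not depend on
      \<open>r\<close>, and \<open>b\<close> the coefficient of the squared deviation. The average
      of the latter is of order \<open>m\<close>, while \<open>b\<close> is of order 1 / m^2 because
      \<open>N \<ge> m\<close>.\<close>
    define c where "c = e + 5 * x * (e + 2 / m) + (e + 106 * x ^ 6 / m / e)"
    define b where "b = 5 * x / (4 * N\<^sup>2 * e)"
    have Bc: "B = (\<lambda>r. c * 1 + b * (pair_moment V r - A)\<^sup>2)"
      by (rule ext) (simp add: B_def c_def b_def algebra_simps)
    have "seq_sum V (\<lambda>_. d - 1) s B = c * Q + b * seq_sum V (\<lambda>_. d - 1) s (\<lambda>r. (pair_moment V r - A)\<^sup>2)"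
      unfolding Bc seq_sum_add seq_sum_cmult seqQ ..
    also have "\<dots> \<le> c * Q + b * (Q * (m * x ^ 4))"
    proof (intro add_left_mono mult_left_mono)
      have "seq_sum V (\<lambda>_. d - 1) s (\<lambda>r. (pair_moment V r - A)\<^sup>2) \<le> Q * (real (card V) * real (d - 1) ^ 4)"
        unfolding Q_def
      proof (rule pair_moment_concentration[OF V])
        show "2 \<le> d - 1" using d by simp
        have "card V * 1 \<le> card V * (d - 2)" using d by (intro mult_left_mono) auto
        then show "4 \<le> s" using n mult.commute[of "card V" "d - 2"] unfolding s by linarith
        have "(d - 1) * card V = (d - 2) * card V + card V" unfolding j by (simp add: algebra_simps)
        then show "s \<le> (d - 1) * card V" using n unfolding s by simp
      qed (simp add: A_def m_def)
      also have "\<dots> \<le> Q * (m * x ^ 4)"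
        unfolding m_def x_def Q_def by (intro mult_left_mono power_mono) auto
      finally show "seq_sum V (\<lambda>_. d - 1) s (\<lambda>r. (pair_moment V r - A)\<^sup>2) \<le> Q * (m * x ^ 4)" .
    qed (use x e in \<open>auto simp: b_def\<close>)
    also have "\<dots> = Q * (c + b * m * x ^ 4)" by (simp add: algebra_simps)
    also have "\<dots> \<le> Q * ((3 + 10 * x) * e)"
    proof (rule mult_left_mono)
      have "b * m \<le> 5 * x / (m * e)"
      proof -
        have "m * m \<le> N * N" using N m by (intro mult_mono) auto
        also have "\<dots> \<le> 4 * N\<^sup>2" by (simp add: power2_eq_square)
        finally have "5 * x * m / (4 * N\<^sup>2 * e) \<le> 5 * x * m / (m * m * e)"
          using x m e N by (intro divide_left_mono mult_right_mono mult_pos_pos) auto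
        then show ?thesis using m by (simp add: b_def)
      qed
      then have "b * m * x ^ 4 \<le> 5 * x / (m * e) * x ^ 4" using x by (intro mult_right_mono) auto
      then have "106 * x ^ 6 / m / e + b * m * x ^ 4 \<le> (106 * x ^ 6 + 5 * x * x ^ 4) / (m * e)"
        by (simp add: add_divide_distrib)
      also have "\<dots> \<le> e" using large(2) by (simp add: x_def m_def)
      finally have 1: "106 * x ^ 6 / m / e + b * m * x ^ 4 \<le> e" .
      have "5 * x * (e + 2 / m) \<le> 5 * x * (e + e)" using large(1) x by (intro mult_left_mono) (auto simp: m_def)
      then show "c + b * m * x ^ 4 \<le> (3 + 10 * x) * e" unfolding c_def using 1 by (simp add: algebra_simps)
    qed (simp add: Q_def)
    finally show "seq_sum V (\<lambda>_. d - 1) s B \<le> Q * ((3 + 10 * x) * e)" .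
  qed (use MF in auto)
  also have "\<dots> = P * ((3 + 10 * real d) * e)" by (simp add: PQ x_def)
  finally show ?thesis unfolding \<mu>_def .
qed

section \<open>Limits of the two counts and their quotient\<close>

lemma card_regular_graphs_eq:
  assumes V: "finite V" and ev: "even (d * card V)"
  shows "real (card (regular_graphs d V)) =
    matching_count (d * card V) / fact d ^ card V * bad_gf V {} (\<lambda>_. d) 1"
proof -
  have "regular_graphs d V = {E \<in> simple_graphs V. E \<inter> {} = {} \<and> (\<forall>v\<in>V. graph_degree E v = d)}"
    by (auto simp: regular_graphs_def)
  then show ?thesis
    using card_simple_graphs_avoiding_eq[OF V, of "{}" "\<lambda>_. d"] ev by (simp add: mult.commute)
qed

text \<open>With equal degrees \<lambda> is \<open>(d - 1) / 2\<close>. The value is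
  \<open>(d\<^sup>2 - 1) / 4\<close>, the familiar exponent for a random matching to give a simple
  graph.\<close>

lemma bad_mean_regular:
  assumes "finite V" "V \<noteq> {}" "d \<ge> 1"
  shows "bad_mean V {} (\<lambda>_. d) = (real d - 1) / 2 + ((real d - 1) / 2)\<^sup>2"
proof -
  have "card V > 0" using assms by (simp add: card_gt_0_iff)
  then have l: "pair_moment V (\<lambda>_. d) / (2 * real (\<Sum>v\<in>V. d)) = (real d - 1) / 2"
    using assms(3) by (simp add: pair_moment_def)
  show ?thesis unfolding bad_mean_def l by (simp add: edge_moment_def)
qed

lemma planted_limit:
  assumes d: "d \<ge> 3"
  defines "Fl \<equiv> inf at_top (principal {n::nat. odd d \<longrightarrow> even n})"
  shows "((\<lambda>n. (\<Sum>G\<in>regular_graphs d {1..n}. real (card (spanning_trees {1..n} G))) /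
     (matching_count ((d - 2) * n + 2) * (fact (n - 2) / fact (d - 1) ^ n) * real (((d - 1) * n) choose ((d - 2) * n + 2))))
     \<longlongrightarrow> exp (- planted_mean d)) Fl"
proof (rule tendstoI)
  fix \<epsilon> :: real assume \<epsilon>: "\<epsilon> > 0"
  \<comment> \<open>Chosen so that the bound of \<open>planted_estimate\<close>, relative to
    \<open>P\<close>, becomes \<epsilon> / 2.\<close>
  define e where "e = \<epsilon> / 2 / (3 + 10 * real d)"
  have e: "e > 0" using \<epsilon> by (simp add: e_def add_pos_nonneg)
  have ee: "(3 + 10 * real d) * e < \<epsilon>"
  proof -
    have "y * (\<epsilon> / 2 / y) = \<epsilon> / 2" if "y > 0" for y :: real using that by simp
    from this[of "3 + 10 * real d"] have "(3 + 10 * real d) * e = \<epsilon> / 2"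
      unfolding e_def by (simp add: add_pos_nonneg)
    then show ?thesis using \<epsilon> by simp
  qed
  obtain N0 where N0: "\<And>(V::nat set) X r. admissible d V X r \<Longrightarrow> (\<Sum>v\<in>V. r v) \<ge> N0 \<Longrightarrow>
    \<bar>bad_gf V X r 1 - exp (- bad_mean V X r)\<bar> \<le> e"
    using bad_gf_one_limit[of d e, where ?'a = nat] d e by (meson le_trans one_le_numeral)
  have "eventually (\<lambda>n. 2 / real n < e) at_top"
    by (rule order_tendstoD(2)[OF lim_const_over_n e])
  moreover have "eventually (\<lambda>n. (106 * real d ^ 6 + 5 * real d * real d ^ 4) / e / real n < e) at_top"
    by (rule order_tendstoD(2)[OF lim_const_over_n e])
  moreover have "eventually (\<lambda>n. n \<ge> N0 + 4) at_top" by (rule eventually_ge_at_top)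
  ultimately have "eventually (\<lambda>n. n \<in> {n. odd d \<longrightarrow> even n} \<longrightarrow>
     dist ((\<Sum>G\<in>regular_graphs d {1..n}. real (card (spanning_trees {1..n} G))) /
     (matching_count ((d - 2) * n + 2) * (fact (n - 2) / fact (d - 1) ^ n) * real (((d - 1) * n) choose ((d - 2) * n + 2))))
     (exp (- planted_mean d)) < \<epsilon>) at_top"
  proof eventually_elim
    case (elim n)
    show ?case
    proof
      assume "n \<in> {n. odd d \<longrightarrow> even n}"
      then have ev: "even (d * n)" by auto
      define P where "P = matching_count ((d - 2) * n + 2) * (fact (n - 2) / fact (d - 1) ^ n) * real (((d - 1) * n) choose ((d - 2) * n + 2))"
      define S where "S = (\<Sum>G\<in>regular_graphs d {1..n}. real (card (spanning_trees {1..n} G)))"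
      have "1 * n \<le> (d - 2) * n" using d by (intro mult_right_mono) auto
      then have sN: "(d - 2) * n + 2 \<ge> N0" using elim by linarith
      have "\<bar>S - P * exp (- planted_mean d)\<bar> \<le> P * ((3 + 10 * real d) * e)"
        unfolding S_def
      proof (rule planted_estimate[OF d _ _ _ e refl])
        show "card {1..n} \<ge> 4" "even (d * card {1..n})" "finite {1..n}" using elim ev by auto
        show "2 / real (card {1..n}) \<le> e" using elim by simp
        show "(106 * real d ^ 6 + 5 * real d * real d ^ 4) / (real (card {1..n}) * e) \<le> e"
          using elim by (simp add: mult.commute)
        show "\<bar>bad_gf {1..n} X r 1 - exp (- bad_mean {1..n} X r)\<bar> \<le> e"
          if "admissible d {1..n} X r" "(d - 2) * card {1..n} + 2 \<le> (\<Sum>v\<in>{1..n}. r v)" for X r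
          using N0[OF that(1)] that(2) sN by simp
      qed (simp add: P_def)
      moreover have P: "P > 0"
      proof -
        obtain j where j: "d = j + 3" using d le_Suc_ex add.commute by metis
        have "(d - 2) * n + 2 \<le> (d - 1) * n" using elim unfolding j by (simp add: algebra_simps)
        then show ?thesis unfolding P_def by (simp add: matching_count_pos zero_less_binomial_iff)
      qed
      ultimately have "\<bar>S / P - exp (- planted_mean d)\<bar> \<le> (3 + 10 * real d) * e"
      proof -
        assume a: "\<bar>S - P * exp (- planted_mean d)\<bar> \<le> P * ((3 + 10 * real d) * e)" and "P > 0"
        have "S / P - exp (- planted_mean d) = (S - P * exp (- planted_mean d)) / P" using P by (simp add: field_simps)
        then have "\<bar>S / P - exp (- planted_mean d)\<bar> = \<bar>S - P * exp (- planted_mean d)\<bar> / P" using P by (simp add: abs_divide)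
        also have "\<dots> \<le> P * ((3 + 10 * real d) * e) / P" using a P by (intro divide_right_mono) auto
        finally show ?thesis using P by simp
      qed
      then show "dist ((\<Sum>G\<in>regular_graphs d {1..n}. real (card (spanning_trees {1..n} G))) /
         (matching_count ((d - 2) * n + 2) * (fact (n - 2) / fact (d - 1) ^ n) * real (((d - 1) * n) choose ((d - 2) * n + 2))))
         (exp (- planted_mean d)) < \<epsilon>"
        using ee unfolding P_def S_def dist_real_def by linarith
    qed
  qed
  then show "eventually (\<lambda>n. dist ((\<Sum>G\<in>regular_graphs d {1..n}. real (card (spanning_trees {1..n} G))) /
     (matching_count ((d - 2) * n + 2) * (fact (n - 2) / fact (d - 1) ^ n) * real (((d - 1) * n) choose ((d - 2) * n + 2))))
     (exp (- planted_mean d)) < \<epsilon>) Fl"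
    unfolding Fl_def eventually_inf_principal .
qed

text \<open>The limit is positive, which also yields the existence of \<open>d\<close>-regular
  graphs for all large \<open>n\<close> of the right parity.\<close>

lemma regular_limit:
  assumes d: "d \<ge> 1"
  defines "Fl \<equiv> inf at_top (principal {n::nat. odd d \<longrightarrow> even n})"
  shows "((\<lambda>n. real (card (regular_graphs d {1..n})) / (matching_count (d * n) / fact d ^ n))
     \<longlongrightarrow> exp (- ((real d - 1) / 2 + ((real d - 1) / 2)\<^sup>2))) Fl"
proof (rule tendstoI)
  fix \<epsilon> :: real assume \<epsilon>: "\<epsilon> > 0"
  obtain N0 where N0: "\<And>(V::nat set) X r. admissible d V X r \<Longrightarrow> (\<Sum>v\<in>V. r v) \<ge> N0 \<Longrightarrow>
    \<bar>bad_gf V X r 1 - exp (- bad_mean V X r)\<bar> \<le> \<epsilon> / 2"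
    using bad_gf_one_limit[of d "\<epsilon> / 2", where ?'a = nat] d \<epsilon> by (meson half_gt_zero)
  have "eventually (\<lambda>n. n \<ge> N0 + 1) at_top" by (rule eventually_ge_at_top)
  then have "eventually (\<lambda>n. n \<in> {n. odd d \<longrightarrow> even n} \<longrightarrow>
     dist (real (card (regular_graphs d {1..n})) / (matching_count (d * n) / fact d ^ n))
     (exp (- ((real d - 1) / 2 + ((real d - 1) / 2)\<^sup>2))) < \<epsilon>) at_top"
  proof eventually_elim
    case (elim n)
    show ?case
    proof
      assume "n \<in> {n. odd d \<longrightarrow> even n}"
      then have ev: "even (d * n)" by auto
      let ?V = "{1..n}"
      have "admissible d ?V {} (\<lambda>_. d)" using ev by (simp add: admissible_def graph_degree_def mult.commute)
      moreover have "(\<Sum>v\<in>?V. d) \<ge> N0"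
      proof -
        have "n * 1 \<le> n * d" using d by (intro mult_left_mono) auto
        moreover have "(\<Sum>v\<in>?V. d) = n * d" by simp
        ultimately show ?thesis using elim by linarith
      qed
      ultimately have "\<bar>bad_gf ?V {} (\<lambda>_. d) 1 - exp (- bad_mean ?V {} (\<lambda>_. d))\<bar> \<le> \<epsilon> / 2" by (rule N0)
      moreover have "bad_mean ?V {} (\<lambda>_. d) = (real d - 1) / 2 + ((real d - 1) / 2)\<^sup>2"
        using elim d by (intro bad_mean_regular) auto
      moreover have "real (card (regular_graphs d ?V)) / (matching_count (d * n) / fact d ^ n) = bad_gf ?V {} (\<lambda>_. d) 1"
        using card_regular_graphs_eq[of ?V d] ev matching_count_pos[of "d * n"] by simp
      ultimately show "dist (real (card (regular_graphs d {1..n})) / (matching_count (d * n) / fact d ^ n))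
         (exp (- ((real d - 1) / 2 + ((real d - 1) / 2)\<^sup>2))) < \<epsilon>"
        using \<epsilon> unfolding dist_real_def by simp
    qed
  qed
  then show "eventually (\<lambda>n. dist (real (card (regular_graphs d {1..n})) / (matching_count (d * n) / fact d ^ n))
     (exp (- ((real d - 1) / 2 + ((real d - 1) / 2)\<^sup>2))) < \<epsilon>) Fl"
    unfolding Fl_def eventually_inf_principal .
qed

text \<open>\<open>p\<close> is the number of edges of the regular graph and \<open>h + 1\<close>
  that of the complement of a tree. Choosing \<open>2 * (h + 1)\<close> of the
  \<open>(d - 1) * n\<close> points leaves \<open>n - 2\<close>, so both factorials in the binomial
  coefficient cancel against the matching and tree counts.\<close>

lemma planted_over_regular_count:
  fixes d n p h :: nat
  assumes d: "d \<ge> 3" and n: "n \<ge> 2" and p: "2 * p = d * n" and h: "h + n = p"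
  shows "matching_count ((d - 2) * n + 2) * (fact (n - 2) / fact (d - 1) ^ n) * real (((d - 1) * n) choose ((d - 2) * n + 2)) /
     (matching_count (d * n) / fact d ^ n) =
    real d ^ n * 2 ^ n / 2 * (fact ((d - 1) * n) * fact p / (fact (h + 1) * fact (2 * p)))"
proof -
  obtain j where j: "d = j + 3" using d le_Suc_ex add.commute by metis
  define s where "s = (d - 2) * n + 2"
  have s: "s = 2 * (h + 1)"
  proof -
    have "d * n = (d - 2) * n + 2 * n" unfolding j by (simp add: algebra_simps)
    moreover have "b + 2 = 2 * (h + 1)" if "a = b + 2 * n" "2 * p = a" for a b :: nat using that h by presburger
    ultimately show ?thesis using p unfolding s_def by blast
  qed
  have Ds: "(d - 1) * n = s + (n - 2)" unfolding s_def j using n by (simp add: algebra_simps)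
  have ch: "real (((d - 1) * n) choose s) = fact ((d - 1) * n) / (fact s * fact (n - 2))"
    using binomial_fact[of s "(d - 1) * n", where ?'a = real] unfolding Ds by simp
  have ms: "matching_count s = fact s / (2 ^ (h + 1) * fact (h + 1))" unfolding s matching_count_def by simp
  have mp: "matching_count (d * n) = fact (2 * p) / (2 ^ p * fact p)" unfolding p[symmetric] matching_count_def by simp
  have fd: "(fact d :: real) = real d * fact (d - 1)" using d by (simp add: fact_reduce)
  have pw: "(2 :: real) ^ p = 2 ^ (h + 1) * (2 ^ n / 2)" unfolding h[symmetric] by (simp add: power_add)
  have "matching_count s * (fact (n - 2) / fact (d - 1) ^ n) * real (((d - 1) * n) choose s) / (matching_count (d * n) / fact d ^ n) =
     fact s / (2 ^ (h + 1) * fact (h + 1)) * (fact (n - 2) / fact (d - 1) ^ n) * (fact ((d - 1) * n) / (fact s * fact (n - 2))) /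
      (fact (2 * p) / ((2 ^ (h + 1) * (2 ^ n / 2)) * fact p) / (real d ^ n * fact (d - 1) ^ n))"
    unfolding ch ms mp fd pw power_mult_distrib ..
  also have "\<dots> = real d ^ n * 2 ^ n / 2 * (fact ((d - 1) * n) * fact p / (fact (h + 1) * fact (2 * p)))"
  proof -
    have "a / (b * c) * (g / k) * (D / (a * g)) / (q / ((b * z) * y) / (x * k)) = x * z * (D * y / (c * q))"
      if "a > 0" "b > 0" "g > 0" "k > 0" for a b c g k D q z y x :: real
      using that by (simp add: field_simps)
    from this[of "fact s" "2 ^ (h + 1)" "fact (n - 2)" "fact (d - 1) ^ n"] show ?thesis by (simp add: mult_ac)
  qed
  finally show ?thesis unfolding s_def .
qed

text \<open>The probabilities are divided, so the exponent is the Poisson mean of the regular graph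
  minus that of the complement of a typical tree.\<close>

lemma mean_difference:
  fixes d :: nat
  assumes "d \<ge> 3"
  shows "((real d - 1) / 2 + ((real d - 1) / 2)\<^sup>2) - planted_mean d =
    (6 * real d ^ 2 - 14 * real d + 7) / (4 * (real d - 1) ^ 2)"
proof -
  define y where "y = real d - 1"
  have y: "y > 0" "real d = y + 1" using assms by (auto simp: y_def)
  show ?thesis unfolding planted_mean_def Let_def y(2) using y(1)
    by (simp add: field_simps power2_eq_square)
qed

theorem theorem1p1:
  fixes d :: nat
  assumes "d \<ge> 3"
  shows "(\<lambda>n. expected_spanning_trees d n)
    \<sim>[inf at_top (principal {n. odd d \<longrightarrow> even n})]
    (\<lambda>n. exp ((6 * real d ^ 2 - 14 * real d + 7) / (4 * (real d - 1) ^ 2))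
       * ((real d - 1) powr (1/2) / (real n * (real d - 2) powr (3/2)))
       * ((real d - 1) ^ (d - 1) / (real d ^ 2 - 2 * real d) powr (real d / 2 - 1)) ^ n)"
proof (rule asymp_equivI')
  let ?F = "inf at_top (principal {n::nat. odd d \<longrightarrow> even n})"
  define num where "num n = (\<Sum>G\<in>regular_graphs d {1..n}. real (card (spanning_trees {1..n} G)))" for n :: nat
  define den where "den n = real (card (regular_graphs d {1..n}))" for n :: nat
  define P where "P n = matching_count ((d - 2) * n + 2) * (fact (n - 2) / fact (d - 1) ^ n) * real (((d - 1) * n) choose ((d - 2) * n + 2))" for n :: nat
  define Pd where "Pd n = matching_count (d * n) / (fact d ^ n :: real)" for n :: nat
  define T where "T n = (real d - 1) powr (1/2) / (real n * (real d - 2) powr (3/2))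
       * ((real d - 1) ^ (d - 1) / (real d ^ 2 - 2 * real d) powr (real d / 2 - 1)) ^ n" for n :: nat
  define c where "c = (6 * real d ^ 2 - 14 * real d + 7) / (4 * (real d - 1) ^ 2)"
  define p where "p n = d * n div 2" for n :: nat
  define h where "h n = d * n div 2 - n" for n :: nat
  \<comment> \<open>Dividing the two counts by their main terms \<open>P\<close> and
    \<open>Pd\<close> leaves convergent probabilities, and \<open>P n / Pd n\<close> is exactly
    \<open>T n * \<rho> n\<close>. The correction \<rho> collects the Stirling ratios and the factor
    \<open>h / (h + 1)\<close>, and tends to 1.\<close>
  define \<rho> where "\<rho> n = (stirling_ratio ((d - 1) * n) * stirling_ratio (p n) / (stirling_ratio (h n) * stirling_ratio (2 * p n))) *
     (real (h n) / (real (h n) + 1))" for n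
  have le: "?F \<le> at_top" by simp
  have lim_num: "((\<lambda>n. num n / P n) \<longlongrightarrow> exp (- planted_mean d)) ?F"
    unfolding num_def P_def by (rule planted_limit[OF assms])
  have lim_den: "((\<lambda>n. den n / Pd n) \<longlongrightarrow> exp (- ((real d - 1) / 2 + ((real d - 1) / 2)\<^sup>2))) ?F"
    unfolding den_def Pd_def using assms by (intro regular_limit) auto
  have dn: "d * n \<ge> 3 * n" for n using assms by (intro mult_right_mono) auto
  have inf_h: "filterlim h at_top at_top"
  proof (rule filterlim_at_top_mono[of "\<lambda>n. n div 2"])
    show "filterlim (\<lambda>n::nat. n div 2) at_top at_top"
      by (rule filterlim_at_top_div_const_nat) simp
    show "eventually (\<lambda>n. n div 2 \<le> h n) at_top"
    proof (intro always_eventually allI)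
      fix n
      have "3 * n div 2 \<le> d * n div 2" using dn by (rule div_le_mono)
      moreover have "n div 2 + n \<le> 3 * n div 2" by linarith
      ultimately show "n div 2 \<le> h n" unfolding h_def by linarith
    qed
  qed
  have inf_p: "filterlim p at_top at_top"
    by (rule filterlim_at_top_mono[OF inf_h]) (auto simp: p_def h_def)
  have inf_2p: "filterlim (\<lambda>n. 2 * p n) at_top at_top"
    by (rule filterlim_at_top_mono[OF inf_p]) auto
  have inf_D: "filterlim (\<lambda>n. (d - 1) * n) at_top at_top"
  proof (rule filterlim_at_top_mono[OF filterlim_ident])
    have "1 * n \<le> (d - 1) * n" for n using assms by (intro mult_right_mono) auto
    then show "eventually (\<lambda>n. n \<le> (d - 1) * n) at_top" by simp
  qed
  obtain C where C: "C > 0" "stirling_ratio \<longlonglongrightarrow> C" using stirling_ratio_limit by blast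
  have "(\<lambda>n. real (h n) / (real (h n) + 1)) \<longlonglongrightarrow> 1"
  proof -
    have "(\<lambda>m. real m / (real m + 1)) \<longlonglongrightarrow> 1" by real_asymp
    from filterlim_compose[OF this inf_h] show ?thesis .
  qed
  then have "\<rho> \<longlonglongrightarrow> (C * C / (C * C)) * 1"
    unfolding \<rho>_def using C(1)
    by (intro tendsto_intros filterlim_compose[OF C(2)] inf_D inf_p inf_h inf_2p) auto
  then have lim_\<rho>: "(\<rho> \<longlongrightarrow> 1) ?F" using C(1) by (intro tendsto_mono[OF le]) simp
  have "((\<lambda>n. (num n / P n) / (den n / Pd n) * \<rho> n / exp c) \<longlongrightarrow>
     exp (- planted_mean d) / exp (- ((real d - 1) / 2 + ((real d - 1) / 2)\<^sup>2)) * 1 / exp c) ?F"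
    by (intro tendsto_intros lim_num lim_den lim_\<rho>) auto
  also have "exp (- planted_mean d) / exp (- ((real d - 1) / 2 + ((real d - 1) / 2)\<^sup>2)) * 1 / exp c = 1"
    unfolding c_def mean_difference[OF assms, symmetric] by (simp flip: exp_diff)
  finally have lim: "((\<lambda>n. (num n / P n) / (den n / Pd n) * \<rho> n / exp c) \<longlongrightarrow> 1) ?F" .
  \<comment> \<open>A positive count makes the set of regular graphs nonempty, so that
    \<open>pmf_of_set\<close> is the uniform distribution for these \<open>n\<close>.\<close>
  have "eventually (\<lambda>n. den n / Pd n > 0) ?F"
    by (rule order_tendstoD(1)[OF lim_den]) simp
  moreover have "eventually (\<lambda>n. n \<ge> 2 \<and> even (d * n)) ?F"
    unfolding eventually_inf_principal using eventually_ge_at_top[of 2] by (rule eventually_mono) auto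
  ultimately have ev: "eventually (\<lambda>n. (num n / P n) / (den n / Pd n) * \<rho> n / exp c =
     expected_spanning_trees d n / (exp c * T n)) ?F"
  proof eventually_elim
    case (elim n)
    have "den n \<noteq> 0" using elim(1) by auto
    then have ne: "regular_graphs d {1..n} \<noteq> {}" by (auto simp: den_def)
    have EY: "expected_spanning_trees d n = num n / den n"
      unfolding expected_spanning_trees_def random_regular_graph_def num_def den_def
      by (rule integral_pmf_of_set[OF ne]) (simp add: finite_regular_graphs)
    have p2: "2 * p n = d * n" using elim(2) by (simp add: p_def)
    have hp: "h n + n = p n"
    proof -
      have "3 * n \<le> 2 * p n" unfolding p2 by (rule dn)
      then show ?thesis unfolding h_def p_def by linarith
    qed
    have n0: "n > 0" "n \<ge> 2" using elim by auto
    have "P n / Pd n = T n * \<rho> n"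
      unfolding P_def Pd_def T_def \<rho>_def
      using planted_over_regular_count[OF assms n0(2) p2 hp] stirling_identity[OF assms n0(1) p2 hp refl]
      by (simp only: mult.assoc)
    moreover have "Pd n > 0" unfolding Pd_def by (simp add: matching_count_pos)
    moreover have "P n \<noteq> 0"
    proof -
      obtain j where j: "d = j + 3" using assms le_Suc_ex add.commute by metis
      have "(d - 2) * n + 2 \<le> (d - 1) * n" using n0 unfolding j by (simp add: algebra_simps)
      then have "P n > 0" unfolding P_def by (simp add: matching_count_pos zero_less_binomial_iff)
      then show ?thesis by simp
    qed
    moreover have "T n > 0" unfolding T_def
    proof -
      have "real d ^ 2 - 2 * real d = real d * (real d - 2)" by (simp add: power2_eq_square algebra_simps)
      then show "(real d - 1) powr (1/2) / (real n * (real d - 2) powr (3/2))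
       * ((real d - 1) ^ (d - 1) / (real d ^ 2 - 2 * real d) powr (real d / 2 - 1)) ^ n > 0"
        using assms n0 by simp
    qed
    ultimately have "\<rho> n = P n / Pd n / T n" by simp
    then have "(num n / P n) / (den n / Pd n) * \<rho> n / exp c = num n / den n / (exp c * T n)"
      using \<open>Pd n > 0\<close> \<open>P n \<noteq> 0\<close> by simp
    then show ?case unfolding EY .
  qed
  have "((\<lambda>n. expected_spanning_trees d n / (exp c * T n)) \<longlongrightarrow> 1) ?F"
    using tendsto_cong[OF ev] lim by blast
  then show "((\<lambda>n. expected_spanning_trees d n /
      (exp ((6 * real d ^ 2 - 14 * real d + 7) / (4 * (real d - 1) ^ 2))
       * ((real d - 1) powr (1/2) / (real n * (real d - 2) powr (3/2)))
       * ((real d - 1) ^ (d - 1) / (real d ^ 2 - 2 * real d) powr (real d / 2 - 1)) ^ n)) \<longlongrightarrow> 1) ?F"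
    unfolding c_def T_def by (simp only: mult.assoc)
qed

end
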